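(* Let $N \geq 2$, $T, \sigma, \gamma > 0$, let $\mathbf b = (b^1,\dots,b^N) \in \{-1,1\}^N$ be such that $b^i = -b^j$ for some $i,j$, and let the (random) initial condition $\mathbf X_0$ with values in $(\mathbb R^2)^N$ be exchangeable with respect to $\mathbf b$. Suppose that there exists a weak solution $\mathbf X = (X^1,\dots,X^N)$ on $[0,T]$, with initial condition $\mathbf X_0$, of the system $$dX_t^i = \sigma\, dB_t^i + \gamma \sum_{j=1}^N b^i b^j K(X_t^i - X_t^j)\, dt, \qquad i=1,\dots,N.$$ For $t \in [0,T]$ let $D_t := \min_{i \neq j} |X_t^i - X_t^j|$. Then $$\mathbb P\Big( \inf_{0 \leq t \leq T} D_t = 0 \Big) > 0.$$
   Context: $K:\mathbb R^2 \to \mathbb R^2$ is given by $K(x) = x/|x|^2$ for $x \neq 0$ and $K(0) := 0$. Exchangeability: for a permutation $s$ of $\{1,\dots,N\}$ write $(\mathbf X^s)^i := X^{s(i)}$ and $(\mathbf b^s)^i := b^{s(i)}$. Given $\mathbf b$, a random variable $\mathbf X$ in $(\mathbb R^2)^N$ is exchangeable with respect to $\mathbf b$ if $\mathbf X$ and $\mathbf X^s$ have the same law for every permutation $s$ with $\mathbf b^s = \mathbf b$. Weak solution: an $(\mathbb R^2)^N$-valued process $\mathbf X$ (on some filtered probability space $(\Omega,\mathcal F,(\mathcal F_t)_t,\mathbb P)$, started from an $\mathcal F_0$-measurable copy of $\mathbf X_0$) is a weak solution of the system on $[0,T]$ with initial condition $\mathbf X_0$ if there is a $2N$-dimensional $(\mathcal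 F_t)$-Brownian motion $\mathbf B = (B^1,\dots,B^N)$, each $B^i$ being $2$-dimensional, such that: (1) $\mathbf B$ and $\mathbf X$ are adapted to $(\mathcal F_t)$; (2) $\mathbf X$ has continuous paths a.s.; (3) $\int_0^T \sum_{i=1}^N \big| \sum_{j=1}^N b^i b^j K(X_s^i - X_s^j) \big|\, ds < \infty$ a.s.; (4) a.s., for all $t\in[0,T]$ and all $i$, $X_t^i = X_0^i + \sigma B_t^i + \gamma \int_0^t \sum_{j=1}^N b^i b^j K(X_s^i - X_s^j)\, ds$. *)

theory Defs
  imports "HOL-Probability.Probability"
begin

text \<open>
  The particles are indexed by a finite type \<open>'n\<close>, so that \<open>N = CARD('n)\<close> and a configuration in
  \<open>(\<real>\<^sup>2)\<^sup>N\<close> is an element of \<open>real ^ 2 ^ 'n\<close>.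
\<close>

definition interaction_kernel :: "real ^ 2 \<Rightarrow> real ^ 2" where
  "interaction_kernel x = (if x = 0 then 0 else x /\<^sub>R (norm x)\<^sup>2)"

definition permute_vec :: "('n \<Rightarrow> 'n) \<Rightarrow> 'c ^ 'n \<Rightarrow> 'c ^ 'n" where
  "permute_vec s v = (\<chi> i. v $ s i)"

definition exchangeable_wrt ::
  "real ^ 'n \<Rightarrow> 'a measure \<Rightarrow> ('a \<Rightarrow> real ^ 2 ^ 'n) \<Rightarrow> bool" where
  "exchangeable_wrt b M X \<longleftrightarrow>
     (\<forall>s. s permutes UNIV \<longrightarrow> permute_vec s b = b \<longrightarrow>
        distr M borel (\<lambda>\<omega>. permute_vec s (X \<omega>)) = distr M borel X)"

text \<open>
  Only the times in \<open>[0,T]\<close> matter below. A filtration indexed by \<open>[0,T]\<close> is extended to all real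
  times, as the library locale requires, by keeping it constant outside of \<open>[0,T]\<close>. No completeness
  or right-continuity is assumed.
\<close>

definition filtered_prob_space :: "'a measure \<Rightarrow> (real \<Rightarrow> 'a measure) \<Rightarrow> bool" where
  "filtered_prob_space M F \<longleftrightarrow>
     prob_space M \<and> filtration (space M) F \<and> (\<forall>t. subalgebra M (F t))"

definition adapted_upto ::
  "real \<Rightarrow> (real \<Rightarrow> 'a measure) \<Rightarrow> (real \<Rightarrow> 'a \<Rightarrow> 'v::topological_space) \<Rightarrow> bool" where
  "adapted_upto T F Y \<longleftrightarrow> (\<forall>t\<in>{0..T}. Y t \<in> borel_measurable (F t))"

text \<open>
  Standard \<open>DIM('v)\<close>-dimensional Brownian motion on \<open>[0,T]\<close> relative to the filtration \<open>F\<close>. The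
  product density says that the coordinates of an increment are independent and centred normal with
  variance \<open>t - s\<close>. For \<open>'v = real ^ 2 ^ 'n\<close> the dimension is \<open>2N\<close>, and \<open>B t \<omega> $ i\<close> is the
  two-dimensional Brownian motion driving particle \<open>i\<close>.
\<close>

definition brownian_motion_upto ::
  "real \<Rightarrow> 'a measure \<Rightarrow> (real \<Rightarrow> 'a measure) \<Rightarrow> (real \<Rightarrow> 'a \<Rightarrow> 'v::euclidean_space) \<Rightarrow> bool" where
  "brownian_motion_upto T M F B \<longleftrightarrow>
     adapted_upto T F B \<and>
     (AE \<omega> in M. B 0 \<omega> = 0) \<and>
     (AE \<omega> in M. continuous_on {0..T} (\<lambda>t. B t \<omega>)) \<and>
     (\<forall>s t. 0 \<le> s \<longrightarrow> s < t \<longrightarrow> t \<le> T \<longrightarrow>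
        prob_space.indep_set M (sets (F s))
          {(\<lambda>\<omega>. B t \<omega> - B s \<omega>) -` A \<inter> space M | A. A \<in> sets borel} \<and>
        distributed M lborel (\<lambda>\<omega>. B t \<omega> - B s \<omega>)
          (\<lambda>x. ennreal (\<Prod>e\<in>Basis. normal_density 0 (sqrt (t - s)) (x \<bullet> e))))"

definition interaction :: "real ^ 'n \<Rightarrow> real ^ 2 ^ 'n \<Rightarrow> 'n \<Rightarrow> real ^ 2" where
  "interaction b x i = (\<Sum>j\<in>UNIV. (b $ i * b $ j) *\<^sub>R interaction_kernel (x $ i - x $ j))"

text \<open>
  The initial condition \<open>X\<^sub>0\<close> lives on its own probability space \<open>M\<^sub>0\<close>; the solution starts from
  \<open>X 0\<close>, which is \<open>F 0\<close>-measurable by adaptedness and has the law of \<open>X\<^sub>0\<close>.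
\<close>

definition weak_solution ::
  "real \<Rightarrow> real \<Rightarrow> real \<Rightarrow> real ^ 'n \<Rightarrow> 'b measure \<Rightarrow> ('b \<Rightarrow> real ^ 2 ^ 'n) \<Rightarrow>
   'a measure \<Rightarrow> (real \<Rightarrow> 'a measure) \<Rightarrow> (real \<Rightarrow> 'a \<Rightarrow> real ^ 2 ^ 'n) \<Rightarrow> bool" where
  "weak_solution T \<sigma> \<gamma> b M\<^sub>0 X\<^sub>0 M F X \<longleftrightarrow>
     filtered_prob_space M F \<and>
     distr M borel (X 0) = distr M\<^sub>0 borel X\<^sub>0 \<and>
     (\<exists>B. brownian_motion_upto T M F B \<and>
        adapted_upto T F B \<and> adapted_upto T F X \<and>
        (AE \<omega> in M. continuous_on {0..T} (\<lambda>t. X t \<omega>)) \<and>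
        (AE \<omega> in M.
           (\<integral>\<^sup>+ s\<in>{0..T}. ennreal (\<Sum>i\<in>UNIV. norm (interaction b (X s \<omega>) i)) \<partial>lborel) < \<infinity>) \<and>
        (AE \<omega> in M. \<forall>t\<in>{0..T}. \<forall>i.
           X t \<omega> $ i = X 0 \<omega> $ i + \<sigma> *\<^sub>R (B t \<omega> $ i)
             + \<gamma> *\<^sub>R (LINT s:{0..t}|lborel. interaction b (X s \<omega>) i)))"

definition min_distance :: "real ^ 2 ^ 'n \<Rightarrow> real" where
  "min_distance x = Min {norm (x $ i - x $ j) | i j. i \<noteq> j}"

end

theory Submission
  imports Defs
begin

text \<open>
  Suppose that almost surely no two particles ever meet. Comparing the system with barrier functions
  \<open>u = s\<^sub>+\<^sup>3\<close>, whose expected value along the process can be estimated from below by discretising time,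
  gives two facts. First, the process follows any given segment of collision-free configurations with
  positive probability, because additive noise can push it along a thin tube in which the drift is
  bounded. Hence at time \<open>T/2\<close> it is, with positive probability, as close as we like to a configuration
  \<open>y0\<close> where exactly one pair of opposite particles coincides. Secondly, near \<open>y0\<close> the distance \<open>\<rho>\<close> of
  this pair behaves like a Bessel process of dimension less than two, so that a small power of \<open>\<rho>\<close> is a
  strict supermartingale, and a process that starts close enough to \<open>y0\<close> must make \<open>\<rho>\<close> vanish before
  time \<open>T\<close> with positive probability. This is a contradiction.
\<close>

subsection \<open>Gaussian increments\<close>

text \<open>The drift is singular at collisions and globally only integrable along paths. Neither
  stochastic integrals nor a change of measure is used: every estimate lives on a compact set where
  the drift is continuous, and the barriers vanish outside it, except possibly near collisions. The
  power 3 is the smallest integer power for which \<open>max 0 s ^ 3\<close> has a Lipschitz second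
  derivative. A time step \<open>h\<close> then leaves a remainder of order
  \<open>h * sqrt h\<close>, and over about \<open>1/h\<close> steps these remainders sum to
  something that tends to 0. For the pair of opposite sign, the relative position \<open>z\<close>
  has noise of variance \<open>2 \<sigma>\<^sup>2\<close> per coordinate and the drift
  \<open>- 2 \<gamma> z / |z|\<^sup>2\<close> up to bounded terms. Up to a constant time change its
  length is of Bessel type with dimension \<open>2 - 2 \<gamma> / \<sigma>\<^sup>2\<close>, which is
  below two for all positive \<gamma> and \<sigma>, so no comparison between these two constants
  enters. A single coinciding pair in \<open>y0\<close> keeps all other interaction terms bounded
  nearby, and on a small ball they are dominated by the attraction of the pair. The law of the
  initial condition is arbitrary; if there are no collisions, its support contains a collision-free
  point at which the tube can start.\<close>

definition gauss :: "real \<Rightarrow> 'e::euclidean_space measure" where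
  "gauss h = density lborel (\<lambda>x. ennreal (\<Prod>e\<in>Basis. normal_density 0 (sqrt h) (x \<bullet> e)))"

lemma space_gauss [simp]: "space (gauss h) = UNIV"
  and sets_gauss [simp, measurable_cong]: "sets (gauss h) = sets borel"
  by (simp_all add: gauss_def)

text \<open>Fubini: \<open>lborel\<close> on a Euclidean space is the image of a product of real
  \<open>lborel\<close> measures under the coordinate map (\<open>lborel_eq\<close>), and there both
  the density and the integrand are products over the coordinates.\<close>

lemma
  fixes f :: "'e::euclidean_space \<Rightarrow> real \<Rightarrow> real"
  assumes h: "h > 0"
    and [measurable]: "\<And>e. f e \<in> borel_measurable borel"
    and int: "\<And>e. e \<in> Basis \<Longrightarrow> integrable lborel (\<lambda>x. normal_density 0 (sqrt h) x * f e x)"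
  shows gauss_integrable_prod: "integrable (gauss h) (\<lambda>y. \<Prod>e\<in>Basis. f e (y \<bullet> e))"
    and gauss_integral_prod:
      "(LINT y|gauss h. (\<Prod>e\<in>Basis. f e (y \<bullet> e)))
        = (\<Prod>e\<in>Basis. LINT x|lborel. normal_density 0 (sqrt h) x * f e x)"
proof -
  interpret product_sigma_finite "\<lambda>_::'e. lborel :: real measure" by standard
  let ?g = "\<lambda>e x. normal_density 0 (sqrt h) x * f e x"
  have [measurable]: "(\<lambda>x::'e. \<Prod>e\<in>Basis. normal_density 0 (sqrt h) (x \<bullet> e)) \<in> borel_measurable borel"
    "(\<lambda>x::'e. \<Prod>e\<in>Basis. f e (x \<bullet> e)) \<in> borel_measurable borel"
    by measurable
  have comp: "(\<lambda>x::'e \<Rightarrow> real. \<Prod>e\<in>Basis. ?g e ((\<Sum>b\<in>Basis. x b *\<^sub>R b) \<bullet> e)) = (\<lambda>x. \<Prod>e\<in>Basis. ?g e (x e))"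
    by (rule ext, rule prod.cong) (auto simp: inner_sum_left inner_Basis if_distrib[where f="\<lambda>u. _ * u"] sum.delta cong: if_cong)
  have meas: "(\<lambda>f. \<Sum>b\<in>Basis. f b *\<^sub>R b) \<in> (\<Pi>\<^sub>M b\<in>(Basis::'e set). lborel) \<rightarrow>\<^sub>M borel"
    by measurable
  have gm: "(\<lambda>y::'e. \<Prod>e\<in>Basis. ?g e (y \<bullet> e)) \<in> borel_measurable borel" by measurable
  have eq: "(\<lambda>y::'e. (\<Prod>e\<in>Basis. normal_density 0 (sqrt h) (y \<bullet> e)) *\<^sub>R (\<Prod>e\<in>Basis. f e (y \<bullet> e)))
      = (\<lambda>y. \<Prod>e\<in>Basis. ?g e (y \<bullet> e))"
    by (simp add: prod.distrib)
  have nn: "AE y::'e in lborel. 0 \<le> (\<Prod>e\<in>Basis. normal_density 0 (sqrt h) (y \<bullet> e))"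
    by (simp add: prod_nonneg)
  have "integrable lborel (\<lambda>y::'e. \<Prod>e\<in>Basis. ?g e (y \<bullet> e))"
    unfolding lborel_eq[where 'a='e] integrable_distr_eq[OF meas gm] comp
    by (rule product_integrable_prod) (auto intro: int)
  then show "integrable (gauss h) (\<lambda>y::'e. \<Prod>e\<in>Basis. f e (y \<bullet> e))"
    unfolding gauss_def by (subst integrable_density[OF _ _ nn]) (auto simp only: eq measurable_lborel1, measurable)
  have "(LINT y|gauss h. (\<Prod>e\<in>Basis. f e (y \<bullet> e))) = (LINT y::'e|lborel. (\<Prod>e\<in>Basis. ?g e (y \<bullet> e)))"
    unfolding gauss_def by (subst integral_density[OF _ _ nn]) (auto simp only: eq measurable_lborel1, measurable)
  also have "\<dots> = (LINT x|(Pi\<^sub>M (Basis::'e set) (\<lambda>b. lborel)). (\<Prod>e\<in>Basis. ?g e (x e)))"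
    unfolding lborel_eq[where 'a='e] integral_distr[OF meas gm] comp ..
  also have "\<dots> = (\<Prod>e\<in>Basis. LINT x|lborel. normal_density 0 (sqrt h) x * f e x)"
    by (rule product_integral_prod) (auto intro: int)
  finally show "(LINT y|gauss h. (\<Prod>e\<in>Basis. f e (y \<bullet> e)))
        = (\<Prod>e\<in>Basis. LINT x|lborel. normal_density 0 (sqrt h) x * f e x)" .
qed

lemma prob_space_gauss: assumes "h > 0" shows "prob_space (gauss h)"
proof
  have "emeasure (gauss h) (UNIV :: 'a set) = (\<Prod>e\<in>(Basis::'a set). \<integral>\<^sup>+x. ennreal (normal_density 0 (sqrt h) x) \<partial>lborel)"
    unfolding gauss_def using nn_integral_lborel_prod[where 'a='a, of \<open>\<lambda>_ x. ennreal (normal_density 0 (sqrt h) x)\<close>] by (simp add: emeasure_density prod_ennreal)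
  also have "\<dots> = 1"
    using assms by (simp add: nn_integral_eq_integral)
  finally show "emeasure (gauss h) (space (gauss h :: 'a measure)) = 1"
    by simp
qed

text \<open>All moments come from the product formula with the constant function 1 in the remaining
  coordinates. The mixed second moment is 0 because the product then contains a factor that is a
  centred first moment.\<close>

lemma gauss_inner_Basis:
  fixes e e' :: "'e::euclidean_space"
  assumes h: "h > 0" and e: "e \<in> Basis" and e': "e' \<in> Basis"
  shows "integrable (gauss h) (\<lambda>y. y \<bullet> e)" "(LINT y|gauss h. y \<bullet> e) = 0"
    "integrable (gauss h) (\<lambda>y. (y \<bullet> e) * (y \<bullet> e'))"
    "(LINT y|gauss h. (y \<bullet> e) * (y \<bullet> e')) = (if e = e' then h else 0)"
    "integrable (gauss h) (\<lambda>y. \<bar>y \<bullet> e\<bar> ^ 3)"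
    "(LINT y|gauss h. \<bar>y \<bullet> e\<bar> ^ 3) = 2 * sqrt (2 / pi) * (h * sqrt h)"
proof -
  have sh: "sqrt h > 0" using h by simp
  have i0: "integrable lborel (\<lambda>x. normal_density 0 (sqrt h) x * 1)"
    and i1: "integrable lborel (\<lambda>x. normal_density 0 (sqrt h) x * x)"
    and i2: "integrable lborel (\<lambda>x. normal_density 0 (sqrt h) x * (x*x))"
    and i3: "integrable lborel (\<lambda>x. normal_density 0 (sqrt h) x * \<bar>x\<bar>^3)"
    using integrable_normal_moment[OF sh, of 0 1] integrable_normal_moment[OF sh, of 0 2]
      integrable_normal_moment_abs[OF sh, of 0 3] sh by (simp_all add: power2_eq_square)
  have v: "(LINT x|lborel. normal_density 0 (sqrt h) x * 1) = 1"
    "(LINT x|lborel. normal_density 0 (sqrt h) x * x) = 0"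
    "(LINT x|lborel. normal_density 0 (sqrt h) x * (x*x)) = h"
    "(LINT x|lborel. normal_density 0 (sqrt h) x * \<bar>x\<bar>^3) = 2 * sqrt (2 / pi) * (h * sqrt h)"
    using integral_normal_moment_odd[OF sh, of 0 0] integral_normal_moment_even[OF sh, of 0 1]
      integral_normal_moment_abs_odd[OF sh, of 0 1] sh h
    by (simp_all add: power2_eq_square power3_eq_cube)
  have P: "(\<Prod>b\<in>Basis. if b = e then (g (y \<bullet> b)::real) else 1) = g (y \<bullet> e)" for g y
    using e by (subst prod.delta) auto
  have single: "integrable (gauss h) (\<lambda>y::'e. g (y \<bullet> e))" 
    "(LINT y|gauss h. g ((y::'e) \<bullet> e)) = (LINT x|lborel. normal_density 0 (sqrt h) x * g x)"
    if g: "integrable lborel (\<lambda>x. normal_density 0 (sqrt h) x * g x)" "g \<in> borel_measurable borel" for g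
  proof -
    let ?f = "\<lambda>b x. if b = e then g x else 1"
    have m: "?f b \<in> borel_measurable borel" for b
      using g(2) by (cases "b = e") auto
    have i: "integrable lborel (\<lambda>x. normal_density 0 (sqrt h) x * ?f b x)" for b
      using g(1) i0 by (cases "b = e") auto
    show "integrable (gauss h) (\<lambda>y::'e. g (y \<bullet> e))"
      using gauss_integrable_prod[OF h, of ?f, OF m i] by (simp add: P)
    have "(LINT y|gauss h. g ((y::'e) \<bullet> e)) = (\<Prod>b\<in>Basis. LINT x|lborel. normal_density 0 (sqrt h) x * ?f b x)"
      using gauss_integral_prod[OF h, of ?f, OF m i] by (simp add: P)
    also have "\<dots> = (\<Prod>b\<in>Basis. if b = e then (LINT x|lborel. normal_density 0 (sqrt h) x * g x) else 1)"
      using v(1) by (intro prod.cong) auto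
    finally show "(LINT y|gauss h. g ((y::'e) \<bullet> e)) = (LINT x|lborel. normal_density 0 (sqrt h) x * g x)"
      using e by (simp add: prod.delta)
  qed
  show "integrable (gauss h) (\<lambda>y. y \<bullet> e)" "(LINT y|gauss h. y \<bullet> e) = 0"
    using single[OF i1] v by auto
  show "integrable (gauss h) (\<lambda>y. \<bar>y \<bullet> e\<bar> ^ 3)"
    "(LINT y|gauss h. \<bar>y \<bullet> e\<bar> ^ 3) = 2 * sqrt (2 / pi) * (h * sqrt h)"
    using single[OF i3] v by auto
  have "integrable (gauss h) (\<lambda>y. (y \<bullet> e) * (y \<bullet> e')) \<and>
    (LINT y|gauss h. (y \<bullet> e) * (y \<bullet> e')) = (if e = e' then h else 0)"
  proof (cases "e = e'")
    case True
    then show ?thesis using single[OF i2] v by auto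
  next
    case False
    let ?f = "\<lambda>b x. if b = e \<or> b = e' then x else (1::real)"
    have m: "?f b \<in> borel_measurable borel" for b
      by (cases "b = e \<or> b = e'") auto
    have i: "integrable lborel (\<lambda>x. normal_density 0 (sqrt h) x * ?f b x)" for b
      using i0 i1 by (cases "b = e \<or> b = e'") auto
    have P2: "(\<Prod>b\<in>Basis. ?f b (y \<bullet> b)) = (y \<bullet> e) * (y \<bullet> e')" for y :: 'e
    proof -
      have "(\<Prod>b\<in>Basis. ?f b (y \<bullet> b)) = (\<Prod>b\<in>{e, e'}. ?f b (y \<bullet> b))"
        by (rule prod.mono_neutral_right) (use e e' in auto)
      also have "\<dots> = (y \<bullet> e) * (y \<bullet> e')" using False by simp
      finally show ?thesis .
    qed
    have "(\<Prod>b\<in>Basis. LINT x|lborel. normal_density 0 (sqrt h) x * ?f b x) = 0"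
      by (rule prod_zero[OF finite_Basis], rule bexI[OF _ e]) (use v(2) in simp)
    then show ?thesis
      using gauss_integrable_prod[OF h, of ?f, OF m i] gauss_integral_prod[OF h, of ?f, OF m i] False by (simp add: P2)
  qed
  then show "integrable (gauss h) (\<lambda>y. (y \<bullet> e) * (y \<bullet> e'))"
    "(LINT y|gauss h. (y \<bullet> e) * (y \<bullet> e')) = (if e = e' then h else 0)" by auto
qed

lemma gauss_inner:
  fixes a :: "'e::euclidean_space"
  assumes h: "h > 0"
  shows "integrable (gauss h) (\<lambda>y. a \<bullet> y)" "(LINT y|gauss h. a \<bullet> y) = 0"
    "integrable (gauss h) (\<lambda>y. (a \<bullet> y)\<^sup>2)" "(LINT y|gauss h. (a \<bullet> y)\<^sup>2) = h * (norm a)\<^sup>2"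
proof -
  note G = gauss_inner_Basis[OF h]
  define c where "c = (\<lambda>e. a \<bullet> e)"
  have e: "a \<bullet> y = (\<Sum>e\<in>Basis. c e * (y \<bullet> e))" for y
    unfolding c_def by (rule euclidean_inner)
  show "integrable (gauss h) (\<lambda>y. a \<bullet> y)"
    unfolding e by (intro Bochner_Integration.integrable_sum integrable_mult_right G(1)) auto
  show "(LINT y|gauss h. a \<bullet> y) = 0"
    unfolding e by (subst Bochner_Integration.integral_sum) (auto intro!: integrable_mult_right G simp: G(2))
  have e2: "(a \<bullet> y)\<^sup>2 = (\<Sum>e\<in>Basis. \<Sum>e'\<in>Basis. c e * c e' * ((y \<bullet> e) * (y \<bullet> e')))" for y
    unfolding power2_eq_square e sum_product by (simp add: ac_simps)
  show "integrable (gauss h) (\<lambda>y. (a \<bullet> y)\<^sup>2)"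
    unfolding e2 by (intro Bochner_Integration.integrable_sum integrable_mult_right G(3)) auto
  have "(LINT y|gauss h. (a \<bullet> y)\<^sup>2) = (\<Sum>e\<in>Basis. \<Sum>e'\<in>Basis. c e * c e' * (if e = e' then h else 0))"
    unfolding e2 by (simp add: Bochner_Integration.integral_sum G(3,4))
  also have "\<dots> = (\<Sum>e\<in>Basis. h * (c e * c e))"
    by (intro sum.cong refl) (simp add: if_distrib[where f="\<lambda>u. _ * u"] sum.delta' cong: if_cong)
  also have "\<dots> = h * (norm a)\<^sup>2"
    by (simp add: power2_norm_eq_inner e[of a] c_def sum_distrib_left)
  finally show "(LINT y|gauss h. (a \<bullet> y)\<^sup>2) = h * (norm a)\<^sup>2" .
qed

lemma gauss_norm_square:
  assumes h: "h > 0"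
  shows "integrable (gauss h) (\<lambda>y::'e::euclidean_space. (norm y)\<^sup>2)"
    "(LINT y|gauss h. (norm (y::'e))\<^sup>2) = h * DIM('e)"
proof -
  have e: "(norm y)\<^sup>2 = (\<Sum>e\<in>Basis. (e \<bullet> y)\<^sup>2)" for y :: 'e
    unfolding power2_norm_eq_inner by (subst euclidean_inner) (simp add: power2_eq_square inner_commute)
  show "integrable (gauss h) (\<lambda>y::'e. (norm y)\<^sup>2)"
    unfolding e by (intro Bochner_Integration.integrable_sum gauss_inner[OF h])
  show "(LINT y|gauss h. (norm (y::'e))\<^sup>2) = h * DIM('e)"
    unfolding e by (simp add: Bochner_Integration.integral_sum gauss_inner[OF h])
qed

text \<open>Brownian scaling: under \<open>gauss h\<close> the quantity
  \<open>sqrt h + norm y\<close> has size \<open>sqrt h\<close>. Its cube is the unit in which every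
  remainder of a time step is measured.\<close>

lemma gauss_norm_cube_le:
  "\<exists>C. \<forall>h>0. integrable (gauss h) (\<lambda>y::'e::euclidean_space. (sqrt h + norm y) ^ 3) \<and>
    (LINT y|gauss h. (sqrt h + norm (y::'e)) ^ 3) \<le> C * (h * sqrt h)"
proof -
  have sum_cube: "(\<Sum>i\<in>I. x i) ^ 3 \<le> real (card I) ^ 3 * (\<Sum>i\<in>I. x i ^ 3)"
    if I: "finite I" and x: "\<And>i. i \<in> I \<Longrightarrow> x i \<ge> 0" for I and x :: "'e \<Rightarrow> real"
  proof (cases "I = {}")
    case False
    define m where "m = Max (x ` I)"
    have "m \<in> x ` I" unfolding m_def using I False by (intro Max_in) auto
    then obtain i0 where i0: "i0 \<in> I" "m = x i0" by auto
    have "(\<Sum>i\<in>I. x i) \<le> real (card I) * m"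
      using sum_bounded_above[of I x m] I unfolding m_def by auto
    then have "(\<Sum>i\<in>I. x i) ^ 3 \<le> (real (card I) * m) ^ 3"
      by (intro power_mono sum_nonneg x)
    also have "\<dots> = real (card I) ^ 3 * m ^ 3" by (simp add: power_mult_distrib)
    also have "m ^ 3 \<le> (\<Sum>i\<in>I. x i ^ 3)"
      unfolding i0(2) using member_le_sum[of i0 I "\<lambda>i. x i ^ 3"] I i0 x by auto
    finally show ?thesis by (simp add: mult_left_mono)
  qed simp
  define d where "d = real DIM('e)"
  \<comment> \<open>The 4 comes from \<open>(a + c) ^ 3 \<le> 4 * (a ^ 3 + c ^ 3)\<close>, the
    factor \<open>d ^ 3\<close> from bounding a sum of \<open>d\<close> coordinates by
    \<open>d\<close> times the largest, and the rest is the sum of \<open>d\<close> third absolute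
    moments.\<close>
  define C where "C = 4 * (1 + d ^ 3 * (d * (2 * sqrt (2 / pi))))"
  have "integrable (gauss h) (\<lambda>y::'e. (sqrt h + norm y) ^ 3) \<and>
    (LINT y|gauss h. (sqrt h + norm (y::'e)) ^ 3) \<le> C * (h * sqrt h)" if h: "h > 0" for h
  proof -
    interpret prob_space "gauss h :: 'e measure" by (rule prob_space_gauss[OF h])
    note G = gauss_inner_Basis[OF h]
    define b where "b = (\<lambda>y::'e. 4 * (h * sqrt h + d ^ 3 * (\<Sum>e\<in>Basis. \<bar>y \<bullet> e\<bar> ^ 3)))"
    have ib: "integrable (gauss h) b"
      unfolding b_def by (intro integrable_mult_right Bochner_Integration.integrable_add Bochner_Integration.integrable_sum G(5)) auto
    have le: "(sqrt h + norm y) ^ 3 \<le> b y" for y :: 'e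
    proof -
      have c: "(a + c) ^ 3 \<le> 4 * (a ^ 3 + c ^ 3)" if "a \<ge> 0" "c \<ge> 0" for a c :: real
      proof -
        have "4 * (a ^ 3 + c ^ 3) - (a + c) ^ 3 = 3 * (a + c) * (a - c)\<^sup>2"
          by (simp add: power2_eq_square power3_eq_cube algebra_simps)
        also have "\<dots> \<ge> 0" using that by simp
        finally show ?thesis by simp
      qed
      have "norm y ^ 3 \<le> (\<Sum>e\<in>Basis. \<bar>y \<bullet> e\<bar>) ^ 3"
        by (intro power_mono norm_le_l1) simp
      also have "\<dots> \<le> d ^ 3 * (\<Sum>e\<in>Basis. \<bar>y \<bullet> e\<bar> ^ 3)"
        unfolding d_def by (rule sum_cube) auto
      finally have "norm y ^ 3 \<le> d ^ 3 * (\<Sum>e\<in>Basis. \<bar>y \<bullet> e\<bar> ^ 3)" .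
      moreover have "sqrt h ^ 3 = h * sqrt h"
        using h by (simp add: power3_eq_cube)
      moreover have "(sqrt h + norm y) ^ 3 \<le> 4 * (sqrt h ^ 3 + norm y ^ 3)"
        by (rule c) (use h in auto)
      ultimately show ?thesis unfolding b_def distrib_left by linarith
    qed
    have i: "integrable (gauss h) (\<lambda>y::'e. (sqrt h + norm y) ^ 3)"
      by (rule Bochner_Integration.integrable_bound[OF ib]) (use le h in \<open>auto intro!: AE_I2 order.trans[OF le]\<close>)
    have "(LINT y|gauss h. (sqrt h + norm (y::'e)) ^ 3) \<le> (LINT y|gauss h. b y)"
      by (rule integral_mono[OF i ib le])
    also have "\<dots> = C * (h * sqrt h)"
      unfolding b_def using prob_space
      by (simp add: G(5,6) Bochner_Integration.integral_sum C_def d_def algebra_simps)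
    finally show ?thesis using i by blast
  qed
  then show ?thesis by blast
qed

subsection \<open>Truncated cubes under a Gaussian step\<close>

text \<open>Second order Taylor expansion of \<open>max 0 s ^ 3\<close> from below, for an increment
  whose part \<open>l\<close> has order \<rho> and whose parts \<open>al\<close> and
  \<open>q\<close> have order \<open>\<rho>\<^sup>2\<close>; hence only \<open>l\<^sup>2\<close>
  appears in the second order term. In applications \<rho> is \<open>sqrt h + norm y\<close>. A
  lower bound on \<open>s'\<close> suffices because the truncated cube is monotone.\<close>

lemma cube_composition_scalar:
  fixes m S C0 :: real
  assumes m: "m \<ge> 0" and S: "S \<ge> 0" and C0: "C0 \<ge> 0"
  obtains C where "C \<ge> 0"
    "\<And>s al l q \<rho> s'. 0 \<le> \<rho> \<Longrightarrow> max 0 s \<le> S \<Longrightarrow> \<bar>al\<bar> \<le> m * \<rho>\<^sup>2 \<Longrightarrow> \<bar>l\<bar> \<le> m * \<rho> \<Longrightarrow> \<bar>q\<bar> \<le> m * \<rho>\<^sup>2 \<Longrightarrow>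
       (\<rho> \<le> 1 \<Longrightarrow> s + al + l + q - C0 * \<rho> ^ 3 \<le> s') \<Longrightarrow>
       max 0 s ^ 3 + 3 * (max 0 s)\<^sup>2 * (al + l + q) + 3 * max 0 s * l\<^sup>2 - C * \<rho> ^ 3 \<le> max 0 s' ^ 3"
proof
  \<comment> \<open>\<open>Ca\<close> pays for \<open>\<rho> > 1\<close>, where all terms are at
    most multiples of \<open>\<rho> ^ 3\<close>. \<open>Cb\<close> pays for
    \<open>\<rho> \<le> 1\<close>: its summands are the errors in the linear, quadratic and cubic
    terms of the expansion of \<open>(p + d) ^ 3\<close>.\<close>
  define Ca where "Ca = S ^ 3 + 9 * S\<^sup>2 * m + 3 * S * m\<^sup>2"
  define Cb where "Cb = 3 * S\<^sup>2 * C0 + 6 * S * m * (2 * m + C0) + (3 * m + C0) ^ 3"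
  have Ca: "Ca \<ge> 0" and Cb: "Cb \<ge> 0" using m S C0 unfolding Ca_def Cb_def by auto
  show "Ca + Cb \<ge> 0" using Ca Cb by simp
  fix s al l q \<rho> s' :: real
  assume \<rho>: "0 \<le> \<rho>" and sS: "max 0 s \<le> S" and al: "\<bar>al\<bar> \<le> m * \<rho>\<^sup>2" and l: "\<bar>l\<bar> \<le> m * \<rho>"
    and q: "\<bar>q\<bar> \<le> m * \<rho>\<^sup>2" and s': "\<rho> \<le> 1 \<Longrightarrow> s + al + l + q - C0 * \<rho> ^ 3 \<le> s'"
  define p where "p = max 0 s"
  have p: "0 \<le> p" "p \<le> S" using sS by (auto simp: p_def)
  have r3: "\<rho> ^ 3 \<ge> 0" using \<rho> by simp
  have l2: "l\<^sup>2 \<le> m\<^sup>2 * \<rho>\<^sup>2"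
    using power_mono[OF l, of 2] by (simp add: power_mult_distrib)
  have p2: "p\<^sup>2 \<le> S\<^sup>2" "p ^ 3 \<le> S ^ 3" using p by (auto intro: power_mono)
  show "max 0 s ^ 3 + 3 * (max 0 s)\<^sup>2 * (al + l + q) + 3 * max 0 s * l\<^sup>2 - (Ca + Cb) * \<rho> ^ 3 \<le> max 0 s' ^ 3"
    unfolding p_def[symmetric]
  proof (cases "\<rho> \<le> 1")
    case False
    then have r: "\<rho> \<ge> 1" by simp
    have a: "1 \<le> \<rho> ^ 3" "\<rho> \<le> \<rho> ^ 3" "\<rho>\<^sup>2 \<le> \<rho> ^ 3"
      using r power_increasing[of 1 3 \<rho>] power_increasing[of 2 3 \<rho>] by auto
    have "al + l + q \<le> m * \<rho> ^ 3 + m * \<rho> ^ 3 + m * \<rho> ^ 3"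
      using al l q a m mult_left_mono[of \<rho> "\<rho> ^ 3" m] mult_left_mono[of "\<rho>\<^sup>2" "\<rho> ^ 3" m] by linarith
    then have "p\<^sup>2 * (al + l + q) \<le> p\<^sup>2 * (3 * m * \<rho> ^ 3)"
      by (intro mult_left_mono) auto
    also have "\<dots> \<le> S\<^sup>2 * (3 * m * \<rho> ^ 3)"
      using p2 m r3 by (intro mult_right_mono) auto
    finally have t1: "3 * p\<^sup>2 * (al + l + q) \<le> 9 * S\<^sup>2 * m * \<rho> ^ 3" by (simp add: algebra_simps)
    have "p * l\<^sup>2 \<le> S * (m\<^sup>2 * \<rho>\<^sup>2)"
      using p l2 by (intro mult_mono) auto
    also have "\<dots> \<le> S * (m\<^sup>2 * \<rho> ^ 3)"
      using a S by (intro mult_left_mono) auto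
    finally have t2: "3 * p * l\<^sup>2 \<le> 3 * S * m\<^sup>2 * \<rho> ^ 3" by simp
    have "p ^ 3 \<le> S ^ 3 * \<rho> ^ 3"
      using p2 a S mult_left_mono[of 1 "\<rho> ^ 3" "S ^ 3"] by simp
    then have "p ^ 3 + 3 * p\<^sup>2 * (al + l + q) + 3 * p * l\<^sup>2 \<le> Ca * \<rho> ^ 3"
      using t1 t2 unfolding Ca_def distrib_right by linarith
    moreover have "0 \<le> Cb * \<rho> ^ 3" using Cb r3 by simp
    moreover have "0 \<le> max 0 s' ^ 3" by simp
    ultimately show "p ^ 3 + 3 * p\<^sup>2 * (al + l + q) + 3 * p * l\<^sup>2 - (Ca + Cb) * \<rho> ^ 3 \<le> max 0 s' ^ 3"
      unfolding distrib_right by linarith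
  next
    case True
    have r32: "\<rho> ^ 3 \<le> \<rho>\<^sup>2" "\<rho>\<^sup>2 \<le> \<rho>" using True \<rho> power_decreasing[of 2 3 \<rho>] power_decreasing[of 1 2 \<rho>] by auto
    show "p ^ 3 + 3 * p\<^sup>2 * (al + l + q) + 3 * p * l\<^sup>2 - (Ca + Cb) * \<rho> ^ 3 \<le> max 0 s' ^ 3"
    proof (cases "s \<le> 0")
      case True
      then have "p = 0" by (simp add: p_def)
      moreover have "0 \<le> (Ca + Cb) * \<rho> ^ 3" using Ca Cb r3 by simp
      ultimately show ?thesis by (simp add: order.trans[of _ 0])
    next
      case False
      then have ps: "p = s" by (simp add: p_def)
      \<comment> \<open>Everything of order \<open>\<rho>\<^sup>2\<close> or smaller goes into
        \<open>w\<close>, so that \<open>d\<^sup>2\<close> falls below \<open>l\<^sup>2\<close> by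
        at most a multiple of \<open>\<rho> ^ 3\<close>.\<close>
      define w where "w = al + q - C0 * \<rho> ^ 3"
      define d where "d = l + w"
      have "p + d \<le> s'" using s'[OF True] unfolding ps d_def w_def by simp
      then have "(p + d) ^ 3 \<le> max 0 s' ^ 3"
        by (intro power_mono_odd) auto
      moreover have "(p + d) ^ 3 = p ^ 3 + 3 * p\<^sup>2 * d + 3 * p * d\<^sup>2 + d ^ 3"
        by (simp add: power2_eq_square power3_eq_cube algebra_simps)
      moreover have "3 * p\<^sup>2 * d \<ge> 3 * p\<^sup>2 * (al + l + q) - 3 * S\<^sup>2 * C0 * \<rho> ^ 3"
      proof -
        have "p\<^sup>2 * (C0 * \<rho> ^ 3) \<le> S\<^sup>2 * (C0 * \<rho> ^ 3)"
          using p2 C0 r3 by (intro mult_right_mono) auto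
        then show ?thesis unfolding d_def w_def by (simp add: algebra_simps)
      qed
      moreover have "3 * p * d\<^sup>2 \<ge> 3 * p * l\<^sup>2 - 6 * S * m * (2 * m + C0) * \<rho> ^ 3"
      proof -
        have w: "\<bar>w\<bar> \<le> (2 * m + C0) * \<rho>\<^sup>2"
        proof -
          have "C0 * \<rho> ^ 3 \<le> C0 * \<rho>\<^sup>2" "0 \<le> C0 * \<rho> ^ 3"
            using r32 r3 C0 by (auto intro!: mult_left_mono)
          moreover have "2 * m * \<rho>\<^sup>2 = m * \<rho>\<^sup>2 + m * \<rho>\<^sup>2" by simp
          ultimately show ?thesis
            using al q unfolding w_def distrib_right abs_le_iff by linarith
        qed
        have "\<bar>l * w\<bar> \<le> (m * \<rho>) * ((2 * m + C0) * \<rho>\<^sup>2)"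
          unfolding abs_mult using l w m \<rho> by (intro mult_mono) auto
        also have "\<dots> = m * (2 * m + C0) * \<rho> ^ 3" by (simp add: power2_eq_square power3_eq_cube)
        finally have lw: "\<bar>l * w\<bar> \<le> m * (2 * m + C0) * \<rho> ^ 3" .
        have "d\<^sup>2 = l\<^sup>2 + 2 * (l * w) + w\<^sup>2" unfolding d_def by (simp add: power2_eq_square algebra_simps)
        then have "d\<^sup>2 \<ge> l\<^sup>2 - 2 * (m * (2 * m + C0) * \<rho> ^ 3)"
          using lw zero_le_power2[of w] by linarith
        then have "p * d\<^sup>2 \<ge> p * (l\<^sup>2 - 2 * (m * (2 * m + C0) * \<rho> ^ 3))"
          using p by (intro mult_left_mono) auto
        moreover have "p * (2 * (m * (2 * m + C0) * \<rho> ^ 3)) \<le> S * (2 * (m * (2 * m + C0) * \<rho> ^ 3))"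
          using p m C0 r3 by (intro mult_right_mono) auto
        ultimately show ?thesis unfolding right_diff_distrib by linarith
      qed
      moreover have "d ^ 3 \<ge> - ((3 * m + C0) ^ 3 * \<rho> ^ 3)"
      proof -
        have "\<bar>d\<bar> \<le> (3 * m + C0) * \<rho>"
        proof -
          have "m * \<rho>\<^sup>2 \<le> m * \<rho>" "C0 * \<rho> ^ 3 \<le> C0 * \<rho>" "0 \<le> C0 * \<rho> ^ 3"
            using r32 r3 m C0 by (auto intro!: mult_left_mono)
          moreover have "3 * m * \<rho> = m * \<rho> + m * \<rho> + m * \<rho>" by simp
          ultimately show ?thesis using al l q unfolding d_def w_def distrib_right abs_le_iff by linarith
        qed
        then have "\<bar>d\<bar> ^ 3 \<le> ((3 * m + C0) * \<rho>) ^ 3" by (intro power_mono) auto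
        moreover have "- (\<bar>d\<bar> ^ 3) \<le> d ^ 3" by (simp add: power_abs[symmetric])
        ultimately show ?thesis by (simp add: power_mult_distrib)
      qed
      moreover have "0 \<le> Ca * \<rho> ^ 3" using Ca r3 by simp
      ultimately show ?thesis unfolding Cb_def distrib_right by linarith
    qed
  qed
qed

text \<open>The expansion of \<open>s'\<close> is needed for small \<open>y\<close> only, because the cubic error dominates everything
  else once \<open>sqrt h + norm y > 1\<close>.\<close>

lemma gauss_cube_step:
  fixes m S C0 :: real
  assumes m: "m \<ge> 0" and S: "S \<ge> 0" and C0: "C0 \<ge> 0"
  obtains C where "C \<ge> 0"
    "\<And>s \<alpha> (g::'e::euclidean_space) q \<tau> h s' Bd. 0 < h \<Longrightarrow> max 0 s \<le> S \<Longrightarrow> \<bar>\<alpha>\<bar> \<le> m \<Longrightarrow> norm g \<le> m \<Longrightarrow>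
       (\<And>y. \<bar>q y\<bar> \<le> m * (norm y)\<^sup>2) \<Longrightarrow> has_bochner_integral (gauss h) q (h * \<tau>) \<Longrightarrow>
       s' \<in> borel_measurable borel \<Longrightarrow> (\<And>y. s' y \<le> Bd) \<Longrightarrow>
       (\<And>y. sqrt h + norm y \<le> 1 \<Longrightarrow> s + \<alpha> * h + g \<bullet> y + q y - C0 * (sqrt h + norm y) ^ 3 \<le> s' y) \<Longrightarrow>
       max 0 s ^ 3 + h * (3 * (max 0 s)\<^sup>2 * (\<alpha> + \<tau>) + 3 * max 0 s * (norm g)\<^sup>2) - C * (h * sqrt h)
         \<le> (LINT y|gauss h. max 0 (s' y) ^ 3)"
proof -
  obtain C where C: "C \<ge> 0"
    "\<And>s al l q \<rho> s'. 0 \<le> \<rho> \<Longrightarrow> max 0 s \<le> S \<Longrightarrow> \<bar>al\<bar> \<le> m * \<rho>\<^sup>2 \<Longrightarrow> \<bar>l\<bar> \<le> m * \<rho> \<Longrightarrow> \<bar>q\<bar> \<le> m * \<rho>\<^sup>2 \<Longrightarrow>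
       (\<rho> \<le> 1 \<Longrightarrow> s + al + l + q - C0 * \<rho> ^ 3 \<le> s') \<Longrightarrow>
       max 0 s ^ 3 + 3 * (max 0 s)\<^sup>2 * (al + l + q) + 3 * max 0 s * l\<^sup>2 - C * \<rho> ^ 3 \<le> max 0 s' ^ 3"
    using cube_composition_scalar[OF assms] by blast
  obtain D where D: "\<And>h. h > 0 \<Longrightarrow> integrable (gauss h) (\<lambda>y::'e. (sqrt h + norm y) ^ 3)"
    "\<And>h. h > 0 \<Longrightarrow> (LINT y|gauss h. (sqrt h + norm (y::'e)) ^ 3) \<le> D * (h * sqrt h)"
    using gauss_norm_cube_le by blast
  show thesis
  proof (rule that[of "C * max 0 D"])
    show "C * max 0 D \<ge> 0" using C(1) by simp
    fix s \<alpha> :: real and g :: 'e and q s' :: "'e \<Rightarrow> real" and \<tau> h Bd :: real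
    assume h: "0 < h" and sS: "max 0 s \<le> S" and \<alpha>: "\<bar>\<alpha>\<bar> \<le> m" and g: "norm g \<le> m"
      and q: "\<And>y. \<bar>q y\<bar> \<le> m * (norm y)\<^sup>2" and qi: "has_bochner_integral (gauss h) q (h * \<tau>)"
      and [measurable]: "s' \<in> borel_measurable borel" and Bd: "\<And>y. s' y \<le> Bd"
      and s': "\<And>y. sqrt h + norm y \<le> 1 \<Longrightarrow> s + \<alpha> * h + g \<bullet> y + q y - C0 * (sqrt h + norm y) ^ 3 \<le> s' y"
    interpret prob_space "gauss h :: 'e measure" by (rule prob_space_gauss[OF h])
    define p where "p = max 0 s"
    \<comment> \<open>A pointwise minorant whose Gaussian integral is explicit:
      \<open>g \<bullet> y\<close> has mean 0, \<open>q\<close> has mean \<open>h * \<tau>\<close>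
      and \<open>(g \<bullet> y)\<^sup>2\<close> has mean
      \<open>h * (norm g)\<^sup>2\<close>.\<close>
    let ?L = "\<lambda>y::'e. p ^ 3 + 3 * p\<^sup>2 * (\<alpha> * h + g \<bullet> y + q y) + 3 * p * (g \<bullet> y)\<^sup>2 - C * (sqrt h + norm y) ^ 3"
    note G = gauss_inner[OF h] and [simp] = D(1)[OF h]
    have qi': "integrable (gauss h) q" "(LINT y|gauss h. q y) = h * \<tau>"
      using qi by (auto simp: has_bochner_integral_iff)
    have le: "?L y \<le> max 0 (s' y) ^ 3" for y
      unfolding p_def
    proof (rule C(2)[OF _ sS])
      let ?r = "sqrt h + norm y"
      show r: "0 \<le> ?r" using h by simp
      have "h \<le> ?r\<^sup>2"
        using power_mono[of "sqrt h" ?r 2] h by simp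
      then show "\<bar>\<alpha> * h\<bar> \<le> m * ?r\<^sup>2"
        unfolding abs_mult using \<alpha> h m by (intro mult_mono) auto
      have "\<bar>g \<bullet> y\<bar> \<le> norm g * norm y" by (rule Cauchy_Schwarz_ineq2)
      also have "\<dots> \<le> m * ?r" using g h m by (intro mult_mono) auto
      finally show "\<bar>g \<bullet> y\<bar> \<le> m * ?r" .
      have "m * (norm y)\<^sup>2 \<le> m * ?r\<^sup>2" using m h by (intro mult_left_mono power_mono) auto
      with q[of y] show "\<bar>q y\<bar> \<le> m * ?r\<^sup>2" by linarith
    qed (rule s')
    have iL: "integrable (gauss h) ?L"
      by (intro Bochner_Integration.integrable_diff Bochner_Integration.integrable_add integrable_mult_right G qi' D h) auto
    have "max 0 (s' y) ^ 3 \<le> max 0 Bd ^ 3" for y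
      using Bd[of y] by (intro power_mono) auto
    then have iR: "integrable (gauss h) (\<lambda>y. max 0 (s' y) ^ 3)"
      by (intro integrable_const_bound[where B="max 0 Bd ^ 3"]) auto
    have "(LINT y|gauss h. ?L y) \<le> (LINT y|gauss h. max 0 (s' y) ^ 3)"
      by (rule integral_mono[OF iL iR le])
    moreover have "(LINT y|gauss h. ?L y) = p ^ 3 + 3 * p\<^sup>2 * (\<alpha> * h + h * \<tau>) + 3 * p * (h * (norm g)\<^sup>2)
        - C * (LINT y|gauss h. (sqrt h + norm (y::'e)) ^ 3)"
      using prob_space by (simp add: G qi')
    moreover have "C * (LINT y|gauss h. (sqrt h + norm (y::'e)) ^ 3) \<le> C * (max 0 D * (h * sqrt h))"
    proof -
      have "D * (h * sqrt h) \<le> max 0 D * (h * sqrt h)" using h by (intro mult_right_mono) auto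
      then show ?thesis using D(2)[OF h] C(1) by (intro mult_left_mono) auto
    qed
    ultimately show "max 0 s ^ 3 + h * (3 * (max 0 s)\<^sup>2 * (\<alpha> + \<tau>) + 3 * max 0 s * (norm g)\<^sup>2) - C * max 0 D * (h * sqrt h)
         \<le> (LINT y|gauss h. max 0 (s' y) ^ 3)"
      unfolding p_def[symmetric] by (simp add: algebra_simps)
  qed
qed

subsection \<open>Processes with additive noise\<close>

text \<open>Density of the rationals, taken in the parameter \<open>r\<close> of the interval and
  not in the time itself. One countable index set thus serves all intervals and contains both end
  points, whether or not these are rational.\<close>

lemma continuous_le_rational:
  fixes f :: "real \<Rightarrow> real"
  assumes ab: "a < b" and f: "continuous_on {a..b} f" and s: "s \<in> {a..b}"
    and le: "\<And>r. r \<in> \<rat> \<inter> {0..1} \<Longrightarrow> f (a + r * (b - a)) \<le> \<delta>"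
  shows "f s \<le> \<delta>"
proof -
  let ?f = "\<lambda>r. f (a + r * (b - a))"
  have r: "closure ({0<..<1} \<inter> \<rat>) = {0..1::real}"
    using closure_open_Int_superset[of "{0<..<1::real}" \<rat>] by (simp add: Rats_closure_real)
  have "(\<lambda>r. a + r * (b - a)) ` {0..1} \<subseteq> {a..b}"
  proof safe
    fix x :: real assume x: "x \<in> {0..1}"
    then have "x * (b - a) \<le> b - a" "0 \<le> x * (b - a)" using ab by (auto intro: mult_left_le_one_le)
    then have "a \<le> a + x * (b - a)" "a + x * (b - a) \<le> b" by linarith+
    then show "a + x * (b - a) \<in> {a..b}" by simp
  qed
  then have cf: "continuous_on {0..1} ?f"
    by (rule continuous_on_compose2[OF f, rotated]) (intro continuous_intros)
  have sr: "(s - a) / (b - a) \<in> {0..1}"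
    using s ab by (simp add: divide_le_eq)
  have "?f ((s - a) / (b - a)) \<le> \<delta>"
  proof (rule continuous_le_on_closure[of "{0<..<1} \<inter> \<rat>" ?f])
    show "continuous_on (closure ({0<..<1} \<inter> \<rat>)) ?f" unfolding r by (rule cf)
    show "(s - a) / (b - a) \<in> closure ({0<..<1} \<inter> \<rat>)" unfolding r by (rule sr)
    show "?f x \<le> \<delta>" if "x \<in> {0<..<1} \<inter> \<rat>" for x using that by (intro le) auto
  qed
  moreover have "a + (s - a) / (b - a) * (b - a) = s" using ab by simp
  ultimately show ?thesis by simp
qed

text \<open>The system as one equation in configuration space with a Borel vector field \<beta> that
  is defined everywhere, including at collisions. The only global control of \<beta> is
  integrability along almost every path; continuity is assumed later, and only on open sets
  \<Omega>.\<close>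

locale additive_noise_process =
  fixes T \<sigma> :: real and M :: "'a measure" and F :: "real \<Rightarrow> 'a measure"
    and \<beta> :: "'e \<Rightarrow> 'e::euclidean_space" and B X :: "real \<Rightarrow> 'a \<Rightarrow> 'e"
  assumes filtered: "filtered_prob_space M F"
    and brownian: "brownian_motion_upto T M F B"
    and adapted_X: "adapted_upto T F X"
    and continuous_X: "AE \<omega> in M. continuous_on {0..T} (\<lambda>t. X t \<omega>)"
    and drift_meas [measurable]: "\<beta> \<in> borel_measurable borel"
    and drift_integrable: "AE \<omega> in M. set_integrable lborel {0..T} (\<lambda>s. \<beta> (X s \<omega>))"
    and equation: "AE \<omega> in M. \<forall>t\<in>{0..T}. X t \<omega> = X 0 \<omega> + \<sigma> *\<^sub>R B t \<omega> + (LINT s:{0..t}|lborel. \<beta> (X s \<omega>))"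
begin

sublocale prob_space M
  using filtered unfolding filtered_prob_space_def by blast

lemma space_F [simp]: "space (F t) = space M"
  and sets_F_subset: "sets (F t) \<subseteq> sets M"
  using filtered unfolding filtered_prob_space_def subalgebra_def by auto

lemma sets_F_mono: "s \<le> t \<Longrightarrow> sets (F s) \<subseteq> sets (F t)"
  using filtered unfolding filtered_prob_space_def filtration_def by auto

lemma X_meas_F: "0 \<le> s \<Longrightarrow> s \<le> t \<Longrightarrow> t \<le> T \<Longrightarrow> X s \<in> borel_measurable (F t)"
  using adapted_X sets_F_mono[of s t] unfolding adapted_upto_def
  by (intro measurable_mono[THEN subsetD, of borel borel "F s" "F t"]) auto

lemma X_meas: "0 \<le> t \<Longrightarrow> t \<le> T \<Longrightarrow> X t \<in> borel_measurable M"
  using X_meas_F[of t t] sets_F_subset[of t]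
  by (intro measurable_mono[THEN subsetD, of borel borel "F t" M]) auto

lemma B_meas: "0 \<le> t \<Longrightarrow> t \<le> T \<Longrightarrow> B t \<in> borel_measurable M"
  using brownian sets_F_subset[of t] unfolding brownian_motion_upto_def adapted_upto_def
  by (intro measurable_mono[THEN subsetD, of borel borel "F t" M]) auto

lemma distr_increment:
  assumes "0 \<le> s" "s < t" "t \<le> T"
  shows "distr M borel (\<lambda>\<omega>. B t \<omega> - B s \<omega>) = gauss (t - s)"
proof -
  have "distributed M lborel (\<lambda>\<omega>. B t \<omega> - B s \<omega>) (\<lambda>x. ennreal (\<Prod>e\<in>Basis. normal_density 0 (sqrt (t - s)) (x \<bullet> e)))"
    using brownian assms unfolding brownian_motion_upto_def by blast
  then have "distr M lborel (\<lambda>\<omega>. B t \<omega> - B s \<omega>) = gauss (t - s)"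
    unfolding gauss_def by (rule distributed_distr_eq_density)
  moreover have "distr M lborel (\<lambda>\<omega>. B t \<omega> - B s \<omega>) = distr M borel (\<lambda>\<omega>. B t \<omega> - B s \<omega>)"
    by (rule distr_cong) auto
  ultimately show ?thesis by simp
qed

lemma integral_increment:
  fixes f :: "'e \<times> 'e \<Rightarrow> real"
  assumes st: "0 \<le> s" "s < t" "t \<le> T" and A: "A \<in> sets (F s)"
    and f [measurable]: "f \<in> borel_measurable (borel \<Otimes>\<^sub>M borel)" and c: "\<And>z. \<bar>f z\<bar> \<le> c"
  shows "(LINT \<omega>|M. indicator A \<omega> * f (X s \<omega>, B t \<omega> - B s \<omega>)) =
    (LINT \<omega>|M. indicator A \<omega> * (LINT y|gauss (t - s). f (X s \<omega>, y)))"
    and "(\<lambda>x. LINT y|gauss (t - s). f (x, y)) \<in> borel_measurable borel"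
    and "\<bar>LINT y|gauss (t - s). f (x, y)\<bar> \<le> c"
proof -
  let ?S = "count_space UNIV \<Otimes>\<^sub>M borel :: (bool \<times> 'e) measure"
  define \<eta> where "\<eta> = (\<lambda>\<omega>. B t \<omega> - B s \<omega>)"
  define \<xi> where "\<xi> = (\<lambda>\<omega>. (\<omega> \<in> A, X s \<omega>))"
  have [measurable]: "B s \<in> borel_measurable M" "B t \<in> borel_measurable M"
    using st by (auto intro!: B_meas)
  have [measurable]: "X s \<in> borel_measurable (F s)" using st by (intro X_meas_F) auto
  have \<xi>F: "\<xi> \<in> F s \<rightarrow>\<^sub>M ?S" unfolding \<xi>_def using A by measurable
  then have [measurable]: "\<xi> \<in> M \<rightarrow>\<^sub>M ?S"
    using sets_F_subset[of s] by (intro measurable_mono[THEN subsetD, of ?S ?S "F s" M]) auto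
  have \<eta> [measurable]: "\<eta> \<in> borel_measurable M" unfolding \<eta>_def using st by measurable
  have ind: "indep_set (sets (F s)) {\<eta> -` A \<inter> space M | A. A \<in> sets borel}"
    using brownian st unfolding brownian_motion_upto_def \<eta>_def by blast
  interpret N: prob_space "gauss (t - s) :: 'e measure" using st by (intro prob_space_gauss) auto
  interpret S: prob_space "distr M ?S \<xi>" by (rule prob_space_distr) measurable
  have D: "distr M ?S \<xi> \<Otimes>\<^sub>M gauss (t - s) = distr M (?S \<Otimes>\<^sub>M borel) (\<lambda>\<omega>. (\<xi> \<omega>, \<eta> \<omega>))"
  proof (rule pair_measure_eqI)
    show "sigma_finite_measure (distr M ?S \<xi>)" "sigma_finite_measure (gauss (t - s) :: 'e measure)"
      by standard
    show "sets (distr M ?S \<xi> \<Otimes>\<^sub>M gauss (t - s)) = sets (distr M (?S \<Otimes>\<^sub>M borel) (\<lambda>\<omega>. (\<xi> \<omega>, \<eta> \<omega>)))"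
      by (simp cong: sets_pair_measure_cong)
    fix U and V :: "'e set" assume "U \<in> sets (distr M ?S \<xi>)" "V \<in> sets (gauss (t - s))"
    then have UV [measurable]: "U \<in> sets ?S" "V \<in> sets borel" by simp_all
    have "prob ((\<xi> -` U \<inter> space M) \<inter> (\<eta> -` V \<inter> space M)) = prob (\<xi> -` U \<inter> space M) * prob (\<eta> -` V \<inter> space M)"
      using measurable_sets[OF \<xi>F UV(1)] UV(2) by (intro indep_setD[OF ind]) auto
    moreover have "(\<lambda>\<omega>. (\<xi> \<omega>, \<eta> \<omega>)) -` (U \<times> V) \<inter> space M = (\<xi> -` U \<inter> space M) \<inter> (\<eta> -` V \<inter> space M)"
      by auto
    ultimately show "emeasure (distr M ?S \<xi>) U * emeasure (gauss (t - s)) V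
        = emeasure (distr M (?S \<Otimes>\<^sub>M borel) (\<lambda>\<omega>. (\<xi> \<omega>, \<eta> \<omega>))) (U \<times> V)"
      using distr_increment[OF st, symmetric]
      by (simp add: emeasure_distr \<eta>_def[symmetric] emeasure_eq_measure ennreal_mult[symmetric])
  qed
  interpret P: pair_prob_space "distr M ?S \<xi>" "gauss (t - s) :: 'e measure" ..
  define \<phi> where "\<phi> = (\<lambda>z :: (bool \<times> 'e) \<times> 'e. if fst (fst z) then f (snd (fst z), snd z) else 0)"
  have [measurable]: "\<phi> \<in> borel_measurable (?S \<Otimes>\<^sub>M borel)" unfolding \<phi>_def by measurable
  have c0: "c \<ge> 0" using order.trans[OF abs_ge_zero c] .
  have \<phi>c: "\<bar>\<phi> z\<bar> \<le> c" for z using c c0 by (auto simp: \<phi>_def)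
  have \<phi>m: "\<phi> \<in> borel_measurable (distr M ?S \<xi> \<Otimes>\<^sub>M gauss (t - s))"
    by measurable
  have \<phi>i: "integrable (distr M ?S \<xi> \<Otimes>\<^sub>M gauss (t - s)) \<phi>"
    using \<phi>c by (intro P.integrable_const_bound[where B=c] \<phi>m) auto
  have fm: "(\<lambda>z. f z) \<in> borel_measurable (borel \<Otimes>\<^sub>M gauss (t - s))"
    using f by (subst measurable_cong_sets[OF sets_pair_measure_cong[OF refl sets_gauss] refl])
  then show m2: "(\<lambda>x. LINT y|gauss (t - s). f (x, y)) \<in> borel_measurable borel"
    using N.borel_measurable_lebesgue_integral[of "\<lambda>x y. f (x, y)" borel] by simp
  show "\<bar>LINT y|gauss (t - s). f (x, y)\<bar> \<le> c" for x
  proof -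
    have i: "integrable (gauss (t - s)) (\<lambda>y. f (x, y))"
      using c by (intro N.integrable_const_bound[where B=c]) auto
    have "\<bar>LINT y|gauss (t - s). f (x, y)\<bar> \<le> (LINT y|gauss (t - s). \<bar>f (x, y)\<bar>)"
      by (rule integral_abs_bound)
    also have "\<dots> \<le> (LINT y|(gauss (t - s) :: 'e measure). c)"
      using i c by (intro integral_mono) auto
    finally show ?thesis using N.prob_space by simp
  qed
  have "(LINT \<omega>|M. indicator A \<omega> * f (X s \<omega>, B t \<omega> - B s \<omega>)) = (LINT \<omega>|M. \<phi> (\<xi> \<omega>, \<eta> \<omega>))"
    by (intro Bochner_Integration.integral_cong refl) (auto simp: \<phi>_def \<xi>_def \<eta>_def)
  also have "\<dots> = integral\<^sup>L (distr M ?S \<xi> \<Otimes>\<^sub>M gauss (t - s)) \<phi>"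
    unfolding D by (rule integral_distr[symmetric]) measurable
  also have "\<dots> = (LINT x|distr M ?S \<xi>. LINT y|gauss (t - s). \<phi> (x, y))"
    by (rule P.integral_fst'[OF \<phi>i, symmetric])
  also have "\<dots> = (LINT \<omega>|M. LINT y|gauss (t - s). \<phi> (\<xi> \<omega>, y))"
  proof (rule integral_distr)
    show "(\<lambda>x. LINT y|gauss (t - s). \<phi> (x, y)) \<in> borel_measurable ?S"
      using N.borel_measurable_lebesgue_integral[of "\<lambda>x y. \<phi> (x, y)" ?S]
      by (simp add: measurable_cong_sets[OF sets_pair_measure_cong[OF refl sets_gauss] refl])
  qed measurable
  also have "\<dots> = (LINT \<omega>|M. indicator A \<omega> * (LINT y|gauss (t - s). f (X s \<omega>, y)))"
  proof (intro Bochner_Integration.integral_cong refl)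
    fix \<omega>
    have "\<phi> (\<xi> \<omega>, y) = indicator A \<omega> * f (X s \<omega>, y)" for y
      by (simp add: \<phi>_def \<xi>_def)
    then show "(LINT y|gauss (t - s). \<phi> (\<xi> \<omega>, y)) = indicator A \<omega> * (LINT y|gauss (t - s). f (X s \<omega>, y))"
      by simp
  qed
  finally show "(LINT \<omega>|M. indicator A \<omega> * f (X s \<omega>, B t \<omega> - B s \<omega>)) =
    (LINT \<omega>|M. indicator A \<omega> * (LINT y|gauss (t - s). f (X s \<omega>, y)))" .
qed

section \<open>Path increments compared with Euler steps, and oscillation on a grid\<close>

text \<open>The difference of the integral equations at \<open>a\<close> and \<open>b\<close> leaves
  the integral of the drift over the interval. The null set does not depend on \<open>a\<close>,
  \<open>b\<close>, \<open>w\<close> and \<epsilon>, so \<open>w\<close> may later be the random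
  vector \<open>\<beta> (X a \<omega>)\<close>.\<close>

lemma increment_approx:
  "AE \<omega> in M. \<forall>a b w \<epsilon>. 0 \<le> a \<longrightarrow> a \<le> b \<longrightarrow> b \<le> T \<longrightarrow> (\<forall>s\<in>{a..b}. norm (\<beta> (X s \<omega>) - w) \<le> \<epsilon>) \<longrightarrow>
     norm (X b \<omega> - (X a \<omega> + \<sigma> *\<^sub>R (B b \<omega> - B a \<omega>) + (b - a) *\<^sub>R w)) \<le> (b - a) * \<epsilon>"
  using drift_integrable equation
proof eventually_elim
  case (elim \<omega>)
  show ?case
  proof (intro allI impI)
    fix a b \<epsilon> :: real and w :: 'e
    assume ab: "0 \<le> a" "a \<le> b" "b \<le> T" and w: "\<forall>s\<in>{a..b}. norm (\<beta> (X s \<omega>) - w) \<le> \<epsilon>"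
    let ?f = "\<lambda>s. \<beta> (X s \<omega>)"
    have i: "set_integrable lborel {0..a} ?f" "set_integrable lborel {a<..b} ?f"
      using ab by (auto intro!: set_integrable_subset[OF elim(1)])
    have un: "{0..b} = {0..a} \<union> {a<..b}" using ab by auto
    have "(LINT s:{0..b}|lborel. ?f s) = (LINT s:{0..a}|lborel. ?f s) + (LINT s:{a<..b}|lborel. ?f s)"
      unfolding un by (rule set_integral_Un[OF _ i]) auto
    then have e: "X b \<omega> - X a \<omega> - \<sigma> *\<^sub>R (B b \<omega> - B a \<omega>) = (LINT s:{a<..b}|lborel. ?f s)"
      using elim(2)[rule_format, of a] elim(2)[rule_format, of b] ab by (simp add: algebra_simps)
    have ci: "set_integrable lborel {a<..b} (\<lambda>s. w)" "set_integrable lborel {a<..b} (\<lambda>s. \<epsilon>)"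
      using ab by (auto simp: set_integrable_def intro!: integrable_scaleR_left)
    have cv: "(LINT s:{a<..b}|lborel. v) = (b - a) *\<^sub>R v" for v :: "'v::{banach,second_countable_topology}"
      using ab by (simp add: set_lebesgue_integral_def)
    have "X b \<omega> - (X a \<omega> + \<sigma> *\<^sub>R (B b \<omega> - B a \<omega>) + (b - a) *\<^sub>R w) = (LINT s:{a<..b}|lborel. ?f s - w)"
      using e set_integral_diff(2)[OF i(2) ci(1)] cv[of w] by (simp add: algebra_simps)
    also have "norm \<dots> \<le> (LINT s:{a<..b}|lborel. norm (?f s - w))"
      by (rule set_integral_norm_bound, rule set_integral_diff(1)[OF i(2) ci(1)])
    also have "\<dots> \<le> (LINT s:{a<..b}|lborel. \<epsilon>)"
      using w by (intro set_integral_mono set_integrable_norm set_integral_diff(1)[OF i(2) ci(1)] ci) auto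
    also have "\<dots> = (b - a) * \<epsilon>" using cv[of \<epsilon>] by simp
    finally show "norm (X b \<omega> - (X a \<omega> + \<sigma> *\<^sub>R (B b \<omega> - B a \<omega>) + (b - a) *\<^sub>R w)) \<le> (b - a) * \<epsilon>" .
  qed
qed

text \<open>Only rational times are inspected: the filtration is not complete, and the event has to lie in
  \<open>F b\<close>.\<close>

definition oscillates :: "real \<Rightarrow> real \<Rightarrow> real \<Rightarrow> 'a set" where
  "oscillates a b \<delta> = {\<omega>\<in>space M. \<exists>r\<in>\<rat> \<inter> {0..1}. \<delta> < norm (X (a + r * (b - a)) \<omega> - X a \<omega>)}"

lemma oscillates_meas:
  assumes "0 \<le> a" "a \<le> b" "b \<le> T"
  shows "oscillates a b \<delta> \<in> sets (F b)"
proof -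
  have "oscillates a b \<delta> = (\<Union>r\<in>\<rat> \<inter> {0..1}. {\<omega>\<in>space (F b). \<delta> < norm (X (a + r * (b - a)) \<omega> - X a \<omega>)})"
    unfolding oscillates_def by auto
  also have "\<dots> \<in> sets (F b)"
  proof (rule sets.countable_UN'')
    show "countable (\<rat> \<inter> {0..1::real})" using countable_rat by (rule countable_subset[rotated]) auto
    fix r :: real assume r: "r \<in> \<rat> \<inter> {0..1}"
    then have "r * (b - a) \<le> b - a" using assms by (auto intro: mult_left_le_one_le)
    then have [measurable]: "X (a + r * (b - a)) \<in> borel_measurable (F b)" "X a \<in> borel_measurable (F b)"
      using r assms by (auto intro!: X_meas_F)
    show "{\<omega>\<in>space (F b). \<delta> < norm (X (a + r * (b - a)) \<omega> - X a \<omega>)} \<in> sets (F b)"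
      by measurable
  qed
  finally show ?thesis .
qed

lemma not_oscillates:
  assumes ab: "0 \<le> a" "a < b" "b \<le> T" and \<omega>: "\<omega> \<in> space M" "\<omega> \<notin> oscillates a b \<delta>"
    and c: "continuous_on {0..T} (\<lambda>t. X t \<omega>)" and s: "s \<in> {a..b}"
  shows "norm (X s \<omega> - X a \<omega>) \<le> \<delta>"
proof (rule continuous_le_rational[OF ab(2) _ s, of "\<lambda>s. norm (X s \<omega> - X a \<omega>)"])
  show "continuous_on {a..b} (\<lambda>s. norm (X s \<omega> - X a \<omega>))"
    using ab by (intro continuous_on_norm continuous_on_diff continuous_on_const continuous_on_subset[OF c]) auto
  fix r :: real assume "r \<in> \<rat> \<inter> {0..1}"
  then have "\<not> \<delta> < norm (X (a + r * (b - a)) \<omega> - X a \<omega>)" using \<omega> unfolding oscillates_def by blast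
  then show "norm (X (a + r * (b - a)) \<omega> - X a \<omega>) \<le> \<delta>" by simp
qed

text \<open>Almost every path is uniformly continuous on \<open>{0..T}\<close> and therefore lies
  outside the union for all fine grids; dominated convergence passes to probabilities. The limit
  comes without any rate.\<close>

lemma oscillates_prob:
  assumes t: "0 \<le> t1" "t1 < t2" "t2 \<le> T" and \<delta>: "\<delta> > 0"
  shows "(\<lambda>n. prob (\<Union>k<n. oscillates (t1 + real k * ((t2 - t1) / n)) (t1 + real (Suc k) * ((t2 - t1) / n)) \<delta>)) \<longlonglongrightarrow> 0"
proof -
  define E where "E n = (\<Union>k<n. oscillates (t1 + real k * ((t2 - t1) / n)) (t1 + real (Suc k) * ((t2 - t1) / n)) \<delta>)" for n
  have grid: "t1 \<le> t1 + real k * ((t2 - t1) / n)" "t1 + real k * ((t2 - t1) / n) \<le> t2" if "k \<le> n" for k n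
  proof -
    show "t1 \<le> t1 + real k * ((t2 - t1) / n)" using t by simp
    have "real k / n * (t2 - t1) \<le> 1 * (t2 - t1)" using t that by (intro mult_right_mono) (auto simp: divide_le_eq)
    then show "t1 + real k * ((t2 - t1) / n) \<le> t2" by simp
  qed
  have Em [measurable]: "E n \<in> sets M" for n
    unfolding E_def
  proof (rule sets.finite_UN)
    fix k assume "k \<in> {..<n}"
    then have "k \<le> n" "Suc k \<le> n" by auto
    then have "t1 \<le> t1 + real k * ((t2 - t1) / n)" "t1 + real (Suc k) * ((t2 - t1) / n) \<le> t2"
      using grid by blast+
    moreover have "real k * ((t2 - t1) / n) \<le> real (Suc k) * ((t2 - t1) / n)"
      using t by (intro mult_right_mono) auto
    ultimately show "oscillates (t1 + real k * ((t2 - t1) / n)) (t1 + real (Suc k) * ((t2 - t1) / n)) \<delta> \<in> sets M"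
      using t by (intro subsetD[OF sets_F_subset oscillates_meas]) linarith+
  qed simp
  have "(\<lambda>n. LINT \<omega>|M. indicator (E n) \<omega> :: real) \<longlonglongrightarrow> (LINT \<omega>|M. 0)"
  proof (rule integral_dominated_convergence[where w="\<lambda>_. 1"])
    show "AE \<omega> in M. (\<lambda>n. indicator (E n) \<omega> :: real) \<longlonglongrightarrow> 0"
      using continuous_X
    proof eventually_elim
      case (elim \<omega>)
      have "uniformly_continuous_on {0..T} (\<lambda>t. X t \<omega>)"
        by (rule compact_uniformly_continuous[OF elim]) simp
      then obtain d where d: "d > 0" "\<And>s s'. s \<in> {0..T} \<Longrightarrow> s' \<in> {0..T} \<Longrightarrow> dist s' s < d \<Longrightarrow> dist (X s' \<omega>) (X s \<omega>) < \<delta>"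
        using \<delta> unfolding uniformly_continuous_on_def by metis
      have "(\<lambda>n. (t2 - t1) / real n) \<longlonglongrightarrow> 0" by (rule lim_const_over_n)
      then have "eventually (\<lambda>n. (t2 - t1) / real n < d) sequentially"
        using d(1) by (rule order_tendstoD)
      then have "eventually (\<lambda>n. indicator (E n) \<omega> = (0::real)) sequentially"
      proof eventually_elim
        case (elim n)
        have "\<omega> \<notin> E n"
        proof
          assume "\<omega> \<in> E n"
          define h where "h = (t2 - t1) / n"
          have st: "t1 + real (Suc j) * h - (t1 + real j * h) = h" for j by (simp add: algebra_simps)
          obtain k r where k: "k < n" and r: "r \<in> {0..1}"
            and gt: "\<delta> < norm (X (t1 + real k * h + r * h) \<omega> - X (t1 + real k * h) \<omega>)"
            using \<open>\<omega> \<in> E n\<close> unfolding E_def oscillates_def h_def[symmetric] st by blast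
          have hpos: "h > 0" using t k by (auto simp: h_def)
          then have rh: "0 \<le> r * h" "r * h \<le> h"
            using r by (auto intro: mult_left_le_one_le)
          have "t1 + real k * h + h \<le> t2" using grid(2)[of "Suc k" n] k unfolding h_def[symmetric] by (simp add: algebra_simps)
          moreover have "t1 \<le> t1 + real k * h" using hpos by simp
          moreover have "h < d" using elim by (simp add: h_def)
          ultimately have "dist (X (t1 + real k * h + r * h) \<omega>) (X (t1 + real k * h) \<omega>) < \<delta>"
            using rh t by (intro d(2)) (auto simp: dist_real_def)
          with gt show False by (simp add: dist_norm)
        qed
        then show ?case by simp
      qed
      then show ?case by (rule tendsto_eventually)
    qed
  qed auto
  then have "(\<lambda>n. prob (E n)) \<longlonglongrightarrow> 0" by simp
  then show ?thesis unfolding E_def .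
qed

section \<open>Lower bounds for the expected value of a barrier\<close>

lemma indicator_mult_meas [measurable]:
  fixes f :: "'e \<Rightarrow> real"
  assumes "0 \<le> t" "t \<le> T" "A \<in> sets M" "f \<in> borel_measurable borel"
  shows "(\<lambda>\<omega>. indicator A \<omega> * f (X t \<omega>)) \<in> borel_measurable M"
proof -
  have [measurable]: "X t \<in> borel_measurable M" "A \<in> sets M" "f \<in> borel_measurable borel"
    using assms X_meas by auto
  show ?thesis by measurable
qed

text \<open>Since \<open>u'\<close> only has to be controlled on \<open>H\<close>, where the increment of \<open>X\<close> is the Gaussian step
  \<open>\<sigma> (B t - B s) + h \<beta> (X s)\<close> up to a small error, no bound on the drift away from \<open>G\<close> is needed.\<close>

lemma one_step:
  fixes u u' :: "'e \<Rightarrow> real"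
  assumes st: "0 \<le> s" "s < t" "t \<le> T" and h: "h = t - s"
    and A: "A \<in> sets (F s)" and H: "H \<in> sets M" "H \<subseteq> A"
    and G: "G \<in> sets borel"
    and u: "u \<in> borel_measurable borel" "\<And>x. 0 \<le> u x" "\<And>x. u x \<le> Bd"
    and u': "u' \<in> borel_measurable borel" "\<And>x. 0 \<le> u' x" "\<And>x. u' x \<le> Bd"
    and supp: "\<And>\<omega>. \<omega> \<in> A \<Longrightarrow> X s \<omega> \<notin> G \<Longrightarrow> u (X s \<omega>) = 0"
    and near: "AE \<omega> in M. \<omega> \<in> H \<longrightarrow> X s \<omega> \<in> G \<longrightarrow>
       u' (X s \<omega> + \<sigma> *\<^sub>R (B t \<omega> - B s \<omega>) + h *\<^sub>R \<beta> (X s \<omega>)) \<le> u' (X t \<omega>) + \<epsilon>"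
    and step: "\<And>x. x \<in> G \<Longrightarrow> (1 - \<kappa>) * u x - C \<le> (LINT y|gauss h. u' (x + \<sigma> *\<^sub>R y + h *\<^sub>R \<beta> x))"
    and nn: "C \<ge> 0" "\<epsilon> \<ge> 0"
  shows "(1 - \<kappa>) * (LINT \<omega>|M. indicator A \<omega> * u (X s \<omega>)) - C - \<epsilon> - Bd * (prob A - prob H)
    \<le> (LINT \<omega>|M. indicator H \<omega> * u' (X t \<omega>))"
proof -
  have AM: "A \<in> sets M" using A sets_F_subset by blast
  note [measurable] = AM H(1) G u(1) u'(1)
  have [measurable]: "X s \<in> borel_measurable M" "X t \<in> borel_measurable M"
    "B s \<in> borel_measurable M" "B t \<in> borel_measurable M" "X s \<in> borel_measurable (F s)"
    using st by (auto intro!: X_meas B_meas X_meas_F)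
  have Bd: "0 \<le> Bd" using order.trans[OF u(2) u(3)] .
  have i_ind: "integrable M (indicator S :: 'a \<Rightarrow> real)" if "S \<in> sets M" for S
    using that by (intro integrable_real_indicator) (auto simp: emeasure_eq_measure)
  \<comment> \<open>On \<open>A\<close> the value \<open>u (X s \<omega>)\<close> is 0 outside
    \<open>G\<close>, so replacing \<open>A\<close> by \<open>A'\<close> costs nothing on the left,
    and the hypothesis on Gaussian steps applies at every point that remains.\<close>
  define A' where "A' = {\<omega>\<in>A. X s \<omega> \<in> G}"
  have "A' = A \<inter> (X s -` G \<inter> space (F s))"
    using sets.sets_into_space[OF AM] by (auto simp: A'_def)
  then have A'F: "A' \<in> sets (F s)"
    using sets.Int[OF A measurable_sets[OF X_meas_F G]] st by simp
  then have A'M [measurable]: "A' \<in> sets M" using sets_F_subset by blast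
  define f where "f = (\<lambda>z::'e \<times> 'e. u' (fst z + \<sigma> *\<^sub>R snd z + h *\<^sub>R \<beta> (fst z)))"
  have fm: "f \<in> borel_measurable (borel \<Otimes>\<^sub>M borel)" unfolding f_def by measurable
  have fB: "\<bar>f z\<bar> \<le> Bd" for z unfolding f_def using u'(2,3) by (simp add: abs_le_iff order.trans[of _ 0])
  note I = integral_increment[OF st A'F fm fB, folded h]
  let ?g = "\<lambda>x. LINT y|gauss h. f (x, y)"
  have [measurable]: "?g \<in> borel_measurable borel" using I(2) .
  have ii: "integrable M (\<lambda>\<omega>. indicator S \<omega> * v \<omega>)" 
    if "S \<in> sets M" "v \<in> borel_measurable M" "\<And>\<omega>. \<bar>v \<omega>\<bar> \<le> Bd" for S and v :: "'a \<Rightarrow> real"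
    using that Bd by (intro integrable_const_bound[where B=Bd]) (auto simp: indicator_def abs_mult)
  have uu: "\<bar>u x\<bar> \<le> Bd" "\<bar>u' x\<bar> \<le> Bd" for x using u u' by auto
  have i1: "integrable M (\<lambda>\<omega>. indicator A \<omega> * u (X s \<omega>))" using uu by (intro ii) auto
  have i2: "integrable M (\<lambda>\<omega>. indicator A' \<omega> * ?g (X s \<omega>))" using I(3) by (intro ii) auto
  have [measurable]: "(\<lambda>\<omega>. f (X s \<omega>, B t \<omega> - B s \<omega>)) \<in> borel_measurable M"
    using measurable_compose[OF _ fm, of "\<lambda>\<omega>. (X s \<omega>, B t \<omega> - B s \<omega>)" M] by measurable
  have i3: "integrable M (\<lambda>\<omega>. indicator A' \<omega> * f (X s \<omega>, B t \<omega> - B s \<omega>))" using fB by (intro ii) auto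
  have i4: "integrable M (\<lambda>\<omega>. indicator H \<omega> * u' (X t \<omega>))" using uu by (intro ii) auto
  have "(1 - \<kappa>) * (LINT \<omega>|M. indicator A \<omega> * u (X s \<omega>)) - C = (LINT \<omega>|M. (1 - \<kappa>) * (indicator A \<omega> * u (X s \<omega>)) - C)"
    using i1 by (simp add: prob_space)
  also have "\<dots> \<le> (LINT \<omega>|M. indicator A' \<omega> * ?g (X s \<omega>))"
  proof (rule integral_mono)
    fix \<omega> assume "\<omega> \<in> space M"
    show "(1 - \<kappa>) * (indicator A \<omega> * u (X s \<omega>)) - C \<le> indicator A' \<omega> * ?g (X s \<omega>)"
      using step[of "X s \<omega>"] supp[of \<omega>] nn by (auto simp: A'_def f_def indicator_def)
  qed (use i1 i2 in auto)
  also have "\<dots> = (LINT \<omega>|M. indicator A' \<omega> * f (X s \<omega>, B t \<omega> - B s \<omega>))"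
    using I(1) by simp
  \<comment> \<open>On \<open>H\<close> the Gaussian step is compared with the true value at time
    \<open>t\<close>. On \<open>A - H\<close> the function \<open>f\<close> is merely bounded by
    \<open>Bd\<close>, which gives the loss \<open>Bd * (prob A - prob H)\<close>.\<close>
  also have "\<dots> \<le> (LINT \<omega>|M. indicator H \<omega> * u' (X t \<omega>) + Bd * (indicator A \<omega> - indicator H \<omega>) + \<epsilon>)"
  proof (rule integral_mono_AE)
    show "AE \<omega> in M. indicator A' \<omega> * f (X s \<omega>, B t \<omega> - B s \<omega>) \<le> indicator H \<omega> * u' (X t \<omega>) + Bd * (indicator A \<omega> - indicator H \<omega>) + \<epsilon>"
      using near
    proof eventually_elim
      case (elim \<omega>)
      show ?case
      proof (cases "\<omega> \<in> A'")
        case True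
        then show ?thesis
        proof (cases "\<omega> \<in> H")
          case True
          then show ?thesis using \<open>\<omega> \<in> A'\<close> elim H(2) by (auto simp: A'_def f_def)
        next
          case False
          then show ?thesis using \<open>\<omega> \<in> A'\<close> fB[of "(X s \<omega>, B t \<omega> - B s \<omega>)"] nn by (auto simp: A'_def)
        qed
      next
        case False
        then show ?thesis using nn u'(2)[of "X t \<omega>"] Bd H(2) by (auto simp: indicator_def)
      qed
    qed
  qed (use i3 i4 i_ind[OF AM] i_ind[OF H(1)] in auto)
  also have "\<dots> = (LINT \<omega>|M. indicator H \<omega> * u' (X t \<omega>)) + Bd * (prob A - prob H) + \<epsilon>"
    using i4 i_ind[OF AM] i_ind[OF H(1)] by (simp add: prob_space)
  finally show ?thesis by simp
qed

text \<open>On a grid, the process is stopped as soon as it visits \<open>Bad\<close> or moves by more than \<open>\<delta>\<close> within one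
  grid interval. A path can violate the second condition in only one of the stopped intervals, so the
  total loss is the probability of ever violating it, which tends to \<open>0\<close> by path continuity alone. This
  replaces Ito's formula and any integrability of the drift.\<close>

lemma barrier:
  fixes u :: "real \<Rightarrow> 'e \<Rightarrow> real"
  assumes t: "0 \<le> t1" "t1 < t2" "t2 \<le> T" and A: "A \<in> sets (F t1)"
    and G: "compact G" and \<Omega>: "open \<Omega>" "G \<subseteq> \<Omega>" "continuous_on \<Omega> \<beta>"
    and u: "\<And>t. u t \<in> borel_measurable borel" "\<And>t x. 0 \<le> u t x"
      "\<And>t x. t \<in> {t1..t2} \<Longrightarrow> u t x \<le> Bd"
    and Bad: "Bad \<in> sets borel"
    and supp: "\<And>t x. t \<in> {t1..t2} \<Longrightarrow> x \<notin> G \<Longrightarrow> x \<notin> Bad \<Longrightarrow> u t x = 0"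
    and lip: "\<delta>0 > 0" "L \<ge> 0" "\<And>t x x' x''. t \<in> {t1..t2} \<Longrightarrow> x \<in> G \<Longrightarrow> norm (x' - x) \<le> \<delta>0 \<Longrightarrow> norm (x'' - x) \<le> \<delta>0
        \<Longrightarrow> \<bar>u t x' - u t x''\<bar> \<le> L * norm (x' - x'')"
    and K: "K \<ge> 0" and C: "C \<ge> 0" and h0: "h0 > 0"
    and step: "\<And>t h x. t1 \<le> t \<Longrightarrow> 0 < h \<Longrightarrow> h \<le> h0 \<Longrightarrow> t + h \<le> t2 \<Longrightarrow> x \<in> G \<Longrightarrow>
        (1 - K * h) * u t x - C * (h * sqrt h) \<le> (LINT y|gauss h. u (t + h) (x + \<sigma> *\<^sub>R y + h *\<^sub>R \<beta> x))"
    and W: "W \<in> sets M" "AE \<omega> in M. \<omega> \<notin> W \<longrightarrow> (\<forall>t\<in>{t1..t2}. X t \<omega> \<notin> Bad)"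
  shows "exp (- K * (t2 - t1)) * (LINT \<omega>|M. indicator A \<omega> * u t1 (X t1 \<omega>)) - Bd * prob W
    \<le> (LINT \<omega>|M. indicator A \<omega> * u t2 (X t2 \<omega>))"
proof -
  define \<tau> where "\<tau> = t2 - t1"
  have \<tau>: "\<tau> > 0" using t by (simp add: \<tau>_def)
  have Bd: "0 \<le> Bd" using order.trans[OF u(2) u(3)[of t1]] t by auto
  let ?E1 = "LINT \<omega>|M. indicator A \<omega> * u t1 (X t1 \<omega>)"
  let ?E2 = "LINT \<omega>|M. indicator A \<omega> * u t2 (X t2 \<omega>)"
  have AM [measurable]: "A \<in> sets M" using A sets_F_subset by blast
  have XM [measurable]: "X t \<in> borel_measurable M" if "t \<in> {t1..t2}" for t using that t by (auto intro!: X_meas)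
  note [measurable] = u(1) Bad W(1)
  have ii: "integrable M (\<lambda>\<omega>. indicator S \<omega> * u t (X t \<omega>))" if "S \<in> sets M" "t \<in> {t1..t2}" for S t
  proof (rule integrable_const_bound[where B=Bd])
    show "AE \<omega> in M. norm (indicator S \<omega> * u t (X t \<omega>)) \<le> Bd"
      using u(2)[of t] u(3)[OF that(2)] Bd by (auto simp: indicator_def)
    show "(\<lambda>\<omega>. indicator S \<omega> * u t (X t \<omega>)) \<in> borel_measurable M"
      using that t by (intro indicator_mult_meas u) auto
  qed
  have i_ind: "integrable M (indicator S :: 'a \<Rightarrow> real)" if "S \<in> sets M" for S
    using that by (intro integrable_real_indicator) (auto simp: emeasure_eq_measure)
  have E1: "0 \<le> ?E1" by (intro integral_nonneg_AE) (use u in auto)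
  \<comment> \<open>The error \<epsilon> of freezing the drift on a grid interval accumulates to
    \<open>\<tau> * (L * \<epsilon>)\<close> for every grid. Hence there are two limits in this
    order: the mesh tends to 0 for fixed \<epsilon>, then \<epsilon> tends to 0.\<close>
  have fixed_\<epsilon>: "exp (- K * \<tau>) * ?E1 - \<tau> * (L * \<epsilon>) - Bd * prob W \<le> ?E2" if \<epsilon>: "\<epsilon> > 0" for \<epsilon>
  proof -
    \<comment> \<open>Uniform continuity of \<beta> on a compact neighbourhood of \<open>G\<close>
      inside \<Omega>. The factor 2 is there because the Euler point may be \<delta> further away
      from the starting point than the path itself.\<close>
    obtain \<delta> where \<delta>: "\<delta> > 0" "2 * \<delta> \<le> \<delta>0"
      "\<And>x x'. x \<in> G \<Longrightarrow> norm (x' - x) \<le> \<delta> \<Longrightarrow> norm (\<beta> x' - \<beta> x) \<le> \<epsilon>"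
    proof -
      obtain d where d: "d > 0" "(\<Union>x\<in>G. ball x d) \<subseteq> \<Omega>"
        using compact_subset_open_imp_ball_epsilon_subset[OF G \<Omega>(1,2)] by blast
      define G2 where "G2 = {x + y | x y. x \<in> G \<and> y \<in> cball 0 (d/2)}"
      have cG: "compact G2" unfolding G2_def using G by (intro compact_sums) auto
      have "G2 \<subseteq> \<Omega>"
        unfolding G2_def
      proof safe
        fix x y :: 'e assume "x \<in> G" "y \<in> cball 0 (d/2)"
        then have "x + y \<in> ball x d" using d(1) by (simp add: dist_norm)
        then show "x + y \<in> \<Omega>" using d(2) \<open>x \<in> G\<close> by blast
      qed
      then have "uniformly_continuous_on G2 \<beta>"
        using cG by (intro compact_uniformly_continuous continuous_on_subset[OF \<Omega>(3)])
      then obtain e where e: "e > 0" "\<And>x x'. x \<in> G2 \<Longrightarrow> x' \<in> G2 \<Longrightarrow> dist x' x < e \<Longrightarrow> dist (\<beta> x') (\<beta> x) < \<epsilon>"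
        unfolding uniformly_continuous_on_def using \<epsilon> by blast
      show thesis
      proof (rule that[of "min (min (e/2) (d/2)) (\<delta>0/2)"])
        fix x x' assume x: "x \<in> G" and x': "norm (x' - x) \<le> min (min (e/2) (d/2)) (\<delta>0/2)"
        have "x \<in> G2" unfolding G2_def using x d(1) by (intro CollectI exI[of _ x] exI[of _ 0]) auto
        moreover have "x' \<in> G2" unfolding G2_def using x x' by (intro CollectI exI[of _ x] exI[of _ "x' - x"]) (auto simp: norm_minus_commute)
        ultimately have "dist (\<beta> x') (\<beta> x) < \<epsilon>" using x' e(1) by (intro e(2)) (auto simp: dist_norm)
        then show "norm (\<beta> x' - \<beta> x) \<le> \<epsilon>" by (simp add: dist_norm)
      qed (use e d lip in auto)
    qed
    define E where "E n = (\<Union>k<n. oscillates (t1 + real k * (\<tau> / n)) (t1 + real (Suc k) * (\<tau> / n)) \<delta>)" for n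
    have finite_n: "(1 - K * (\<tau> / n)) ^ n * ?E1 - \<tau> * (C * sqrt (\<tau> / n)) - \<tau> * (L * \<epsilon>) - Bd * prob W - Bd * prob (E n) \<le> ?E2"
      if n: "n > 0" "\<tau> / n \<le> h0" "K * (\<tau> / n) \<le> 1" "\<tau> / n * \<epsilon> \<le> \<delta>" for n :: nat
    proof -
      define h where "h = \<tau> / n"
      define tk where "tk k = t1 + real k * h" for k
      have h: "h > 0" "h \<le> h0" "K * h \<le> 1" "h * \<epsilon> \<le> \<delta>" using n \<tau> by (auto simp: h_def)
      have tk0: "tk 0 = t1" and tkn: "tk n = t2" using n t by (auto simp: tk_def h_def \<tau>_def)
      have tk_mono: "j \<le> k \<Longrightarrow> tk j \<le> tk k" for j k using h by (simp add: tk_def mult_right_mono)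
      have tk_in: "k \<le> n \<Longrightarrow> tk k \<in> {t1..t2}" for k using tk_mono[of 0 k] tk_mono[of k n] tk0 tkn by auto
      have tk_Suc: "tk (Suc k) = tk k + h" for k by (simp add: tk_def algebra_simps)
      define Ob where "Ob k = oscillates (tk k) (tk (Suc k)) \<delta>" for k
      have E: "E n = (\<Union>k<n. Ob k)" unfolding E_def Ob_def tk_def h_def ..
      have ObF: "Ob k \<in> sets (F (tk j))" if "Suc k \<le> j" "j \<le> n" for k j
      proof -
        have "Ob k \<in> sets (F (tk (Suc k)))"
          unfolding Ob_def using tk_in[of k] tk_in[of "Suc k"] tk_mono[of k "Suc k"] that t by (intro oscillates_meas) auto
        then show ?thesis using sets_F_mono[OF tk_mono[OF that(1)]] by blast
      qed
      \<comment> \<open>the event that the process has not been stopped before \<open>tk k\<close>\<close>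
      define Ak where "Ak k = {\<omega>\<in>A. (\<forall>j\<in>{..k}. X (tk j) \<omega> \<notin> Bad) \<and> (\<forall>j\<in>{..<k}. \<omega> \<notin> Ob j)}" for k
      \<comment> \<open>\<open>Bad\<close> is tested up to and including the time
        \<open>tk k\<close>, oscillation only on the intervals that end by \<open>tk k\<close>. So
        \<open>Ak k\<close> is known at time \<open>tk k\<close>, and on it \<open>supp\<close>
        makes the barrier vanish outside \<open>G\<close> at that very time.\<close>
      have AkF: "Ak k \<in> sets (F (tk k))" if k: "k \<le> n" for k
      proof -
        have "Ak k = A - ((\<Union>j\<in>{..k}. X (tk j) -` Bad \<inter> space (F (tk k))) \<union> (\<Union>j\<in>{..<k}. Ob j))"
          using sets.sets_into_space[OF AM] by (auto simp: Ak_def)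
        also have "\<dots> \<in> sets (F (tk k))"
        proof (intro sets.Diff sets.Un sets.finite_UN)
          show "A \<in> sets (F (tk k))" using A sets_F_mono[of t1 "tk k"] tk_in[OF k] by auto
          fix j assume "j \<in> {..k}"
          then show "X (tk j) -` Bad \<inter> space (F (tk k)) \<in> sets (F (tk k))"
            using k tk_in[of j] tk_in[of k] tk_mono[of j k] t Bad
            by (intro measurable_sets[OF X_meas_F]) auto
        next
          fix j assume "j \<in> {..<k}"
          then show "Ob j \<in> sets (F (tk k))" using k by (intro ObF) auto
        qed auto
        finally show ?thesis .
      qed
      have AkM: "Ak k \<in> sets M" if "k \<le> n" for k using AkF[OF that] sets_F_subset by blast
      have Ak_sub: "Ak (Suc k) \<subseteq> Ak k" for k by (auto simp: Ak_def)
      have AkA: "Ak k \<subseteq> A" for k by (auto simp: Ak_def)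
      define a where "a k = (LINT \<omega>|M. indicator (Ak k) \<omega> * u (tk k) (X (tk k) \<omega>))" for k
      have a_nonneg: "0 \<le> a k" for k unfolding a_def by (intro integral_nonneg_AE) (use u in auto)
      define Q where "Q = C * (h * sqrt h) + L * (h * \<epsilon>)"
      have Q: "Q \<ge> 0" unfolding Q_def using C lip h \<epsilon> by auto
      have one: "(1 - K * h) * a k - Q - Bd * (prob (Ak k) - prob (Ak (Suc k))) \<le> a (Suc k)" if k: "k < n" for k
      proof -
        have kin: "tk k \<in> {t1..t2}" "tk (Suc k) \<in> {t1..t2}" using k tk_in[of k] tk_in[of "Suc k"] by auto
        have lt: "tk k < tk (Suc k)" using h by (simp add: tk_Suc)
        have "(1 - K * h) * (LINT \<omega>|M. indicator (Ak k) \<omega> * u (tk k) (X (tk k) \<omega>)) - C * (h * sqrt h) - L * (h * \<epsilon>)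
            - Bd * (prob (Ak k) - prob (Ak (Suc k)))
          \<le> (LINT \<omega>|M. indicator (Ak (Suc k)) \<omega> * min (u (tk (Suc k)) (X (tk (Suc k)) \<omega>)) Bd)"
        proof (rule one_step[where G=G])
          show "0 \<le> tk k" "tk (Suc k) \<le> T" using kin t by auto
          show "tk k < tk (Suc k)" by (rule lt)
          show "h = tk (Suc k) - tk k" by (simp add: tk_Suc)
          show "Ak k \<in> sets (F (tk k))" "Ak (Suc k) \<in> sets M" using k by (auto intro!: AkF AkM)
          show "Ak (Suc k) \<subseteq> Ak k" by (rule Ak_sub)
          show "G \<in> sets borel" using G by (simp add: borel_compact)
          show "u (tk k) x \<le> Bd" "min (u (tk (Suc k)) x) Bd \<le> Bd" for x using u(3)[OF kin(1)] by auto
          show "u (tk k) \<in> borel_measurable borel" "0 \<le> u (tk k) x" for x using u by auto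
          show "(\<lambda>x. min (u (tk (Suc k)) x) Bd) \<in> borel_measurable borel" by measurable
          show "0 \<le> min (u (tk (Suc k)) x) Bd" for x using u Bd by auto
          show "C * (h * sqrt h) \<ge> 0" "L * (h * \<epsilon>) \<ge> 0" using C lip h \<epsilon> by auto
          show "u (tk k) (X (tk k) \<omega>) = 0" if "\<omega> \<in> Ak k" "X (tk k) \<omega> \<notin> G" for \<omega>
            using that kin by (intro supp) (auto simp: Ak_def)
          have mm: "min (u (tk (Suc k)) x) Bd = u (tk (Suc k)) x" for x using u(3)[OF kin(2)] by (simp add: min_absorb1)
          show "(1 - K * h) * u (tk k) x - C * (h * sqrt h) \<le> (LINT y|gauss h. min (u (tk (Suc k)) (x + \<sigma> *\<^sub>R y + h *\<^sub>R \<beta> x)) Bd)"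
            if "x \<in> G" for x
            unfolding mm unfolding tk_Suc using that h kin by (intro step) (auto simp: tk_Suc)
          show "AE \<omega> in M. \<omega> \<in> Ak (Suc k) \<longrightarrow> X (tk k) \<omega> \<in> G \<longrightarrow>
             min (u (tk (Suc k)) (X (tk k) \<omega> + \<sigma> *\<^sub>R (B (tk (Suc k)) \<omega> - B (tk k) \<omega>) + h *\<^sub>R \<beta> (X (tk k) \<omega>))) Bd
               \<le> min (u (tk (Suc k)) (X (tk (Suc k)) \<omega>)) Bd + L * (h * \<epsilon>)"
            unfolding mm using continuous_X increment_approx AE_space
          proof eventually_elim
            case (elim \<omega>)
            show ?case
            proof (intro impI)
              assume \<omega>: "\<omega> \<in> Ak (Suc k)" and inG: "X (tk k) \<omega> \<in> G"
              have "\<omega> \<notin> oscillates (tk k) (tk (Suc k)) \<delta>" using \<omega> by (auto simp: Ak_def Ob_def)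
              then have osc: "norm (X s \<omega> - X (tk k) \<omega>) \<le> \<delta>" if "s \<in> {tk k..tk (Suc k)}" for s
                using kin lt t elim(1,3) that by (intro not_oscillates[of "tk k" "tk (Suc k)" \<omega>]) auto
              let ?y = "X (tk k) \<omega> + \<sigma> *\<^sub>R (B (tk (Suc k)) \<omega> - B (tk k) \<omega>) + h *\<^sub>R \<beta> (X (tk k) \<omega>)"
              have d: "norm (X (tk (Suc k)) \<omega> - ?y) \<le> h * \<epsilon>"
                using elim(2)[rule_format, of "tk k" "tk (Suc k)" "\<beta> (X (tk k) \<omega>)" \<epsilon>] \<delta>(3)[OF inG osc] kin lt t
                by (simp add: tk_Suc)
              have tri: "norm (y - x) \<le> norm (z - x) + norm (z - y)" for x y z :: 'e
                using norm_triangle_ineq4[of "z - x" "z - y"] by simp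
              have "norm (X (tk (Suc k)) \<omega> - X (tk k) \<omega>) \<le> \<delta>" using osc lt by simp
              moreover have "norm (?y - X (tk k) \<omega>) \<le> norm (X (tk (Suc k)) \<omega> - X (tk k) \<omega>) + norm (X (tk (Suc k)) \<omega> - ?y)"
                by (rule tri)
              ultimately have "\<bar>u (tk (Suc k)) (X (tk (Suc k)) \<omega>) - u (tk (Suc k)) ?y\<bar> \<le> L * norm (X (tk (Suc k)) \<omega> - ?y)"
                using d h(4) \<delta>(1,2) kin by (intro lip(3)[OF _ inG]) auto
              also have "\<dots> \<le> L * (h * \<epsilon>)" using d lip(2) by (rule mult_left_mono)
              finally show "u (tk (Suc k)) ?y \<le> u (tk (Suc k)) (X (tk (Suc k)) \<omega>) + L * (h * \<epsilon>)" by linarith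
            qed
          qed
        qed
        moreover have "min (u (tk (Suc k)) x) Bd = u (tk (Suc k)) x" for x
          using u(3)[OF kin(2)] by (simp add: min_absorb1)
        ultimately show ?thesis by (simp add: a_def Q_def)
      qed
      \<comment> \<open>The losses telescope in \<open>prob (Ak k)\<close>. Since
        \<open>1 - K * h\<close> lies between 0 and 1, multiplying the errors made so far by it only
        decreases them.\<close>
      have iter: "(1 - K * h) ^ k * a 0 - real k * Q - Bd * (prob (Ak 0) - prob (Ak k)) \<le> a k" if "k \<le> n" for k
        using that
      proof (induction k)
        case (Suc k)
        define r where "r = 1 - K * h"
        have r: "0 \<le> r" "r \<le> 1" using h K by (auto simp: r_def)
        have pk: "prob (Ak k) \<le> prob (Ak 0)"
        proof (rule finite_measure_mono)
          show "Ak k \<subseteq> Ak 0" by (auto simp: Ak_def)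
          show "Ak 0 \<in> sets M" by (rule AkM) simp
        qed
        define Z where "Z = real k * Q + Bd * (prob (Ak 0) - prob (Ak k))"
        have Z: "Z \<ge> 0" unfolding Z_def using Q Bd pk by simp
        have IH: "r ^ k * a 0 - Z \<le> a k" using Suc unfolding r_def Z_def by simp
        have "r ^ Suc k * a 0 - Z \<le> r ^ Suc k * a 0 - r * Z"
          using mult_left_le_one_le[OF Z r] by linarith
        also have "\<dots> = r * (r ^ k * a 0 - Z)" by (simp add: algebra_simps)
        also have "\<dots> \<le> r * a k" using IH r by (intro mult_left_mono)
        finally show ?case
          using one[of k] Suc.prems unfolding r_def[symmetric] Z_def by (simp add: algebra_simps)
      qed simp
      \<comment> \<open>This is where the sum of all losses becomes a probability: a path in
        \<open>A\<close> that has been stopped has visited \<open>Bad\<close>, hence lies almost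
        surely in \<open>W\<close>, or has oscillated in some interval, hence lies in
        \<open>E n\<close>.\<close>
      have pA: "prob A - prob (Ak n) \<le> prob W + prob (E n)"
      proof -
        have EM: "E n \<in> sets M"
          unfolding E using ObF[of _ n] sets_F_subset[of "tk n"] by (intro sets.finite_UN) auto
        have "prob A - prob (Ak n) = prob (A - Ak n)"
          using AkA AkM[of n] by (intro finite_measure_Diff[symmetric]) auto
        also have "\<dots> \<le> prob (W \<union> E n)"
        proof (rule finite_measure_mono_AE)
          show "AE \<omega> in M. \<omega> \<in> A - Ak n \<longrightarrow> \<omega> \<in> W \<union> E n"
            using W(2)
          proof eventually_elim
            case (elim \<omega>)
            then show ?case using tk_in by (auto simp: Ak_def E)
          qed
          show "W \<union> E n \<in> sets M" using EM by simp
        qed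
        also have "\<dots> \<le> prob W + prob (E n)" using EM by (intro measure_Un_le W) auto
        finally show ?thesis .
      qed
      have a0: "?E1 - Bd * (prob A - prob (Ak 0)) \<le> a 0"
      proof -
        have "?E1 \<le> (LINT \<omega>|M. indicator (Ak 0) \<omega> * u t1 (X t1 \<omega>) + Bd * (indicator A \<omega> - indicator (Ak 0) \<omega>))"
        proof (rule integral_mono)
          show "integrable M (\<lambda>\<omega>. indicator A \<omega> * u t1 (X t1 \<omega>))" using t by (intro ii) auto
          show "integrable M (\<lambda>\<omega>. indicator (Ak 0) \<omega> * u t1 (X t1 \<omega>) + Bd * (indicator A \<omega> - indicator (Ak 0) \<omega>))"
            using ii[OF AkM[of 0], of t1] i_ind[OF AkM[of 0]] i_ind[OF AM] t by auto
          fix \<omega>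
          show "indicator A \<omega> * u t1 (X t1 \<omega>) \<le> indicator (Ak 0) \<omega> * u t1 (X t1 \<omega>) + Bd * (indicator A \<omega> - indicator (Ak 0) \<omega>)"
            using u(3)[of t1] AkA[of 0] t by (auto simp: indicator_def)
        qed
        also have "\<dots> = a 0 + Bd * (prob A - prob (Ak 0))"
          using ii[OF AkM[of 0], of t1] i_ind[OF AkM[of 0]] i_ind[OF AM] AkM[of 0] t by (simp add: a_def tk0)
        finally show ?thesis by simp
      qed
      have an: "a n \<le> ?E2"
      proof -
        have "a n \<le> (LINT \<omega>|M. indicator A \<omega> * u (tk n) (X (tk n) \<omega>))" unfolding a_def
        proof (rule integral_mono)
          fix \<omega>
          show "indicator (Ak n) \<omega> * u (tk n) (X (tk n) \<omega>) \<le> indicator A \<omega> * u (tk n) (X (tk n) \<omega>)"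
            using AkA[of n] u(2)[of "tk n"] by (auto simp: indicator_def)
        qed (auto intro!: ii AkM tk_in)
        then show ?thesis by (simp add: tkn)
      qed
      define R where "R = (1 - K * h) ^ n"
      have R: "0 \<le> R" "R \<le> 1" unfolding R_def using h K by (auto intro!: power_le_one)
      have "prob (Ak 0) \<le> prob A" by (rule finite_measure_mono[OF AkA AM])
      then have nn: "0 \<le> Bd * (prob A - prob (Ak 0))" using Bd by simp
      have "R * ?E1 - Bd * (prob A - prob (Ak 0)) \<le> R * (?E1 - Bd * (prob A - prob (Ak 0)))"
        using mult_left_le_one_le[OF nn R] by (simp add: right_diff_distrib)
      also have "\<dots> \<le> R * a 0" using a0 R by (intro mult_left_mono)
      also have "\<dots> \<le> a n + real n * Q + Bd * (prob (Ak 0) - prob (Ak n))"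
        using iter[of n] unfolding R_def by simp
      finally have "R * ?E1 - real n * Q - Bd * (prob A - prob (Ak n)) \<le> ?E2"
        using an by (simp add: algebra_simps)
      moreover have "real n * Q = \<tau> * (C * sqrt h) + \<tau> * (L * \<epsilon>)"
      proof -
        have nh: "real n * h = \<tau>" using n by (simp add: h_def)
        have "real n * Q = (real n * h) * (C * sqrt h) + (real n * h) * (L * \<epsilon>)" by (simp add: Q_def algebra_simps)
        then show ?thesis unfolding nh .
      qed
      moreover have "Bd * (prob A - prob (Ak n)) \<le> Bd * (prob W + prob (E n))"
        using pA Bd by (rule mult_left_mono)
      ultimately show ?thesis unfolding R_def h_def[symmetric] by (simp add: distrib_left)
    qed
    have lim0: "(\<lambda>n. c * (\<tau> / real n)) \<longlonglongrightarrow> 0" for c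
      using tendsto_mult_right_zero[OF lim_const_over_n[of \<tau>], of c] .
    \<comment> \<open>The \<open>n\<close> remainders \<open>C * (h * sqrt h)\<close> have become
      \<open>\<tau> * (C * sqrt (\<tau> / n))\<close>, which vanishes in the limit together with the
      oscillation probability; the powers converge to the exponential factor.\<close>
    have "(\<lambda>n. (1 - K * (\<tau> / n)) ^ n * ?E1 - \<tau> * (C * sqrt (\<tau> / n)) - \<tau> * (L * \<epsilon>) - Bd * prob W - Bd * prob (E n))
       \<longlonglongrightarrow> exp (- K * \<tau>) * ?E1 - \<tau> * (C * sqrt 0) - \<tau> * (L * \<epsilon>) - Bd * prob W - Bd * 0"
    proof (intro tendsto_diff tendsto_mult tendsto_const tendsto_real_sqrt)
      show "(\<lambda>n. (1 - K * (\<tau> / real n)) ^ n) \<longlonglongrightarrow> exp (- K * \<tau>)"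
        using tendsto_exp_limit_sequentially[of "- K * \<tau>"] by simp
      show "(\<lambda>n. \<tau> / real n) \<longlonglongrightarrow> 0" by (rule lim_const_over_n)
      show "(\<lambda>n. prob (E n)) \<longlonglongrightarrow> 0"
        unfolding E_def \<tau>_def by (rule oscillates_prob[OF t \<delta>(1)])
    qed
    moreover have "eventually (\<lambda>n. (1 - K * (\<tau> / n)) ^ n * ?E1 - \<tau> * (C * sqrt (\<tau> / n)) - \<tau> * (L * \<epsilon>) - Bd * prob W - Bd * prob (E n) \<le> ?E2) sequentially"
    proof -
      have ev: "eventually (\<lambda>n. c * (\<tau> / real n) < b) sequentially" if "b > 0" for b c
        using order_tendstoD(2)[OF lim0 that] .
      show ?thesis
        using eventually_gt_at_top[of "0::nat"] ev[OF h0, of 1] ev[OF zero_less_one, of K] ev[OF \<delta>(1), of \<epsilon>]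
      proof eventually_elim
        case (elim n)
        then show ?case by (intro finite_n) (auto simp: mult.commute)
      qed
    qed
    ultimately show ?thesis
      using tendsto_upperbound[OF _ _ sequentially_bot] by fastforce
  qed
  have "exp (- K * \<tau>) * ?E1 - Bd * prob W \<le> ?E2 + e" if "e > 0" for e
  proof -
    define \<epsilon> where "\<epsilon> = e / (\<tau> * (L + 1))"
    have "\<epsilon> > 0" using that \<tau> lip by (simp add: \<epsilon>_def)
    moreover have "\<tau> * (L * \<epsilon>) \<le> e"
    proof -
      have "\<tau> * ((L + 1) * \<epsilon>) = e" using \<tau> lip by (simp add: \<epsilon>_def)
      moreover have "\<tau> * (L * \<epsilon>) \<le> \<tau> * ((L + 1) * \<epsilon>)" using \<tau> \<open>\<epsilon> > 0\<close> by simp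
      ultimately show ?thesis by simp
    qed
    ultimately show ?thesis using fixed_\<epsilon>[of \<epsilon>] by linarith
  qed
  then show ?thesis unfolding \<tau>_def by (rule field_le_epsilon)
qed

text \<open>A continuous positive function on a compact interval has a positive minimum, so almost
  every path leaves \<open>W \<delta>\<close> for good as \<delta> tends to 0.
  \<open>W \<delta>\<close> inspects countably many times, which makes it measurable.\<close>

lemma small_values_vanish:
  fixes f :: "'e \<Rightarrow> real"
  assumes t: "0 \<le> t1" "t1 < t2" "t2 \<le> T" and f: "continuous_on UNIV f"
    and pos: "AE \<omega> in M. \<forall>t\<in>{t1..t2}. 0 < f (X t \<omega>)"
  obtains W where "\<And>\<delta>. W \<delta> \<in> sets M" "\<And>\<delta>. AE \<omega> in M. \<omega> \<notin> W \<delta> \<longrightarrow> (\<forall>t\<in>{t1..t2}. \<delta> \<le> f (X t \<omega>))"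
    "(\<lambda>n. prob (W (1 / real (Suc n)))) \<longlonglongrightarrow> 0"
proof
  define W where "W \<delta> = (\<Union>r\<in>\<rat> \<inter> {0..1}. {\<omega>\<in>space M. f (X (t1 + r * (t2 - t1)) \<omega>) < \<delta>})" for \<delta>
  have [measurable]: "f \<in> borel_measurable borel" using f by (rule borel_measurable_continuous_onI)
  have tin: "t1 + r * (t2 - t1) \<in> {t1..t2}" if "r \<in> {0..1}" for r
  proof -
    have "r * (t2 - t1) \<le> t2 - t1" "0 \<le> r * (t2 - t1)" using that t by (auto intro: mult_left_le_one_le)
    then show ?thesis by simp
  qed
  show Wm: "W \<delta> \<in> sets M" for \<delta>
    unfolding W_def
  proof (rule sets.countable_UN'')
    show "countable (\<rat> \<inter> {0..1::real})" using countable_rat by (rule countable_subset[rotated]) auto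
    fix r :: real assume "r \<in> \<rat> \<inter> {0..1}"
    then have [measurable]: "X (t1 + r * (t2 - t1)) \<in> borel_measurable M" using tin[of r] t by (intro X_meas) auto
    show "{\<omega>\<in>space M. f (X (t1 + r * (t2 - t1)) \<omega>) < \<delta>} \<in> sets M" by measurable
  qed
  have cX: "continuous_on {t1..t2} (\<lambda>t. f (X t \<omega>))" if "continuous_on {0..T} (\<lambda>t. X t \<omega>)" for \<omega>
    by (rule continuous_on_compose2[OF f]) (use that t in \<open>auto intro: continuous_on_subset\<close>)
  show "AE \<omega> in M. \<omega> \<notin> W \<delta> \<longrightarrow> (\<forall>t\<in>{t1..t2}. \<delta> \<le> f (X t \<omega>))" for \<delta>
    using continuous_X AE_space
  proof eventually_elim
    case (elim \<omega>)
    show ?case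
    proof (intro impI ballI)
      fix t assume \<omega>: "\<omega> \<notin> W \<delta>" and tt: "t \<in> {t1..t2}"
      have "- f (X t \<omega>) \<le> - \<delta>"
      proof (rule continuous_le_rational[OF t(2) _ tt, of "\<lambda>t. - f (X t \<omega>)"])
        show "continuous_on {t1..t2} (\<lambda>t. - f (X t \<omega>))" using cX[OF elim(1)] by (rule continuous_on_minus)
        fix r :: real assume "r \<in> \<rat> \<inter> {0..1}"
        then have "\<not> f (X (t1 + r * (t2 - t1)) \<omega>) < \<delta>" using \<omega> elim(2) unfolding W_def by blast
        then show "- f (X (t1 + r * (t2 - t1)) \<omega>) \<le> - \<delta>" by simp
      qed
      then show "\<delta> \<le> f (X t \<omega>)" by simp
    qed
  qed
  have "(\<lambda>n. LINT \<omega>|M. indicator (W (1 / real (Suc n))) \<omega> :: real) \<longlonglongrightarrow> (LINT \<omega>|M. 0)"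
  proof (rule integral_dominated_convergence[where w="\<lambda>_. 1"])
    show "AE \<omega> in M. (\<lambda>n. indicator (W (1 / real (Suc n))) \<omega> :: real) \<longlonglongrightarrow> 0"
      using continuous_X pos
    proof eventually_elim
      case (elim \<omega>)
      obtain t0 where t0: "t0 \<in> {t1..t2}" "\<And>t. t \<in> {t1..t2} \<Longrightarrow> f (X t0 \<omega>) \<le> f (X t \<omega>)"
        using continuous_attains_inf[OF _ _ cX[OF elim(1)]] t by auto
      have "0 < f (X t0 \<omega>)" using elim(2) t0(1) by blast
      moreover have "(\<lambda>n. 1 / real (Suc n)) \<longlonglongrightarrow> 0" using LIMSEQ_inverse_real_of_nat by (simp add: inverse_eq_divide)
      ultimately have "eventually (\<lambda>n. 1 / real (Suc n) < f (X t0 \<omega>)) sequentially"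
        by (rule order_tendstoD(2)[rotated])
      then have "eventually (\<lambda>n. indicator (W (1 / real (Suc n))) \<omega> = (0::real)) sequentially"
      proof eventually_elim
        case (elim n)
        have "\<omega> \<notin> W (1 / real (Suc n))"
        proof
          assume "\<omega> \<in> W (1 / real (Suc n))"
          then obtain r where r: "r \<in> {0..1}" "f (X (t1 + r * (t2 - t1)) \<omega>) < 1 / real (Suc n)" unfolding W_def by blast
          then show False using t0(2)[OF tin[OF r(1)]] elim by linarith
        qed
        then show ?case by simp
      qed
      then show ?case by (rule tendsto_eventually)
    qed
  qed (use Wm in auto)
  then have "(\<lambda>n. LINT \<omega>|M. indicator (W (1 / real (Suc n))) \<omega> :: real) \<longlonglongrightarrow> 0" by simp
  then show "(\<lambda>n. prob (W (1 / real (Suc n)))) \<longlonglongrightarrow> 0" using Wm by simp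
qed

end

subsection \<open>Following a path\<close>

lemma max_cube_diff_le:
  fixes s s' S :: real
  assumes "max 0 s \<le> S" "max 0 s' \<le> S"
  shows "\<bar>max 0 s ^ 3 - max 0 s' ^ 3\<bar> \<le> 3 * S\<^sup>2 * \<bar>s - s'\<bar>"
proof -
  define a b where "a = max 0 s" and "b = max 0 s'"
  have ab: "0 \<le> a" "0 \<le> b" "a \<le> S" "b \<le> S" and S: "0 \<le> S" using assms by (auto simp: a_def b_def)
  have "a ^ 3 - b ^ 3 = (a - b) * (a * a + a * b + b * b)"
    by (simp add: power3_eq_cube algebra_simps)
  then have "\<bar>a ^ 3 - b ^ 3\<bar> = \<bar>a - b\<bar> * (a * a + a * b + b * b)"
    using ab by (simp add: abs_mult)
  also have "\<dots> \<le> \<bar>s - s'\<bar> * (S * S + S * S + S * S)"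
    using ab S by (intro mult_mono add_mono) (auto simp: a_def b_def)
  finally show ?thesis by (simp add: a_def b_def power2_eq_square mult.commute)
qed

lemma norm_square_diff_le:
  fixes x y :: "'e::real_inner"
  shows "\<bar>(norm x)\<^sup>2 - (norm y)\<^sup>2\<bar> \<le> norm (x - y) * (norm x + norm y)"
proof -
  have "(norm x)\<^sup>2 - (norm y)\<^sup>2 = (norm x - norm y) * (norm x + norm y)"
    by (simp add: power2_eq_square algebra_simps)
  then have "\<bar>(norm x)\<^sup>2 - (norm y)\<^sup>2\<bar> = \<bar>norm x - norm y\<bar> * (norm x + norm y)"
    by (simp add: abs_mult)
  also have "\<dots> \<le> norm (x - y) * (norm x + norm y)"
    by (intro mult_right_mono norm_triangle_ineq3) auto
  finally show ?thesis .
qed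

text \<open>Bookkeeping of orders: \<open>sqrt h\<close> and \<nu> have order one, hence
  \<open>h\<close> has order two, and below scale 1 both \<open>h * \<nu>\<close> and
  \<open>h\<^sup>2\<close> count as cubic remainders.\<close>

lemma scaling_errors:
  fixes h \<nu> :: real
  assumes "0 \<le> h" "0 \<le> \<nu>" "sqrt h + \<nu> \<le> 1"
  shows "h * \<nu> \<le> (sqrt h + \<nu>) ^ 3" "h\<^sup>2 \<le> (sqrt h + \<nu>) ^ 3"
    "h \<le> (sqrt h + \<nu>)\<^sup>2" "\<nu> \<le> sqrt h + \<nu>"
proof -
  let ?r = "sqrt h + \<nu>"
  have r: "0 \<le> ?r" "?r \<le> 1" using assms by auto
  show hr: "h \<le> ?r\<^sup>2" using power_mono[of "sqrt h" ?r 2] assms by simp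
  show "\<nu> \<le> ?r" using assms by simp
  show "h * \<nu> \<le> ?r ^ 3"
    using mult_mono[OF hr, of \<nu> ?r] assms r by (simp add: power2_eq_square power3_eq_cube)
  have "?r\<^sup>2 \<le> ?r" using power_decreasing[of 1 2 ?r] r by simp
  then have "h \<le> ?r" using hr by simp
  then show "h\<^sup>2 \<le> ?r ^ 3"
    using mult_mono[OF hr, of h ?r] assms r by (simp add: power2_eq_square power3_eq_cube)
qed

text \<open>The barrier is \<open>u = (r0\<^sup>2 - |x - c t|\<^sup>2)\<^sub>+\<^sup>3\<close>. Its generator is at least \<open>- K u\<close>: near the boundary
  of the tube the quadratic variation of \<open>|x - c t|\<^sup>2\<close> dominates the drift terms, and \<open>K\<close> makes the
  discriminant of the resulting quadratic polynomial in \<open>r0\<^sup>2 - |x - c t|\<^sup>2\<close> vanish.\<close>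

lemma (in additive_noise_process) follows_path:
  fixes p q :: 'e and t1 t2 r :: real
  defines "c \<equiv> \<lambda>t. p + (t - t1) *\<^sub>R q"
  assumes \<sigma>: "\<sigma> \<noteq> 0" and t: "0 \<le> t1" "t1 < t2" "t2 \<le> T"
    and \<Omega>: "open \<Omega>" "continuous_on \<Omega> \<beta>" "\<And>t. t \<in> {t1..t2} \<Longrightarrow> c t \<in> \<Omega>"
    and start: "\<And>\<epsilon>. \<epsilon> > 0 \<Longrightarrow> prob {\<omega>\<in>space M. X t1 \<omega> \<in> ball p \<epsilon>} > 0"
    and r: "r > 0"
  shows "prob {\<omega>\<in>space M. X t2 \<omega> \<in> ball (c t2) r} > 0"
proof -
  define path where "path = c ` {t1..t2}"
  have "continuous_on {t1..t2} c" unfolding c_def by (intro continuous_intros)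
  then have path: "compact path" "path \<subseteq> \<Omega>" unfolding path_def using \<Omega>(3) by (auto intro: compact_continuous_image)
  then obtain d where d: "d > 0" "(\<Union>x\<in>path. ball x d) \<subseteq> \<Omega>"
    using compact_subset_open_imp_ball_epsilon_subset[OF path(1) \<Omega>(1)] by blast
  \<comment> \<open>Less than \<open>d\<close>, so that the closed tube stays inside \<Omega>, and
    at most \<open>r\<close>, so that the end of the tube lies in the target ball.\<close>
  define r0 where "r0 = min (d / 2) r"
  have r0: "r0 > 0" "r0 < d" "r0 \<le> r" using d r by (auto simp: r0_def)
  define G where "G = {x + y | x y. x \<in> path \<and> y \<in> cball 0 r0}"
  have G: "compact G" unfolding G_def by (intro compact_sums path) auto
  have G\<Omega>: "G \<subseteq> \<Omega>"
    unfolding G_def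
  proof safe
    fix x y :: 'e assume "x \<in> path" "y \<in> cball 0 r0"
    then have "x + y \<in> ball x d" using r0 by (simp add: dist_norm)
    then show "x + y \<in> \<Omega>" using d(2) \<open>x \<in> path\<close> by blast
  qed
  have inG: "x \<in> G" if "t \<in> {t1..t2}" "norm (x - c t) \<le> r0" for t x
    unfolding G_def path_def using that by (intro CollectI exI[of _ "c t"] exI[of _ "x - c t"]) auto
  have "compact (\<beta> ` G)" using continuous_on_subset[OF \<Omega>(2) G\<Omega>] G by (rule compact_continuous_image)
  then obtain \<Theta>0 where \<Theta>0: "\<Theta>0 > 0" "\<And>x. x \<in> G \<Longrightarrow> norm (\<beta> x) \<le> \<Theta>0"
    using compact_imp_bounded[of "\<beta> ` G"] unfolding bounded_pos by auto
  obtain R1 where R1: "\<And>x. x \<in> G \<Longrightarrow> norm x \<le> R1" using compact_imp_bounded[OF G] unfolding bounded_iff by auto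
  obtain R2 where R2: "\<And>x. x \<in> path \<Longrightarrow> norm x \<le> R2" using compact_imp_bounded[OF path(1)] unfolding bounded_iff by auto
  define R where "R = max 0 R1 + max 0 R2 + 1"
  define \<Theta> where "\<Theta> = \<Theta>0 + norm q"
  have \<Theta>: "\<Theta> > 0" using \<Theta>0 by (simp add: \<Theta>_def add_pos_nonneg)
  define D where "D = real DIM('e)"
  define s where "s t x = r0\<^sup>2 - (norm (x - c t))\<^sup>2" for t x
  define u where "u t x = max 0 (s t x) ^ 3" for t x
  define m where "m = 2 * r0 * \<Theta> + 2 * \<bar>\<sigma>\<bar> * r0 + \<sigma>\<^sup>2"
  define C0 where "C0 = 2 * \<bar>\<sigma>\<bar> * \<Theta> + \<Theta>\<^sup>2"
  \<comment> \<open>The bracket bounds drift and Laplacian; \<open>12 * \<sigma>\<^sup>2\<close>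
    comes from writing \<open>(norm z)\<^sup>2 = r0\<^sup>2 - S\<close> in the quadratic variation.
    The generator is then at least \<open>S * (12 * \<sigma>\<^sup>2 * r0\<^sup>2 - m' * S)\<close>,
    and \<open>K\<close> is chosen for this polynomial.\<close>
  define m' where "m' = 3 * (2 * r0 * \<Theta> + \<sigma>\<^sup>2 * D) + 12 * \<sigma>\<^sup>2"
  define K where "K = m'\<^sup>2 / (48 * \<sigma>\<^sup>2 * r0\<^sup>2)"
  have s_le: "max 0 (s t x) \<le> r0\<^sup>2" for t x by (auto simp: s_def)
  have m: "m \<ge> 0" "C0 \<ge> 0" using r0 \<Theta> by (auto simp: m_def C0_def)
  have mb: "2 * (r0 * \<Theta>) \<le> m" "2 * (\<bar>\<sigma>\<bar> * r0) \<le> m" "\<sigma>\<^sup>2 \<le> m" using r0 \<Theta> by (auto simp: m_def)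
  obtain C where C: "C \<ge> 0" and step: "\<And>s \<alpha> (g::'e) Qf \<tau> h s' Bd. 0 < h \<Longrightarrow> max 0 s \<le> r0\<^sup>2 \<Longrightarrow> \<bar>\<alpha>\<bar> \<le> m \<Longrightarrow> norm g \<le> m \<Longrightarrow>
       (\<And>y. \<bar>Qf y\<bar> \<le> m * (norm y)\<^sup>2) \<Longrightarrow> has_bochner_integral (gauss h) Qf (h * \<tau>) \<Longrightarrow>
       s' \<in> borel_measurable borel \<Longrightarrow> (\<And>y. s' y \<le> Bd) \<Longrightarrow>
       (\<And>y. sqrt h + norm y \<le> 1 \<Longrightarrow> s + \<alpha> * h + g \<bullet> y + Qf y - C0 * (sqrt h + norm y) ^ 3 \<le> s' y) \<Longrightarrow>
       max 0 s ^ 3 + h * (3 * (max 0 s)\<^sup>2 * (\<alpha> + \<tau>) + 3 * max 0 s * (norm g)\<^sup>2) - C * (h * sqrt h)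
         \<le> (LINT y|gauss h. max 0 (s' y) ^ 3)"
    using gauss_cube_step[of m "r0\<^sup>2" C0] m by (metis zero_le_power2)
  have [measurable]: "u t \<in> borel_measurable borel" for t
    unfolding u_def s_def by measurable
  have u_bd: "0 \<le> u t x" "u t x \<le> (r0\<^sup>2) ^ 3" for t x
    unfolding u_def using power_mono[OF s_le[of t x], of 3] by simp_all
  \<comment> \<open>The drift is continuous on a neighbourhood of the whole tube, so nothing has to
    be avoided: \<open>Bad\<close> and \<open>W\<close> are empty, and no path is excluded at the
    start.\<close>
  note BB = barrier[OF t _ G \<Omega>(1) G\<Omega> \<Omega>(2), where Bad="{}" and ?\<delta>0.0=1 and L="3 * (r0\<^sup>2)\<^sup>2 * (2 * R)" and C=C and ?h0.0=1 and K=K and W="{}" and A="space M" and u=u and Bd="(r0\<^sup>2) ^ 3"]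
  have "exp (- K * (t2 - t1)) * (LINT \<omega>|M. indicator (space M) \<omega> * u t1 (X t1 \<omega>)) - (r0\<^sup>2) ^ 3 * prob {}
    \<le> (LINT \<omega>|M. indicator (space M) \<omega> * u t2 (X t2 \<omega>))"
  proof (rule BB)
    show "space M \<in> sets (F t1)" using sets.top[of "F t1"] by simp
    show "0 \<le> u t x" "u t x \<le> (r0\<^sup>2) ^ 3" for t x by (rule u_bd)+
    show "u t x = 0" if "t \<in> {t1..t2}" "x \<notin> G" for t x
    proof -
      have "r0 < norm (x - c t)" using inG[OF that(1)] that(2) by force
      then have "s t x \<le> 0" unfolding s_def using r0 by (simp add: power_mono)
      then show ?thesis by (simp add: u_def)
    qed
    show "0 \<le> 3 * (r0\<^sup>2)\<^sup>2 * (2 * R)" by (simp add: R_def)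
    show "\<bar>u t x' - u t x''\<bar> \<le> 3 * (r0\<^sup>2)\<^sup>2 * (2 * R) * norm (x' - x'')"
      if tx: "t \<in> {t1..t2}" "x \<in> G" and x: "norm (x' - x) \<le> 1" "norm (x'' - x) \<le> 1" for t x x' x''
    proof -
      have "norm (c t) \<le> R2" using tx by (intro R2) (auto simp: path_def)
      then have b: "norm (w - c t) \<le> R" if "norm (w - x) \<le> 1" for w
        using that R1[OF tx(2)] norm_triangle_ineq[of "w - x" "x - c t"] norm_triangle_ineq4[of x "c t"]
        by (simp add: R_def)
      have "\<bar>s t x' - s t x''\<bar> \<le> norm (x' - x'') * (norm (x' - c t) + norm (x'' - c t))"
        using norm_square_diff_le[of "x' - c t" "x'' - c t"] by (simp add: s_def abs_minus_commute)
      also have "\<dots> \<le> norm (x' - x'') * (2 * R)"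
        using b[OF x(1)] b[OF x(2)] by (intro mult_left_mono) auto
      finally have "3 * (r0\<^sup>2)\<^sup>2 * \<bar>s t x' - s t x''\<bar> \<le> 3 * (r0\<^sup>2)\<^sup>2 * (norm (x' - x'') * (2 * R))"
        by (intro mult_left_mono) auto
      then show ?thesis
        unfolding u_def using max_cube_diff_le[OF s_le s_le, of t x' t x''] by (simp add: ac_simps)
    qed
    show "K \<ge> 0" by (simp add: K_def)
    show "C \<ge> 0" by (rule C)
    show "(1 - K * h) * u t x - C * (h * sqrt h) \<le> (LINT y|gauss h. u (t + h) (x + \<sigma> *\<^sub>R y + h *\<^sub>R \<beta> x))"
      if "t1 \<le> t" and h: "0 < h" "h \<le> 1" and th: "t + h \<le> t2" and x: "x \<in> G" for t h x
    proof (cases "s t x \<le> 0")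
      case True
      have "0 \<le> (LINT y|gauss h. u (t + h) (x + \<sigma> *\<^sub>R y + h *\<^sub>R \<beta> x))"
        by (intro integral_nonneg_AE) (auto simp: u_def)
      moreover have "0 \<le> C * (h * sqrt h)" using C h by simp
      moreover have "u t x = 0" using True by (simp add: u_def)
      ultimately show ?thesis by simp
    next
      case False
      define z where "z = x - c t"
      define \<theta> where "\<theta> = \<beta> x - q"
      define S where "S = s t x"
      have S: "S > 0" "S = r0\<^sup>2 - (norm z)\<^sup>2" using False by (auto simp: s_def S_def z_def)
      have z: "norm z \<le> r0"
        by (rule power2_le_imp_le) (use S r0 in linarith)+
      have \<theta>: "norm \<theta> \<le> \<Theta>"
        unfolding \<theta>_def \<Theta>_def using \<Theta>0(2)[OF x] norm_triangle_ineq4[of "\<beta> x" q] by linarith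
      have zt: "\<bar>z \<bullet> \<theta>\<bar> \<le> r0 * \<Theta>"
        by (rule order.trans[OF Cauchy_Schwarz_ineq2 mult_mono[OF z \<theta>]]) (use r0 in auto)
      have "max 0 S ^ 3 + h * (3 * (max 0 S)\<^sup>2 * (- 2 * (z \<bullet> \<theta>) + - \<sigma>\<^sup>2 * D) + 3 * max 0 S * (norm ((- 2 * \<sigma>) *\<^sub>R z))\<^sup>2) - C * (h * sqrt h)
         \<le> (LINT y|gauss h. max 0 (s (t + h) (x + \<sigma> *\<^sub>R y + h *\<^sub>R \<beta> x)) ^ 3)"
      proof (rule step[of h S "- 2 * (z \<bullet> \<theta>)" "(- 2 * \<sigma>) *\<^sub>R z" "\<lambda>y. - \<sigma>\<^sup>2 * (norm y)\<^sup>2" "- \<sigma>\<^sup>2 * D"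
            "\<lambda>y. s (t + h) (x + \<sigma> *\<^sub>R y + h *\<^sub>R \<beta> x)" "r0\<^sup>2", OF h(1)])
        show "max 0 S \<le> r0\<^sup>2" unfolding S_def by (rule s_le)
        show "\<bar>- 2 * (z \<bullet> \<theta>)\<bar> \<le> m" unfolding abs_mult using zt mb(1) by simp
        have "\<bar>\<sigma>\<bar> * norm z \<le> \<bar>\<sigma>\<bar> * r0" using z by (intro mult_left_mono) auto
        then show "norm ((- 2 * \<sigma>) *\<^sub>R z) \<le> m" using mb(2) by (simp add: abs_mult)
        show "\<bar>- \<sigma>\<^sup>2 * (norm y)\<^sup>2\<bar> \<le> m * (norm y)\<^sup>2" for y :: 'e
          unfolding abs_mult using mb(3) m by (intro mult_mono) auto
        show "has_bochner_integral (gauss h) (\<lambda>y::'e. - \<sigma>\<^sup>2 * (norm y)\<^sup>2) (h * (- \<sigma>\<^sup>2 * D))"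
          using gauss_norm_square[OF h(1), where 'e='e] by (simp add: has_bochner_integral_iff D_def)
        show "(\<lambda>y. s (t + h) (x + \<sigma> *\<^sub>R y + h *\<^sub>R \<beta> x)) \<in> borel_measurable borel"
          unfolding s_def by measurable
        show "s (t + h) (x + \<sigma> *\<^sub>R y + h *\<^sub>R \<beta> x) \<le> r0\<^sup>2" for y by (simp add: s_def)
        fix y :: 'e assume y: "sqrt h + norm y \<le> 1"
        have eqz: "x + \<sigma> *\<^sub>R y + h *\<^sub>R \<beta> x - c (t + h) = z + (\<sigma> *\<^sub>R y + h *\<^sub>R \<theta>)"
          by (simp add: z_def c_def \<theta>_def algebra_simps)
        have "s (t + h) (x + \<sigma> *\<^sub>R y + h *\<^sub>R \<beta> x) = r0\<^sup>2 - (norm (z + (\<sigma> *\<^sub>R y + h *\<^sub>R \<theta>)))\<^sup>2"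
          unfolding s_def eqz ..
        also have "\<dots> = S + (- 2 * (z \<bullet> \<theta>)) * h + ((- 2 * \<sigma>) *\<^sub>R z) \<bullet> y + - \<sigma>\<^sup>2 * (norm y)\<^sup>2
            - (2 * \<sigma> * (h * (\<theta> \<bullet> y)) + h\<^sup>2 * (norm \<theta>)\<^sup>2)"
          unfolding S(2) power2_norm_eq_inner
          by (simp add: inner_add_left inner_add_right algebra_simps inner_commute power2_eq_square)
        also have "\<dots> \<ge> S + (- 2 * (z \<bullet> \<theta>)) * h + ((- 2 * \<sigma>) *\<^sub>R z) \<bullet> y + - \<sigma>\<^sup>2 * (norm y)\<^sup>2 - C0 * (sqrt h + norm y) ^ 3"
        proof -
          note E = scaling_errors[OF less_imp_le[OF h(1)] norm_ge_zero y]
          have "\<theta> \<bullet> y \<le> \<Theta> * norm y" "- (\<theta> \<bullet> y) \<le> \<Theta> * norm y"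
            using Cauchy_Schwarz_ineq2[of \<theta> y] mult_right_mono[OF \<theta> norm_ge_zero[of y]] by auto
          then have "\<bar>\<sigma> * (h * (\<theta> \<bullet> y))\<bar> \<le> \<bar>\<sigma>\<bar> * (h * (\<Theta> * norm y))"
            unfolding abs_mult using h by (intro mult_left_mono) auto
          also have "\<dots> = \<bar>\<sigma>\<bar> * \<Theta> * (h * norm y)" by simp
          also have "\<dots> \<le> \<bar>\<sigma>\<bar> * \<Theta> * (sqrt h + norm y) ^ 3" using E \<Theta> by (intro mult_left_mono) auto
          finally have e1: "\<bar>\<sigma> * (h * (\<theta> \<bullet> y))\<bar> \<le> \<bar>\<sigma>\<bar> * \<Theta> * (sqrt h + norm y) ^ 3" .
          have "h\<^sup>2 * (norm \<theta>)\<^sup>2 \<le> (sqrt h + norm y) ^ 3 * \<Theta>\<^sup>2"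
            using E \<theta> h by (intro mult_mono power_mono) auto
          with e1 show ?thesis unfolding C0_def distrib_right abs_le_iff by (simp add: mult.commute mult.left_commute)
        qed
        finally show "S + (- 2 * (z \<bullet> \<theta>)) * h + ((- 2 * \<sigma>) *\<^sub>R z) \<bullet> y + - \<sigma>\<^sup>2 * (norm y)\<^sup>2 - C0 * (sqrt h + norm y) ^ 3
            \<le> s (t + h) (x + \<sigma> *\<^sub>R y + h *\<^sub>R \<beta> x)" .
      qed
      moreover have "- K * S ^ 3 \<le> 3 * S\<^sup>2 * (- 2 * (z \<bullet> \<theta>) + - \<sigma>\<^sup>2 * D) + 3 * S * (norm ((- 2 * \<sigma>) *\<^sub>R z))\<^sup>2"
      proof -
        \<comment> \<open>Completes the square:
          \<open>12 * \<sigma>\<^sup>2 * r0\<^sup>2 * (1 - a)\<^sup>2\<close> is exactly the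
          polynomial with \<open>K * S\<^sup>2\<close> added.\<close>
        define a where "a = m' * S / (24 * \<sigma>\<^sup>2 * r0\<^sup>2)"
        have "0 \<le> 12 * \<sigma>\<^sup>2 * r0\<^sup>2 * (1 - a)\<^sup>2" by simp
        also have "\<dots> = 12 * \<sigma>\<^sup>2 * r0\<^sup>2 - m' * S + K * S\<^sup>2"
          using \<sigma> r0 by (simp add: a_def K_def power2_eq_square field_simps)
        finally have "0 \<le> S * (12 * \<sigma>\<^sup>2 * r0\<^sup>2 - m' * S + K * S\<^sup>2)" using S by simp
        moreover have "3 * S\<^sup>2 * (- 2 * (z \<bullet> \<theta>) + - \<sigma>\<^sup>2 * D) + 3 * S * (norm ((- 2 * \<sigma>) *\<^sub>R z))\<^sup>2
          = S * (12 * \<sigma>\<^sup>2 * (norm z)\<^sup>2 - S * (6 * (z \<bullet> \<theta>) + 3 * \<sigma>\<^sup>2 * D))"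
          by (simp add: power2_eq_square algebra_simps)
        moreover have "S * (12 * \<sigma>\<^sup>2 * (norm z)\<^sup>2 - S * (6 * (z \<bullet> \<theta>) + 3 * \<sigma>\<^sup>2 * D)) \<ge> S * (12 * \<sigma>\<^sup>2 * r0\<^sup>2 - m' * S)"
        proof -
          have "S * (6 * (z \<bullet> \<theta>) + 3 * \<sigma>\<^sup>2 * D) \<le> S * (m' - 12 * \<sigma>\<^sup>2)"
            using S zt by (intro mult_left_mono) (auto simp: m'_def)
          moreover have nz: "(norm z)\<^sup>2 = r0\<^sup>2 - S" using S by simp
          ultimately have "12 * \<sigma>\<^sup>2 * r0\<^sup>2 - m' * S \<le> 12 * \<sigma>\<^sup>2 * (norm z)\<^sup>2 - S * (6 * (z \<bullet> \<theta>) + 3 * \<sigma>\<^sup>2 * D)"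
            unfolding nz by (simp add: algebra_simps)
          then show ?thesis using S(1) by (intro mult_left_mono less_imp_le[OF S(1)])
        qed
        moreover have "S * (12 * \<sigma>\<^sup>2 * r0\<^sup>2 - m' * S + K * S\<^sup>2) = S * (12 * \<sigma>\<^sup>2 * r0\<^sup>2 - m' * S) + K * S ^ 3"
          by (simp add: power2_eq_square power3_eq_cube algebra_simps)
        ultimately show ?thesis by linarith
      qed
      then have "h * (- K * S ^ 3) \<le> h * (3 * S\<^sup>2 * (- 2 * (z \<bullet> \<theta>) + - \<sigma>\<^sup>2 * D) + 3 * S * (norm ((- 2 * \<sigma>) *\<^sub>R z))\<^sup>2)"
        using h by (intro mult_left_mono) auto
      moreover have "max 0 S = S" using S by simp
      moreover have "(1 - K * h) * u t x = S ^ 3 + h * (- K * S ^ 3)"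
        using S by (simp add: u_def S_def[symmetric] algebra_simps)
      ultimately show ?thesis by (simp add: u_def)
    qed
  qed (auto)
  moreover have "0 < (LINT \<omega>|M. indicator (space M) \<omega> * u t1 (X t1 \<omega>))"
  proof -
    define H where "H = {\<omega>\<in>space M. X t1 \<omega> \<in> ball p (r0 / 2)}"
    have [measurable]: "X t1 \<in> borel_measurable M" using t by (intro X_meas) auto
    have "H = X t1 -` ball p (r0 / 2) \<inter> space M" by (auto simp: H_def)
    then have HM [measurable]: "H \<in> sets M" by (simp add: measurable_sets_borel)
    have i: "integrable M (\<lambda>\<omega>. indicator (space M) \<omega> * u t1 (X t1 \<omega>))"
    proof (rule integrable_const_bound)
      show "AE \<omega> in M. norm (indicator (space M) \<omega> * u t1 (X t1 \<omega>)) \<le> (r0\<^sup>2) ^ 3"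
        using u_bd by (intro always_eventually allI) (simp add: indicator_def del: power_mult)
    qed measurable
    have "0 < (r0\<^sup>2 / 2) ^ 3 * prob H" using start[of "r0 / 2"] r0 by (simp add: H_def)
    also have "\<dots> = (LINT \<omega>|M. (r0\<^sup>2 / 2) ^ 3 * indicator H \<omega>)" by simp
    also have "\<dots> \<le> (LINT \<omega>|M. indicator (space M) \<omega> * u t1 (X t1 \<omega>))"
    proof (rule integral_mono[OF _ i])
      show "integrable M (\<lambda>\<omega>. (r0\<^sup>2 / 2) ^ 3 * indicator H \<omega>)"
        by (intro integrable_mult_right integrable_real_indicator) (auto simp: emeasure_eq_measure)
      fix \<omega> assume \<omega>: "\<omega> \<in> space M"
      show "(r0\<^sup>2 / 2) ^ 3 * indicator H \<omega> \<le> indicator (space M) \<omega> * u t1 (X t1 \<omega>)"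
      proof (cases "\<omega> \<in> H")
        case True
        then have "norm (X t1 \<omega> - c t1) \<le> r0 / 2" by (auto simp: H_def c_def dist_norm norm_minus_commute)
        then have "(norm (X t1 \<omega> - c t1))\<^sup>2 \<le> (r0 / 2)\<^sup>2" by (intro power_mono) auto
        moreover have "(r0 / 2)\<^sup>2 = r0\<^sup>2 / 4" by (simp add: power_divide)
        ultimately have "r0\<^sup>2 / 2 \<le> s t1 (X t1 \<omega>)" unfolding s_def using zero_le_power2[of r0] by linarith
        then have "(r0\<^sup>2 / 2) ^ 3 \<le> u t1 (X t1 \<omega>)" unfolding u_def by (intro power_mono) auto
        then show ?thesis using True \<omega> by simp
      qed (use u_bd in simp)
    qed
    finally show ?thesis .
  qed
  then have "0 < exp (- K * (t2 - t1)) * (LINT \<omega>|M. indicator (space M) \<omega> * u t1 (X t1 \<omega>))"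
    by (intro mult_pos_pos) simp
  ultimately have pos: "0 < (LINT \<omega>|M. indicator (space M) \<omega> * u t2 (X t2 \<omega>))"
    by simp
  show ?thesis
  proof (rule ccontr)
    assume "\<not> ?thesis"
    then have z: "prob {\<omega>\<in>space M. X t2 \<omega> \<in> ball (c t2) r} = 0" by (simp add: not_less measure_le_0_iff)
    have [measurable]: "X t2 \<in> borel_measurable M" using t by (intro X_meas) auto
    have "{\<omega>\<in>space M. X t2 \<omega> \<in> ball (c t2) r} = X t2 -` ball (c t2) r \<inter> space M" by auto
    then have "{\<omega>\<in>space M. X t2 \<omega> \<in> ball (c t2) r} \<in> sets M" by (simp add: measurable_sets_borel)
    then have "AE \<omega> in M. X t2 \<omega> \<notin> ball (c t2) r"
      using z by (intro AE_I[of _ _ "{\<omega>\<in>space M. X t2 \<omega> \<in> ball (c t2) r}"]) (auto simp: emeasure_eq_measure)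
    then have "AE \<omega> in M. indicator (space M) \<omega> * u t2 (X t2 \<omega>) = 0"
    proof eventually_elim
      case (elim \<omega>)
      then have "r0 \<le> norm (X t2 \<omega> - c t2)" using r0 by (auto simp: dist_norm norm_minus_commute)
      then have "s t2 (X t2 \<omega>) \<le> 0" unfolding s_def using r0 by (simp add: power_mono)
      then show ?case by (simp add: u_def)
    qed
    then have "(LINT \<omega>|M. indicator (space M) \<omega> * u t2 (X t2 \<omega>)) = 0" by (rule integral_eq_zero_AE)
    with pos show False by simp
  qed
qed

subsection \<open>Collision of an attracting pair\<close>

lemma powr_le_cubic:
  fixes q d U V :: real
  assumes q: "0 < q" "q < 1" and d: "0 < d" "d \<le> U" and V: "0 \<le> V"
  shows "V powr q \<le> U powr q + q * U powr (q - 1) * (V - U) - q * (1 - q) / 2 * U powr (q - 2) * (V - U)\<^sup>2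
    + q * (1 - q) * (2 - q) / 6 * d powr (q - 3) * \<bar>V - U\<bar> ^ 3"
proof -
  define P where "P = q * (1 - q) * (2 - q) / 6"
  have P: "P > 0" using q by (simp add: P_def)
  have U: "U > 0" using d by simp
  have err: "0 \<le> P * d powr (q - 3) * \<bar>V - U\<bar> ^ 3" using P by simp
  consider "V = U" | "V = 0" | "V > 0" "V \<noteq> U" using V by linarith
  then show ?thesis
  proof cases
    case 1
    then show ?thesis by simp
  next
    case 2
    have a: "U powr (q - 1) * U = U powr q" "U powr (q - 2) * U\<^sup>2 = U powr q"
      using U powr_add[of U "q - 1" 1] powr_add[of U "q - 2" 2] by simp_all
    have "U powr q + q * U powr (q - 1) * (V - U) - q * (1 - q) / 2 * U powr (q - 2) * (V - U)\<^sup>2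
      = U powr q - q * (U powr (q - 1) * U) - q * (1 - q) / 2 * (U powr (q - 2) * U\<^sup>2)"
      by (simp add: 2)
    also have "\<dots> = U powr q * ((1 - q) * (1 - q / 2))"
      unfolding a by (simp add: algebra_simps)
    also have "\<dots> \<ge> 0" using q by simp
    finally show ?thesis using 2 err q unfolding P_def by simp
  next
    case 3
    define f where "f = (\<lambda>(m::nat) t. if m = 0 then t powr q else if m = 1 then q * t powr (q - 1)
        else if m = 2 then q * (q - 1) * t powr (q - 2) else q * (q - 1) * (q - 2) * t powr (q - 3))"
    have D: "DERIV (f m) t :> f (Suc m) t" if "m < 3" "t > 0" for m t
    proof -
      consider "m = 0" | "m = 1" | "m = 2" using \<open>m < 3\<close> by linarith
      then show ?thesis
        using \<open>t > 0\<close> by cases (auto simp: f_def intro!: derivative_eq_intros)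
    qed
    have "\<exists>t. (if V < U then V < t \<and> t < U else U < t \<and> t < V) \<and>
        V powr q = (\<Sum>m<3. (f m U / fact m) * (V - U) ^ m) + (f 3 t / fact 3) * (V - U) ^ 3"
    proof (rule Taylor[where a="min U V" and b="max U V"])
      show "f 0 = (\<lambda>t. t powr q)" by (simp add: f_def)
      show "\<forall>m t. m < 3 \<and> min U V \<le> t \<and> t \<le> max U V \<longrightarrow> DERIV (f m) t :> f (Suc m) t"
        using D 3 U by auto
    qed (use 3 in auto)
    then obtain t where t: "if V < U then V < t \<and> t < U else U < t \<and> t < V"
      and e: "V powr q = (\<Sum>m<3. (f m U / fact m) * (V - U) ^ m) + (f 3 t / fact 3) * (V - U) ^ 3" by blast
    have "(\<Sum>m<3. (f m U / fact m) * (V - U) ^ m) = U powr q + q * U powr (q - 1) * (V - U) - q * (1 - q) / 2 * U powr (q - 2) * (V - U)\<^sup>2"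
      by (simp add: f_def numeral_3_eq_3 power2_eq_square field_simps)
    moreover have "(f 3 t / fact 3) * (V - U) ^ 3 = P * t powr (q - 3) * (V - U) ^ 3"
      by (simp add: f_def P_def fact_numeral field_simps)
    moreover have "P * t powr (q - 3) * (V - U) ^ 3 \<le> P * d powr (q - 3) * \<bar>V - U\<bar> ^ 3"
    proof (cases "V < U")
      case True
      then have "(V - U) ^ 3 \<le> 0" by (simp add: power3_eq_cube mult_nonneg_nonpos2 mult_le_0_iff)
      then have "P * t powr (q - 3) * (V - U) ^ 3 \<le> 0" using P by (simp add: mult_nonneg_nonpos)
      then show ?thesis using err by linarith
    next
      case False
      then have "t powr (q - 3) \<le> d powr (q - 3)"
        using t d q by (intro powr_mono2') auto
      moreover have "\<bar>V - U\<bar> = V - U" using False by simp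
      ultimately show ?thesis using False P by (simp add: mult_right_mono)
    qed
    ultimately show ?thesis unfolding P_def using e by linarith
  qed
qed

lemma powr_lipschitz:
  fixes q m U V :: real
  assumes q: "0 < q" "q < 1" and m: "0 < m" "m \<le> U" "m \<le> V"
  shows "\<bar>U powr q - V powr q\<bar> \<le> q * m powr (q - 1) * \<bar>U - V\<bar>"
proof -
  have *: "\<bar>U powr q - V powr q\<bar> \<le> q * m powr (q - 1) * \<bar>U - V\<bar>" if UV: "U < V" "m \<le> U" for U V
  proof -
    have "\<exists>z>U. z < V \<and> V powr q - U powr q = (V - U) * (q * z powr (q - 1))"
      using UV m by (intro MVT2) (auto intro!: derivative_eq_intros)
    then obtain z where z: "U < z" "V powr q - U powr q = (V - U) * (q * z powr (q - 1))" by blast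
    have "z powr (q - 1) \<le> m powr (q - 1)" using z UV m q by (intro powr_mono2') auto
    then have "(V - U) * (q * z powr (q - 1)) \<le> (V - U) * (q * m powr (q - 1))"
      using UV q by (intro mult_left_mono) auto
    moreover have "0 \<le> (V - U) * (q * z powr (q - 1))" using UV q by simp
    ultimately show ?thesis using z UV by (simp add: algebra_simps)
  qed
  show ?thesis
    using *[of U V] *[of V U] m by (cases U V rule: linorder_cases) (auto simp: abs_minus_commute)
qed

text \<open>The adjoint of the map from a configuration to the relative position of two particles.
  It turns statements on relative positions into statements on \<open>a \<bullet> y\<close>; the 2
  is the doubled variance of a difference of independent noises.\<close>

lemma pair_difference_adjoint:
  fixes y :: "real ^ 2 ^ 'n" and z :: "real ^ 2"
  assumes "i \<noteq> j"
  shows "z \<bullet> (y $ i - y $ j) = (axis i z - axis j z) \<bullet> y" "(norm (axis i z - axis j z))\<^sup>2 = 2 * (norm z)\<^sup>2"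
proof -
  show "z \<bullet> (y $ i - y $ j) = (axis i z - axis j z) \<bullet> y"
    by (simp add: inner_diff_left inner_diff_right inner_axis')
  show "(norm (axis i z - axis j z))\<^sup>2 = 2 * (norm z)\<^sup>2"
    using assms by (simp add: power2_norm_eq_inner inner_diff_left inner_diff_right inner_axis_axis)
qed

text \<open>The relative noise has variance \<open>2 * h\<close> in each direction of the plane;
  summing over the two basis vectors gives \<open>4 * h\<close>.\<close>

lemma gauss_pair_difference:
  fixes z :: "real ^ 2" and i j :: "'n::finite"
  assumes h: "h > 0" and ij: "i \<noteq> j"
  shows "has_bochner_integral (gauss h) (\<lambda>y::real^2^'n. (z \<bullet> (y $ i - y $ j))\<^sup>2) (h * (2 * (norm z)\<^sup>2))"
    "has_bochner_integral (gauss h) (\<lambda>y::real^2^'n. (norm (y $ i - y $ j))\<^sup>2) (h * 4)"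
proof -
  show 1: "has_bochner_integral (gauss h) (\<lambda>y::real^2^'n. (z \<bullet> (y $ i - y $ j))\<^sup>2) (h * (2 * (norm z)\<^sup>2))" for z :: "real ^ 2"
    unfolding has_bochner_integral_iff pair_difference_adjoint(1)[OF ij] pair_difference_adjoint(2)[OF ij, symmetric]
    by (intro conjI gauss_inner[OF h])
  have e: "(norm w)\<^sup>2 = (\<Sum>e\<in>Basis. (e \<bullet> w)\<^sup>2)" for w :: "real ^ 2"
    unfolding power2_norm_eq_inner by (subst euclidean_inner) (simp add: power2_eq_square inner_commute)
  have "has_bochner_integral (gauss h) (\<lambda>y::real^2^'n. \<Sum>e\<in>Basis. (e \<bullet> (y $ i - y $ j))\<^sup>2) (\<Sum>e\<in>(Basis::(real^2) set). h * (2 * (norm e)\<^sup>2))"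
    by (intro has_bochner_integral_sum 1)
  moreover have "(\<Sum>e\<in>(Basis::(real^2) set). h * (2 * (norm e)\<^sup>2)) = h * 4"
    by (simp add: norm_Basis)
  ultimately show "has_bochner_integral (gauss h) (\<lambda>y::real^2^'n. (norm (y $ i - y $ j))\<^sup>2) (h * 4)"
    unfolding e by simp
qed

text \<open>For composing a power with the increment \<open>l + w\<close> of the squared distance,
  where \<open>l\<close> has order \<rho> and \<open>w\<close> order \<open>\<rho>\<^sup>2\<close>:
  up to cubic errors the square can be replaced by \<open>l\<^sup>2\<close> from below, and the cube
  is itself an error.\<close>

lemma square_increment_bounds:
  fixes l w m \<rho> :: real
  assumes "0 \<le> \<rho>" "\<rho> \<le> 1" "0 \<le> m" "\<bar>l\<bar> \<le> m * \<rho>" "\<bar>w\<bar> \<le> m * \<rho>\<^sup>2"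
  shows "l\<^sup>2 - 2 * m\<^sup>2 * \<rho> ^ 3 \<le> (l + w)\<^sup>2" "\<bar>l + w\<bar> ^ 3 \<le> 8 * m ^ 3 * \<rho> ^ 3"
proof -
  have "\<bar>l * w\<bar> \<le> (m * \<rho>) * (m * \<rho>\<^sup>2)"
    unfolding abs_mult using assms by (intro mult_mono) auto
  then have "- (m\<^sup>2 * \<rho> ^ 3) \<le> l * w" by (simp add: power2_eq_square power3_eq_cube abs_le_iff algebra_simps)
  moreover have "(l + w)\<^sup>2 = l\<^sup>2 + 2 * (l * w) + w\<^sup>2" by (simp add: power2_eq_square algebra_simps)
  ultimately show "l\<^sup>2 - 2 * m\<^sup>2 * \<rho> ^ 3 \<le> (l + w)\<^sup>2" using zero_le_power2[of w] by linarith
  have "\<rho>\<^sup>2 \<le> \<rho>" using power_decreasing[of 1 2 \<rho>] assms by simp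
  then have "m * \<rho>\<^sup>2 \<le> m * \<rho>" using assms by (intro mult_left_mono) auto
  then have "\<bar>l + w\<bar> \<le> 2 * m * \<rho>" using assms by linarith
  then have "\<bar>l + w\<bar> ^ 3 \<le> (2 * m * \<rho>) ^ 3" by (intro power_mono) auto
  then show "\<bar>l + w\<bar> ^ 3 \<le> 8 * m ^ 3 * \<rho> ^ 3" by (simp add: power_mult_distrib)
qed

text \<open>With \<open>U = |x\<^sub>i - x\<^sub>j|\<^sup>2\<close>, the noise contributes \<open>4 \<sigma>\<^sup>2 q\<^sup>2 U\<^bsup>q - 1\<^esup>\<close> to the generator of \<open>U\<^bsup>q\<^esup>\<close> and the
  attraction at most \<open>- 2 \<gamma> q U\<^bsup>q - 1\<^esup>\<close>, so for small \<open>q > 0\<close> a large multiple of \<open>- U\<^bsup>q\<^esup>\<close> compensates the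
  localisation \<open>\<kappa> |x - y0|\<^sup>2\<close> and the linear decrease in time. The resulting barrier vanishes at \<open>t2\<close>,
  so mass near \<open>y0\<close> at time \<open>t1\<close> can only be lost through the collision set.\<close>

lemma no_collision_avoids_neighbourhood:
  fixes \<beta> :: "real ^ 2 ^ 'n \<Rightarrow> real ^ 2 ^ 'n" and y0 :: "real ^ 2 ^ 'n" and i j :: 'n
  assumes process: "additive_noise_process T \<sigma> M F \<beta> B X"
    and \<sigma>: "\<sigma> > 0" and t: "0 \<le> t1" "t1 < t2" "t2 \<le> T"
    and ij: "i \<noteq> j" and y0: "y0 $ i = y0 $ j" and r: "r > 0"
    and \<Omega>: "open \<Omega>" "continuous_on \<Omega> \<beta>" "{x \<in> cball y0 r. x $ i \<noteq> x $ j} \<subseteq> \<Omega>"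
    and \<gamma>: "\<gamma> > 0"
    and attract: "\<And>x. x \<in> cball y0 r \<Longrightarrow> x $ i \<noteq> x $ j \<Longrightarrow> (x $ i - x $ j) \<bullet> (\<beta> x $ i - \<beta> x $ j) \<le> - \<gamma>"
    and radial: "\<And>x. x \<in> cball y0 r \<Longrightarrow> x $ i \<noteq> x $ j \<Longrightarrow> (x - y0) \<bullet> \<beta> x \<le> \<Theta>"
    and no_collision: "AE \<omega> in M. \<forall>t\<in>{t1..t2}. X t \<omega> $ i \<noteq> X t \<omega> $ j"
  obtains r1 where "r1 > 0" "measure M {\<omega>\<in>space M. X t1 \<omega> \<in> ball y0 r1} = 0"
proof -
  interpret additive_noise_process T \<sigma> M F \<beta> B X by (rule process)
  define P :: "real ^ 2 ^ 'n \<Rightarrow> real ^ 2" where "P x = x $ i - x $ j" for x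
  have P_le: "norm (P x) \<le> 2 * norm x" for x
    unfolding P_def using norm_triangle_ineq4[of "x $ i" "x $ j"] Finite_Cartesian_Product.norm_nth_le[of x i] Finite_Cartesian_Product.norm_nth_le[of x j] by linarith
  have P_diff: "P (x - y) = P x - P y" and P_add: "P (x + y) = P x + P y" and P_scale: "P (c *\<^sub>R x) = c *\<^sub>R P x" for x y c
    by (simp_all add: P_def algebra_simps)
  have P_y0: "P y0 = 0" using y0 by (simp add: P_def)
  have P_near: "norm (P x) \<le> 2 * norm (x - y0)" for x using P_le[of "x - y0"] by (simp add: P_diff P_y0)
  have P_cont: "continuous_on S P" for S unfolding P_def by (intro continuous_intros)
  have [measurable]: "P \<in> borel_measurable borel" using P_cont by (rule borel_measurable_continuous_onI)
  define Pt :: "real ^ 2 \<Rightarrow> real ^ 2 ^ 'n" where "Pt z = axis i z - axis j z" for z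
  have Pt: "z \<bullet> P y = Pt z \<bullet> y" for z y unfolding P_def Pt_def by (rule pair_difference_adjoint[OF ij])
  have Pt_le: "norm (Pt z) \<le> 2 * norm z" for z
  proof (rule power2_le_imp_le)
    show "(norm (Pt z))\<^sup>2 \<le> (2 * norm z)\<^sup>2"
      unfolding Pt_def pair_difference_adjoint(2)[OF ij] by (simp add: power_mult_distrib)
  qed simp
  define D where "D = real DIM(real ^ 2 ^ 'n)"
  \<comment> \<open>The attraction contributes at least \<open>2 * \<gamma>\<close> to the bracket
    multiplying \<open>a * A1\<close> in the generator, the noise takes
    \<open>4 * \<sigma>\<^sup>2 * q\<close> away. The choice leaves at least half of the attraction,
    and the minimum with 1/2 keeps \<open>q < 1\<close>.\<close>
  define q where "q = min (1/2) (\<gamma> / (4 * \<sigma>\<^sup>2))"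
  have q: "0 < q" "q < 1" "4 * \<sigma>\<^sup>2 * q \<le> \<gamma>"
    using \<gamma> \<sigma> by (auto simp: q_def min_def field_simps)
  \<comment> \<open>Normalised so that \<kappa> times the squared distance reaches 1 on the sphere
    of radius \<open>r\<close>, and \<open>\<mu> * (t - t1)\<close> reaches 1 at \<open>t2\<close>:
    the barrier is 0 off the ball and at the final time.\<close>
  define \<kappa> where "\<kappa> = 1 / r\<^sup>2"
  define \<mu> where "\<mu> = 1 / (t2 - t1)"
  have \<kappa>: "\<kappa> > 0" and \<mu>: "\<mu> > 0" using r t by (auto simp: \<kappa>_def \<mu>_def)
  \<comment> \<open>\<open>\<kappa>s\<close> bounds the rate at which localisation and time decrease
    \<open>s\<close>. As \<open>q - 1 < 0\<close> and the squared distance of the pair is at most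
    \<open>4 * r\<^sup>2\<close> in the ball, \<open>Um\<close> is a lower bound for its power
    \<open>q - 1\<close>; \<open>a\<close> is then chosen so that the guaranteed gain
    \<open>a * (q * \<gamma> * Um)\<close> equals \<open>\<kappa>s\<close>.\<close>
  define \<kappa>s where "\<kappa>s = \<kappa> * (2 * max 0 \<Theta> + \<sigma>\<^sup>2 * D) + \<mu>"
  have \<kappa>s: "\<kappa>s > 0" unfolding \<kappa>s_def using \<kappa> \<mu> by (intro add_nonneg_pos) (auto simp: D_def)
  define Um where "Um = (4 * r\<^sup>2) powr (q - 1)"
  have Um: "Um > 0" using r by (simp add: Um_def)
  define a where "a = \<kappa>s / (q * \<gamma> * Um)"
  have a: "a > 0" "a * (q * \<gamma> * Um) = \<kappa>s" using \<kappa>s q \<gamma> Um by (auto simp: a_def)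
  define U where "U x = (norm (P x))\<^sup>2" for x
  define s where "s t x = 1 - a * U x powr q - \<kappa> * (norm (x - y0))\<^sup>2 - \<mu> * (t - t1)" for t x
  define u where "u t x = max 0 (s t x) ^ 3" for t x
  have s_le: "s t x \<le> 1" if "t1 \<le> t" for t x
  proof -
    have "0 \<le> a * U x powr q" "0 \<le> \<kappa> * (norm (x - y0))\<^sup>2" "0 \<le> \<mu> * (t - t1)" using a \<kappa> \<mu> that by auto
    then show ?thesis unfolding s_def by linarith
  qed
  have u_nonneg: "0 \<le> u t x" for t x by (simp add: u_def)
  have u_le: "u t x \<le> 1" if "t1 \<le> t" for t x
    unfolding u_def using s_le[OF that, of x] by (intro power_le_one) auto
  have s_meas [measurable]: "s t \<in> borel_measurable borel" for t unfolding s_def U_def by measurable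
  have u_meas [measurable]: "u t \<in> borel_measurable borel" for t unfolding u_def by measurable
  \<comment> \<open>Solves \<open>a * ((2 * \<rho>1)\<^sup>2) powr q = 1/4\<close>. Together with
    \<open>r / 2\<close> for the localisation, each of the two subtracted terms is at most 1/4 at
    time \<open>t1\<close>, so the barrier is at least \<open>(1/2) ^ 3\<close> on the small ball;
    hence the 8 below.\<close>
  define \<rho>1 where "\<rho>1 = sqrt ((1 / (4 * a)) powr (1 / q) / 4)"
  define r1 where "r1 = min \<rho>1 (r / 2)"
  have r1: "r1 > 0" "r1 \<le> \<rho>1" "r1 \<le> r / 2" using a r by (auto simp: r1_def \<rho>1_def)
  have s_half: "1/2 \<le> s t1 x" if "x \<in> ball y0 r1" for x
  proof -
    have n: "norm (x - y0) \<le> r1" using that by (simp add: dist_norm norm_minus_commute)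
    have "norm (P x) \<le> 2 * \<rho>1" using P_near[of x] n r1 by linarith
    then have "U x \<le> (2 * \<rho>1)\<^sup>2" unfolding U_def by (rule power_mono) simp
    also have "\<dots> = (1 / (4 * a)) powr (1 / q)" using a by (simp add: \<rho>1_def power_mult_distrib)
    finally have "U x powr q \<le> ((1 / (4 * a)) powr (1 / q)) powr q"
      using q by (intro powr_mono2) (auto simp: U_def)
    also have "\<dots> = 1 / (4 * a)" using q a by (simp add: powr_powr)
    finally have "a * U x powr q \<le> a * (1 / (4 * a))" using a by (intro mult_left_mono) auto
    also have "\<dots> = 1/4" using a by simp
    finally have e1: "a * U x powr q \<le> 1/4" .
    have "\<kappa> * (norm (x - y0))\<^sup>2 \<le> \<kappa> * (r / 2)\<^sup>2"
      using n r1 \<kappa> by (intro mult_left_mono power_mono) auto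
    also have "\<dots> = 1/4" using r by (simp add: \<kappa>_def power_divide)
    finally have "\<kappa> * (norm (x - y0))\<^sup>2 \<le> 1/4" .
    moreover have "s t1 x = 1 - a * U x powr q - \<kappa> * (norm (x - y0))\<^sup>2" by (simp add: s_def)
    ultimately show ?thesis using e1 by linarith
  qed
  define A where "A = {\<omega>\<in>space M. X t1 \<omega> \<in> ball y0 r1}"
  have "X t1 \<in> borel_measurable (F t1)" using t by (intro X_meas_F) auto
  then have "X t1 -` ball y0 r1 \<inter> space (F t1) \<in> sets (F t1)" by (rule measurable_sets) simp
  moreover have "X t1 -` ball y0 r1 \<inter> space (F t1) = A" by (auto simp: A_def)
  ultimately have AF: "A \<in> sets (F t1)" by simp
  then have AM [measurable]: "A \<in> sets M" using sets_F_subset by blast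
  \<comment> \<open>The constants of the discretisation below depend on \<delta> and blow up as
    \<delta> tends to 0, but neither \<open>r1\<close> nor the resulting inequality contains them.
    This is what allows \<delta> to tend to 0 afterwards.\<close>
  have bound: "prob A / 8 \<le> prob W"
    if \<delta>: "\<delta> > 0" and W: "W \<in> sets M" "AE \<omega> in M. \<omega> \<notin> W \<longrightarrow> (\<forall>t\<in>{t1..t2}. \<delta> \<le> norm (P (X t \<omega>)))" for \<delta> W
  proof -
    define G where "G = {x \<in> cball y0 r. \<delta> \<le> norm (P x)}"
    define Bad where "Bad = {x. norm (P x) < \<delta>}"
    have G: "compact G"
    proof -
      have "closed {x. \<delta> \<le> norm (P x)}" by (intro closed_Collect_le continuous_on_norm P_cont continuous_on_const)
      then have "compact (cball y0 r \<inter> {x. \<delta> \<le> norm (P x)})" by (intro compact_Int_closed compact_cball)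
      moreover have "cball y0 r \<inter> {x. \<delta> \<le> norm (P x)} = G" by (auto simp: G_def)
      ultimately show ?thesis by simp
    qed
    have G_ne: "x $ i \<noteq> x $ j" if "x \<in> G" for x using that \<delta> by (auto simp: G_def P_def)
    have G\<Omega>: "G \<subseteq> \<Omega>" using G_ne \<Omega>(3) by (auto simp: G_def)
    have "compact (\<beta> ` G)" using continuous_on_subset[OF \<Omega>(2) G\<Omega>] G by (rule compact_continuous_image)
    then obtain \<Theta>b where \<Theta>b: "\<Theta>b > 0" "\<And>x. x \<in> G \<Longrightarrow> norm (\<beta> x) \<le> \<Theta>b"
      using compact_imp_bounded[of "\<beta> ` G"] unfolding bounded_pos by auto
    \<comment> \<open>\<open>A1m\<close> and \<open>A2m\<close> dominate the Taylor coefficients of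
      the power on \<open>G\<close>, where the squared distance is at least
      \<open>\<delta>\<^sup>2\<close>, and \<open>A3\<close> weighs the cubic remainder.
      \<open>m1\<close> controls the first and second order parts of the increment of the squared
      distance, \<open>c1\<close> its cubic part; \<open>ma\<close>, \<open>mg\<close>,
      \<open>mq\<close> bound the coefficients of the expansion of \<open>s\<close>.\<close>
    define A1m where "A1m = q * (\<delta>\<^sup>2) powr (q - 1)"
    define A2m where "A2m = q * (1 - q) / 2 * (\<delta>\<^sup>2) powr (q - 2)"
    define A3 where "A3 = q * (1 - q) * (2 - q) / 6 * (\<delta>\<^sup>2) powr (q - 3)"
    define m1 where "m1 = 8 * \<sigma> * r + 8 * r * \<Theta>b + 4 * (\<sigma> + \<Theta>b)\<^sup>2"
    define c1 where "c1 = 8 * \<sigma> * \<Theta>b + 4 * \<Theta>b\<^sup>2"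
    define C0 where "C0 = a * (A1m * c1 + 2 * A2m * m1\<^sup>2 + 8 * A3 * m1 ^ 3) + \<kappa> * (2 * \<sigma> * \<Theta>b + \<Theta>b\<^sup>2)"
    define ma where "ma = 8 * a * A1m * r * \<Theta>b + 2 * \<kappa> * r * \<Theta>b + \<mu>"
    define mg where "mg = 8 * a * A1m * \<sigma> * r + 2 * \<kappa> * \<sigma> * r"
    define mq where "mq = 4 * a * A1m * \<sigma>\<^sup>2 + 64 * a * A2m * \<sigma>\<^sup>2 * r\<^sup>2 + \<kappa> * \<sigma>\<^sup>2"
    define m where "m = ma + mg + mq"
    have nn: "0 \<le> A1m" "0 \<le> A2m" "0 \<le> A3" "0 \<le> m1" "0 \<le> c1"
      using q \<sigma> r \<Theta>b by (auto simp: A1m_def A2m_def A3_def m1_def c1_def)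
    have nn2: "0 \<le> C0" "0 \<le> ma" "0 \<le> mg" "0 \<le> mq"
      using nn a \<kappa> \<mu> \<sigma> r \<Theta>b by (auto simp: C0_def ma_def mg_def mq_def)
    then have m: "0 \<le> m" "ma \<le> m" "mg \<le> m" "mq \<le> m" by (auto simp: m_def)
    obtain C where C: "C \<ge> 0" and step: "\<And>s \<alpha> (g::real^2^'n) Q \<tau> h s' Bd. 0 < h \<Longrightarrow> max 0 s \<le> 1 \<Longrightarrow> \<bar>\<alpha>\<bar> \<le> m \<Longrightarrow> norm g \<le> m \<Longrightarrow>
       (\<And>y. \<bar>Q y\<bar> \<le> m * (norm y)\<^sup>2) \<Longrightarrow> has_bochner_integral (gauss h) Q (h * \<tau>) \<Longrightarrow>
       s' \<in> borel_measurable borel \<Longrightarrow> (\<And>y. s' y \<le> Bd) \<Longrightarrow>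
       (\<And>y. sqrt h + norm y \<le> 1 \<Longrightarrow> s + \<alpha> * h + g \<bullet> y + Q y - C0 * (sqrt h + norm y) ^ 3 \<le> s' y) \<Longrightarrow>
       max 0 s ^ 3 + h * (3 * (max 0 s)\<^sup>2 * (\<alpha> + \<tau>) + 3 * max 0 s * (norm g)\<^sup>2) - C * (h * sqrt h)
         \<le> (LINT y|gauss h. max 0 (s' y) ^ 3)"
      using gauss_cube_step[of m 1 C0] m nn2 by (metis zero_le_one)
    \<comment> \<open>A displacement by \<open>\<delta> / 4\<close> changes the relative position by
      at most \<open>\<delta> / 2\<close>, so the squared distance stays above
      \<open>\<delta>\<^sup>2 / 4\<close>, where the power is Lipschitz.\<close>
    define L where "L = 3 * (a * (q * (\<delta>\<^sup>2 / 4) powr (q - 1) * (8 * (r + \<delta>))) + \<kappa> * (2 * (r + \<delta>)))"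
    \<comment> \<open>Here \<open>K = 0\<close>: the generator of the barrier will be nonnegative,
      so no exponential factor is lost. The only loss is the probability of coming closer than
      \<delta>.\<close>
    note BB = barrier[OF t AF G \<Omega>(1) G\<Omega> \<Omega>(2), where u=u and Bd=1 and Bad=Bad and ?\<delta>0.0="\<delta>/4" and L=L and K=0 and C=C and ?h0.0=1 and W=W]
    have main: "exp (- 0 * (t2 - t1)) * (LINT \<omega>|M. indicator A \<omega> * u t1 (X t1 \<omega>)) - 1 * prob W
      \<le> (LINT \<omega>|M. indicator A \<omega> * u t2 (X t2 \<omega>))"
    proof (rule BB)
      show "u t \<in> borel_measurable borel" "0 \<le> u t x" for t x by (rule u_meas u_nonneg)+
      show "u t x \<le> 1" if "t \<in> {t1..t2}" for t x using that by (intro u_le) auto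
      show "Bad \<in> sets borel" unfolding Bad_def by measurable
      show "u t x = 0" if tt: "t \<in> {t1..t2}" and x: "x \<notin> G" "x \<notin> Bad" for t x
      proof -
        have "r < norm (x - y0)" using x by (auto simp: G_def Bad_def dist_norm norm_minus_commute)
        then have "r\<^sup>2 \<le> (norm (x - y0))\<^sup>2" using r by (intro power_mono) auto
        then have "\<kappa> * r\<^sup>2 \<le> \<kappa> * (norm (x - y0))\<^sup>2" using \<kappa> by (intro mult_left_mono) auto
        moreover have "\<kappa> * r\<^sup>2 = 1" using r by (simp add: \<kappa>_def)
        moreover have "0 \<le> a * U x powr q" "0 \<le> \<mu> * (t - t1)" using a \<mu> tt by auto
        ultimately have "s t x \<le> 0" unfolding s_def by linarith
        then show ?thesis by (simp add: u_def)
      qed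
      show "\<delta> / 4 > 0" using \<delta> by simp
      show "L \<ge> 0" unfolding L_def using a q \<kappa> \<delta> r by simp
      show "\<bar>u t x' - u t x''\<bar> \<le> L * norm (x' - x'')"
        if tt: "t \<in> {t1..t2}" and x: "x \<in> G" and x': "norm (x' - x) \<le> \<delta> / 4" and x'': "norm (x'' - x) \<le> \<delta> / 4" for t x x' x''
      proof -
        have w: "\<delta> / 2 \<le> norm (P w)" "norm (w - y0) \<le> r + \<delta>" if "norm (w - x) \<le> \<delta> / 4" for w
        proof -
          have "norm (P x) - norm (P w) \<le> norm (P w - P x)" using norm_triangle_ineq2[of "P x" "P w"] by (simp add: norm_minus_commute)
          also have "\<dots> \<le> 2 * norm (w - x)" using P_le[of "w - x"] by (simp add: P_diff)
          finally show "\<delta> / 2 \<le> norm (P w)" using that x by (simp add: G_def)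
          have "norm (w - y0) \<le> norm (w - x) + norm (x - y0)" using norm_triangle_ineq[of "w - x" "x - y0"] by simp
          then show "norm (w - y0) \<le> r + \<delta>" using that x \<delta> by (simp add: G_def dist_norm norm_minus_commute)
        qed
        have Uge: "\<delta>\<^sup>2 / 4 \<le> U w" if "norm (w - x) \<le> \<delta> / 4" for w
        proof -
          have "(\<delta> / 2)\<^sup>2 \<le> U w" unfolding U_def using w(1)[OF that] \<delta> by (intro power_mono) auto
          then show ?thesis by (simp add: power_divide)
        qed
        have "\<bar>U x' - U x''\<bar> \<le> norm (P x' - P x'') * (norm (P x') + norm (P x''))"
          unfolding U_def by (rule norm_square_diff_le)
        also have "\<dots> \<le> (2 * norm (x' - x'')) * (2 * (r + \<delta>) + 2 * (r + \<delta>))"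
          using P_le[of "x' - x''"] P_near[of x'] P_near[of x''] w(2)[OF x'] w(2)[OF x'']
          by (intro mult_mono add_mono) (auto simp: P_diff)
        finally have dU: "\<bar>U x' - U x''\<bar> \<le> 8 * (r + \<delta>) * norm (x' - x'')" by (simp add: algebra_simps)
        have "\<bar>U x' powr q - U x'' powr q\<bar> \<le> q * (\<delta>\<^sup>2 / 4) powr (q - 1) * \<bar>U x' - U x''\<bar>"
          using Uge[OF x'] Uge[OF x''] \<delta> q by (intro powr_lipschitz) auto
        also have "\<dots> \<le> q * (\<delta>\<^sup>2 / 4) powr (q - 1) * (8 * (r + \<delta>) * norm (x' - x''))"
          using dU q by (intro mult_left_mono) auto
        finally have d1: "a * \<bar>U x' powr q - U x'' powr q\<bar> \<le> a * (q * (\<delta>\<^sup>2 / 4) powr (q - 1) * (8 * (r + \<delta>) * norm (x' - x'')))"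
          using a by (intro mult_left_mono) auto
        have "\<bar>(norm (x' - y0))\<^sup>2 - (norm (x'' - y0))\<^sup>2\<bar> \<le> norm ((x' - y0) - (x'' - y0)) * (norm (x' - y0) + norm (x'' - y0))"
          by (rule norm_square_diff_le)
        also have "\<dots> \<le> norm (x' - x'') * (2 * (r + \<delta>))"
          using w(2)[OF x'] w(2)[OF x''] by (intro mult_mono) auto
        finally have d2: "\<kappa> * \<bar>(norm (x' - y0))\<^sup>2 - (norm (x'' - y0))\<^sup>2\<bar> \<le> \<kappa> * (norm (x' - x'') * (2 * (r + \<delta>)))"
          using \<kappa> by (intro mult_left_mono) auto
        have "s t x' - s t x'' = - (a * (U x' powr q - U x'' powr q)) - \<kappa> * ((norm (x' - y0))\<^sup>2 - (norm (x'' - y0))\<^sup>2)"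
          by (simp add: s_def algebra_simps)
        then have "\<bar>s t x' - s t x''\<bar> \<le> a * \<bar>U x' powr q - U x'' powr q\<bar> + \<kappa> * \<bar>(norm (x' - y0))\<^sup>2 - (norm (x'' - y0))\<^sup>2\<bar>"
          using abs_triangle_ineq4[of "- (a * (U x' powr q - U x'' powr q))" "\<kappa> * ((norm (x' - y0))\<^sup>2 - (norm (x'' - y0))\<^sup>2)"] a \<kappa>
          by (simp add: abs_mult)
        then have "3 * \<bar>s t x' - s t x''\<bar> \<le> L * norm (x' - x'')"
          using d1 d2 unfolding L_def by (simp add: algebra_simps)
        moreover have "\<bar>u t x' - u t x''\<bar> \<le> 3 * 1\<^sup>2 * \<bar>s t x' - s t x''\<bar>"
          unfolding u_def using s_le[of t] tt by (intro max_cube_diff_le) auto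
        ultimately show ?thesis by simp
      qed
      show "(1 - 0 * h) * u t x - C * (h * sqrt h) \<le> (LINT y|gauss h. u (t + h) (x + \<sigma> *\<^sub>R y + h *\<^sub>R \<beta> x))"
        if tt: "t1 \<le> t" and h: "0 < h" "h \<le> 1" and th: "t + h \<le> t2" and x: "x \<in> G" for t h x
      proof -
        define d z b \<theta> where "d = x - y0" and "z = P x" and "b = \<beta> x" and "\<theta> = P b"
        have d: "norm d \<le> r" using x by (simp add: G_def d_def dist_norm norm_minus_commute)
        have z: "\<delta> \<le> norm z" "norm z \<le> 2 * r" using x P_near[of x] d by (auto simp: G_def z_def d_def)
        have b: "norm b \<le> \<Theta>b" "norm \<theta> \<le> 2 * \<Theta>b" using \<Theta>b(2)[OF x] P_le[of b] by (auto simp: b_def \<theta>_def)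
        have z\<theta>: "z \<bullet> \<theta> \<le> - \<gamma>" "d \<bullet> b \<le> \<Theta>"
          using attract[of x] radial[of x] G_ne[OF x] x by (auto simp: z_def \<theta>_def b_def d_def P_def G_def)
        have az: "\<bar>z \<bullet> w\<bar> \<le> 2 * r * norm w" for w
          using Cauchy_Schwarz_ineq2[of z w] mult_right_mono[OF z(2) norm_ge_zero[of w]] by linarith
        have ad: "\<bar>d \<bullet> w\<bar> \<le> r * norm w" for w
          using Cauchy_Schwarz_ineq2[of d w] mult_right_mono[OF d norm_ge_zero[of w]] by linarith
        have Ux: "U x = (norm z)\<^sup>2" "\<delta>\<^sup>2 \<le> U x" "U x \<le> 4 * r\<^sup>2"
          using power_mono[OF z(1), of 2] power_mono[OF z(2), of 2] \<delta> by (auto simp: U_def z_def power_mult_distrib)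
        have Upos: "U x > 0" using Ux(2) \<delta> by (intro less_le_trans[OF _ Ux(2)]) simp
        define A1 where "A1 = q * U x powr (q - 1)"
        define A2 where "A2 = q * (1 - q) / 2 * U x powr (q - 2)"
        have A1: "0 \<le> A1" "A1 \<le> A1m" "q * Um \<le> A1"
          using q Ux \<delta> Upos r unfolding A1_def A1m_def Um_def by (auto intro!: mult_left_mono powr_mono2')
        have A2: "0 \<le> A2" "A2 \<le> A2m"
          using q Ux \<delta> unfolding A2_def A2m_def by (auto intro!: mult_left_mono powr_mono2')
        \<comment> \<open>In the plane the second derivative in radial direction is proportional to
          the Laplacian part. This identity lets the two noise terms combine into
          \<open>- 4 * \<sigma>\<^sup>2 * q\<close>, where the factor \<open>q\<close> is what makes
          a small exponent useful.\<close>
        have A2z: "A2 * (norm z)\<^sup>2 = (1 - q) / 2 * A1"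
        proof -
          have "U x powr (q - 2) * U x = U x powr (q - 1)"
            using Upos powr_add[of "U x" "q - 2" 1] by simp
          then show ?thesis unfolding A1_def A2_def Ux(1)[symmetric] by simp
        qed
        \<comment> \<open>Coefficients of the one-step expansion of \<open>s\<close>: \<alpha> for
          time and drift, \<open>g\<close> for the part linear in the noise, \<open>Q\<close> for
          the quadratic part, and \<open>h * \<tau>\<close> the mean of \<open>Q\<close>. Thus
          \<open>\<alpha> + \<tau>\<close> is the generator applied to \<open>s\<close>.\<close>
        define \<alpha> where "\<alpha> = - 2 * a * A1 * (z \<bullet> \<theta>) - 2 * \<kappa> * (d \<bullet> b) - \<mu>"
        define g where "g = (- 2 * a * A1 * \<sigma>) *\<^sub>R Pt z - (2 * \<kappa> * \<sigma>) *\<^sub>R d"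
        define Q where "Q y = - (a * A1 * \<sigma>\<^sup>2) * (norm (P y))\<^sup>2 + 4 * a * A2 * \<sigma>\<^sup>2 * (z \<bullet> P y)\<^sup>2 - \<kappa> * \<sigma>\<^sup>2 * (norm y)\<^sup>2" for y
        define \<tau> where "\<tau> = - (a * A1 * \<sigma>\<^sup>2) * 4 + 4 * a * A2 * \<sigma>\<^sup>2 * (2 * (norm z)\<^sup>2) - \<kappa> * \<sigma>\<^sup>2 * D"
        have A1b: "a * A1 * v \<le> a * A1m * v" "a * A2 * v \<le> a * A2m * v" if "0 \<le> v" for v
          using A1 A2 a that by (auto intro!: mult_right_mono mult_left_mono)
        have aA: "0 \<le> a * A1" "0 \<le> a * A2" using a A1 A2 by auto
        have "max 0 (s t x) ^ 3 + h * (3 * (max 0 (s t x))\<^sup>2 * (\<alpha> + \<tau>) + 3 * max 0 (s t x) * (norm g)\<^sup>2) - C * (h * sqrt h)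
          \<le> (LINT y|gauss h. max 0 (s (t + h) (x + \<sigma> *\<^sub>R y + h *\<^sub>R \<beta> x)) ^ 3)"
        proof (rule step[of h "s t x" \<alpha> g Q \<tau> "\<lambda>y. s (t + h) (x + \<sigma> *\<^sub>R y + h *\<^sub>R \<beta> x)" 1, OF h(1)])
          show "max 0 (s t x) \<le> 1" using s_le[OF tt] by simp
          show "\<bar>\<alpha>\<bar> \<le> m"
          proof -
            have "\<bar>z \<bullet> \<theta>\<bar> \<le> 4 * r * \<Theta>b" using az[of \<theta>] mult_left_mono[OF b(2), of "2 * r"] r by linarith
            then have "a * A1 * \<bar>z \<bullet> \<theta>\<bar> \<le> a * A1m * (4 * r * \<Theta>b)"
              using A1 a nn by (intro mult_mono) auto
            moreover have "\<kappa> * \<bar>d \<bullet> b\<bar> \<le> \<kappa> * (r * \<Theta>b)"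
              using order.trans[OF ad[of b] mult_left_mono[OF b(1), of r]] r \<kappa> by (intro mult_left_mono) auto
            moreover have "\<bar>\<alpha>\<bar> \<le> 2 * (a * A1 * \<bar>z \<bullet> \<theta>\<bar>) + 2 * (\<kappa> * \<bar>d \<bullet> b\<bar>) + \<mu>"
            proof -
              have "\<bar>a * A1 * (z \<bullet> \<theta>)\<bar> = a * A1 * \<bar>z \<bullet> \<theta>\<bar>" "\<bar>\<kappa> * (d \<bullet> b)\<bar> = \<kappa> * \<bar>d \<bullet> b\<bar>"
                using abs_mult[of "a * A1" "z \<bullet> \<theta>"] abs_mult[of \<kappa> "d \<bullet> b"] aA \<kappa> by simp_all
              moreover have "\<alpha> = - (2 * (a * A1 * (z \<bullet> \<theta>))) - 2 * (\<kappa> * (d \<bullet> b)) - \<mu>" by (simp add: \<alpha>_def)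
              ultimately show ?thesis using \<mu> by linarith
            qed
            ultimately have "\<bar>\<alpha>\<bar> \<le> ma" unfolding ma_def by (simp add: algebra_simps)
            then show ?thesis using m by linarith
          qed
          show "norm g \<le> m"
          proof -
            have "norm g \<le> norm ((- 2 * a * A1 * \<sigma>) *\<^sub>R Pt z) + norm ((2 * \<kappa> * \<sigma>) *\<^sub>R d)"
              unfolding g_def by (rule norm_triangle_ineq4)
            also have "\<dots> = a * A1 * (2 * \<sigma> * norm (Pt z)) + 2 * \<kappa> * \<sigma> * norm d"
              using a A1 \<sigma> \<kappa> by (simp add: abs_mult)
            also have "\<dots> \<le> a * A1m * (2 * \<sigma> * (2 * (2 * r))) + 2 * \<kappa> * \<sigma> * r"
              using a A1 nn \<sigma> \<kappa> d Pt_le[of z] z by (intro add_mono mult_mono) auto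
            also have "\<dots> = mg" unfolding mg_def by simp
            finally show ?thesis using m by linarith
          qed
          show "\<bar>Q y\<bar> \<le> m * (norm y)\<^sup>2" for y
          proof -
            have n1: "(norm (P y))\<^sup>2 \<le> 4 * (norm y)\<^sup>2"
              using power_mono[OF P_le[of y], of 2] by (simp add: power_mult_distrib)
            have "\<bar>z \<bullet> P y\<bar> \<le> 4 * r * norm y" using az[of "P y"] mult_left_mono[OF P_le[of y], of "2 * r"] r by linarith
            then have n2: "(z \<bullet> P y)\<^sup>2 \<le> 16 * r\<^sup>2 * (norm y)\<^sup>2"
              using power_mono[of "\<bar>z \<bullet> P y\<bar>" "4 * r * norm y" 2] by (simp add: power_mult_distrib)
            have "a * A1 * (\<sigma>\<^sup>2 * (norm (P y))\<^sup>2) \<le> a * A1m * (\<sigma>\<^sup>2 * (4 * (norm y)\<^sup>2))"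
              using a A1 nn n1 by (intro mult_mono) auto
            moreover have "a * A2 * (4 * \<sigma>\<^sup>2 * (z \<bullet> P y)\<^sup>2) \<le> a * A2m * (4 * \<sigma>\<^sup>2 * (16 * r\<^sup>2 * (norm y)\<^sup>2))"
              using a A2 nn n2 by (intro mult_mono) auto
            moreover have "\<bar>Q y\<bar> \<le> a * A1 * (\<sigma>\<^sup>2 * (norm (P y))\<^sup>2) + a * A2 * (4 * \<sigma>\<^sup>2 * (z \<bullet> P y)\<^sup>2) + \<kappa> * \<sigma>\<^sup>2 * (norm y)\<^sup>2"
            proof -
              have "0 \<le> a * A1 * (\<sigma>\<^sup>2 * (norm (P y))\<^sup>2)" "0 \<le> a * A2 * (4 * \<sigma>\<^sup>2 * (z \<bullet> P y)\<^sup>2)" "0 \<le> \<kappa> * \<sigma>\<^sup>2 * (norm y)\<^sup>2"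
                using aA \<kappa> by auto
              moreover have "Q y = - (a * A1 * (\<sigma>\<^sup>2 * (norm (P y))\<^sup>2)) + a * A2 * (4 * \<sigma>\<^sup>2 * (z \<bullet> P y)\<^sup>2) - \<kappa> * \<sigma>\<^sup>2 * (norm y)\<^sup>2"
                by (simp add: Q_def)
              ultimately show ?thesis by linarith
            qed
            ultimately have "\<bar>Q y\<bar> \<le> mq * (norm y)\<^sup>2" unfolding mq_def by (simp add: algebra_simps)
            also have "\<dots> \<le> m * (norm y)\<^sup>2" using m by (intro mult_right_mono) auto
            finally show ?thesis .
          qed
          show "has_bochner_integral (gauss h) Q (h * \<tau>)"
          proof -
            have e: "h * \<tau> = - (a * A1 * \<sigma>\<^sup>2) * (h * 4) + 4 * a * A2 * \<sigma>\<^sup>2 * (h * (2 * (norm z)\<^sup>2)) - \<kappa> * \<sigma>\<^sup>2 * (h * D)"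
              by (simp add: \<tau>_def algebra_simps)
            have nsq: "has_bochner_integral (gauss h) (\<lambda>y::real^2^'n. (norm y)\<^sup>2) (h * D)"
              using gauss_norm_square[OF h(1), where 'e="real^2^'n"] by (simp add: has_bochner_integral_iff D_def)
            note pd = gauss_pair_difference[OF h(1) ij, folded P_def]
            show ?thesis
              unfolding e Q_def
              by (intro has_bochner_integral_diff has_bochner_integral_add has_bochner_integral_mult_right pd nsq)
          qed
          show "(\<lambda>y. s (t + h) (x + \<sigma> *\<^sub>R y + h *\<^sub>R \<beta> x)) \<in> borel_measurable borel" by measurable
          show "s (t + h) (x + \<sigma> *\<^sub>R y + h *\<^sub>R \<beta> x) \<le> 1" for y using tt h by (intro s_le) auto
          fix y :: "real ^ 2 ^ 'n" assume y: "sqrt h + norm y \<le> 1"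
          define \<rho> where "\<rho> = sqrt h + norm y"
          note E = scaling_errors[OF less_imp_le[OF h(1)] norm_ge_zero y, folded \<rho>_def]
          have \<rho>: "0 \<le> \<rho>" "\<rho> \<le> 1" using y h by (auto simp: \<rho>_def)
          have r3: "0 \<le> \<rho> ^ 3" using \<rho> by simp
          define \<zeta> where "\<zeta> = P y"
          have \<zeta>: "norm \<zeta> \<le> 2 * norm y" unfolding \<zeta>_def by (rule P_le)
          \<comment> \<open>The squared distance grows by \<open>l + w\<close>. Inside
            \<open>w\<close> only the first two terms count for the generator; \<open>e1\<close> is
            of cubic order.\<close>
          define l where "l = 2 * \<sigma> * (z \<bullet> \<zeta>)"
          define e1 where "e1 = 2 * \<sigma> * h * (\<zeta> \<bullet> \<theta>) + h\<^sup>2 * (norm \<theta>)\<^sup>2"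
          define w where "w = 2 * h * (z \<bullet> \<theta>) + \<sigma>\<^sup>2 * (norm \<zeta>)\<^sup>2 + e1"
          define x' where "x' = x + \<sigma> *\<^sub>R y + h *\<^sub>R \<beta> x"
          have Px': "P x' = z + (\<sigma> *\<^sub>R \<zeta> + h *\<^sub>R \<theta>)"
            by (simp add: x'_def P_add P_scale z_def \<zeta>_def \<theta>_def b_def)
          have w_eq: "w = 2 * h * (z \<bullet> \<theta>) + (norm (\<sigma> *\<^sub>R \<zeta> + h *\<^sub>R \<theta>))\<^sup>2"
            unfolding w_def e1_def power2_norm_eq_inner
            by (simp add: inner_add_left inner_add_right algebra_simps inner_commute power2_eq_square)
          have dU: "U x' - U x = l + w"
            unfolding w_eq unfolding U_def Px' l_def z_def[symmetric] power2_norm_eq_inner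
            by (simp add: inner_add_left inner_add_right algebra_simps inner_commute)
          have h\<rho>: "h \<le> \<rho>" using E(3) power_decreasing[of 1 2 \<rho>] \<rho> by simp
          have l_le: "\<bar>l\<bar> \<le> m1 * \<rho>"
          proof -
            have "\<bar>z \<bullet> \<zeta>\<bar> \<le> 2 * r * (2 * \<rho>)" using az[of \<zeta>] mult_left_mono[of "norm \<zeta>" "2 * \<rho>" "2 * r"] \<zeta> E(4) r by linarith
            then have "2 * \<sigma> * \<bar>z \<bullet> \<zeta>\<bar> \<le> 2 * \<sigma> * (2 * r * (2 * \<rho>))" using \<sigma> by (intro mult_left_mono) auto
            then have "\<bar>l\<bar> \<le> (8 * \<sigma> * r) * \<rho>" using \<sigma> by (simp add: l_def abs_mult)
            also have "\<dots> \<le> m1 * \<rho>" using \<rho> r \<Theta>b \<sigma> by (intro mult_right_mono) (auto simp: m1_def)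
            finally show ?thesis .
          qed
          have w_le: "\<bar>w\<bar> \<le> m1 * \<rho>\<^sup>2"
          proof -
            have "\<bar>z \<bullet> \<theta>\<bar> \<le> 4 * r * \<Theta>b" using az[of \<theta>] mult_left_mono[OF b(2), of "2 * r"] r by linarith
            then have "h * \<bar>z \<bullet> \<theta>\<bar> \<le> \<rho>\<^sup>2 * (4 * r * \<Theta>b)" using h E by (intro mult_mono) auto
            then have w1: "\<bar>2 * h * (z \<bullet> \<theta>)\<bar> \<le> 8 * r * \<Theta>b * \<rho>\<^sup>2" using h by (simp add: abs_mult algebra_simps)
            have "norm (\<sigma> *\<^sub>R \<zeta> + h *\<^sub>R \<theta>) \<le> \<sigma> * norm \<zeta> + h * norm \<theta>"
              using norm_triangle_ineq[of "\<sigma> *\<^sub>R \<zeta>" "h *\<^sub>R \<theta>"] \<sigma> h by simp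
            also have "\<dots> \<le> \<sigma> * (2 * \<rho>) + \<rho> * (2 * \<Theta>b)"
              using \<sigma> h \<zeta> b h\<rho> E(4) \<rho> by (intro add_mono mult_mono) auto
            also have "\<dots> = 2 * (\<sigma> + \<Theta>b) * \<rho>" by (simp add: algebra_simps)
            finally have "(norm (\<sigma> *\<^sub>R \<zeta> + h *\<^sub>R \<theta>))\<^sup>2 \<le> (2 * (\<sigma> + \<Theta>b) * \<rho>)\<^sup>2" by (rule power_mono) simp
            then have w2: "(norm (\<sigma> *\<^sub>R \<zeta> + h *\<^sub>R \<theta>))\<^sup>2 \<le> 4 * (\<sigma> + \<Theta>b)\<^sup>2 * \<rho>\<^sup>2"
              using power_mult_distrib[of "2 * (\<sigma> + \<Theta>b)" \<rho> 2] power_mult_distrib[of 2 "\<sigma> + \<Theta>b" 2] by simp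
            have "0 \<le> 8 * \<sigma> * r * \<rho>\<^sup>2" using \<sigma> r by simp
            moreover have "\<bar>w\<bar> \<le> \<bar>2 * h * (z \<bullet> \<theta>)\<bar> + (norm (\<sigma> *\<^sub>R \<zeta> + h *\<^sub>R \<theta>))\<^sup>2"
              unfolding w_eq using zero_le_power2[of "norm (\<sigma> *\<^sub>R \<zeta> + h *\<^sub>R \<theta>)"] by linarith
            ultimately show ?thesis using w1 w2 unfolding m1_def distrib_right by linarith
          qed
          have e1_le: "e1 \<le> c1 * \<rho> ^ 3"
          proof -
            have "\<zeta> \<bullet> \<theta> \<le> (2 * norm y) * (2 * \<Theta>b)"
              using Cauchy_Schwarz_ineq2[of \<zeta> \<theta>] mult_mono[OF \<zeta> b(2)] by simp
            then have "2 * \<sigma> * h * (\<zeta> \<bullet> \<theta>) \<le> 2 * \<sigma> * h * ((2 * norm y) * (2 * \<Theta>b))"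
              using \<sigma> h by (intro mult_left_mono) auto
            also have "\<dots> = 8 * \<sigma> * \<Theta>b * (h * norm y)" by simp
            also have "\<dots> \<le> 8 * \<sigma> * \<Theta>b * \<rho> ^ 3" using E \<sigma> \<Theta>b by (intro mult_left_mono) auto
            finally have "2 * \<sigma> * h * (\<zeta> \<bullet> \<theta>) \<le> 8 * \<sigma> * \<Theta>b * \<rho> ^ 3" .
            moreover have "h\<^sup>2 * (norm \<theta>)\<^sup>2 \<le> \<rho> ^ 3 * (2 * \<Theta>b)\<^sup>2"
              using E b \<rho> by (intro mult_mono power_mono) auto
            ultimately show ?thesis unfolding e1_def c1_def by (simp add: power_mult_distrib algebra_simps)
          qed
          note sq = square_increment_bounds[OF \<rho> nn(4) l_le w_le]
          have "U x' powr q \<le> U x powr q + A1 * (l + w) - A2 * (l + w)\<^sup>2 + A3 * \<bar>l + w\<bar> ^ 3"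
            using powr_le_cubic[OF q(1,2) _ Ux(2), of "U x'"] \<delta> unfolding dU A1_def A2_def A3_def by (simp add: U_def)
          also have "\<dots> \<le> U x powr q + A1 * (l + w) - (A2 * l\<^sup>2 - 2 * A2m * m1\<^sup>2 * \<rho> ^ 3) + A3 * (8 * m1 ^ 3 * \<rho> ^ 3)"
          proof -
            have "A2 * (l\<^sup>2 - 2 * m1\<^sup>2 * \<rho> ^ 3) \<le> A2 * (l + w)\<^sup>2" using sq(1) A2 by (intro mult_left_mono)
            moreover have "A2 * (2 * m1\<^sup>2 * \<rho> ^ 3) \<le> A2m * (2 * m1\<^sup>2 * \<rho> ^ 3)" using A2 r3 by (intro mult_right_mono) auto
            moreover have "A3 * \<bar>l + w\<bar> ^ 3 \<le> A3 * (8 * m1 ^ 3 * \<rho> ^ 3)" using sq(2) nn by (intro mult_left_mono)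
            ultimately show ?thesis by (simp add: algebra_simps)
          qed
          also have "\<dots> \<le> U x powr q + A1 * (l + 2 * h * (z \<bullet> \<theta>) + \<sigma>\<^sup>2 * (norm \<zeta>)\<^sup>2) + A1m * (c1 * \<rho> ^ 3)
              - (A2 * l\<^sup>2 - 2 * A2m * m1\<^sup>2 * \<rho> ^ 3) + A3 * (8 * m1 ^ 3 * \<rho> ^ 3)"
          proof -
            have "A1 * e1 \<le> A1 * (c1 * \<rho> ^ 3)" using e1_le A1 by (intro mult_left_mono)
            also have "\<dots> \<le> A1m * (c1 * \<rho> ^ 3)" using A1 nn r3 by (intro mult_right_mono) auto
            finally show ?thesis unfolding w_def by (simp add: algebra_simps)
          qed
          finally have "a * U x' powr q \<le> a * (U x powr q + A1 * (l + 2 * h * (z \<bullet> \<theta>) + \<sigma>\<^sup>2 * (norm \<zeta>)\<^sup>2) + A1m * (c1 * \<rho> ^ 3)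
              - (A2 * l\<^sup>2 - 2 * A2m * m1\<^sup>2 * \<rho> ^ 3) + A3 * (8 * m1 ^ 3 * \<rho> ^ 3))"
            using a by (intro mult_left_mono) auto
          moreover have "\<kappa> * (norm (x' - y0))\<^sup>2 \<le> \<kappa> * ((norm d)\<^sup>2 + 2 * \<sigma> * (d \<bullet> y) + 2 * h * (d \<bullet> b) + \<sigma>\<^sup>2 * (norm y)\<^sup>2 + (2 * \<sigma> * \<Theta>b + \<Theta>b\<^sup>2) * \<rho> ^ 3)"
          proof (intro mult_left_mono)
            have "x' - y0 = d + (\<sigma> *\<^sub>R y + h *\<^sub>R b)" by (simp add: x'_def d_def b_def)
            then have "(norm (x' - y0))\<^sup>2 = (norm d)\<^sup>2 + 2 * \<sigma> * (d \<bullet> y) + 2 * h * (d \<bullet> b) + \<sigma>\<^sup>2 * (norm y)\<^sup>2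
                + (2 * \<sigma> * (h * (y \<bullet> b)) + h\<^sup>2 * (norm b)\<^sup>2)"
              unfolding power2_norm_eq_inner
              by (simp add: inner_add_left inner_add_right algebra_simps inner_commute power2_eq_square)
            moreover have "2 * \<sigma> * (h * (y \<bullet> b)) \<le> 2 * \<sigma> * (\<Theta>b * \<rho> ^ 3)"
            proof -
              have "y \<bullet> b \<le> norm y * \<Theta>b" using Cauchy_Schwarz_ineq2[of y b] mult_left_mono[OF b(1) norm_ge_zero[of y]] by linarith
              then have "h * (y \<bullet> b) \<le> \<Theta>b * (h * norm y)" using h mult_left_mono[of "y \<bullet> b" "norm y * \<Theta>b" h] by (simp add: ac_simps)
              also have "\<dots> \<le> \<Theta>b * \<rho> ^ 3" using E \<Theta>b by (intro mult_left_mono) auto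
              finally show ?thesis using \<sigma> by (intro mult_left_mono) auto
            qed
            moreover have "h\<^sup>2 * (norm b)\<^sup>2 \<le> \<rho> ^ 3 * \<Theta>b\<^sup>2" using E b \<rho> by (intro mult_mono power_mono) auto
            ultimately show "(norm (x' - y0))\<^sup>2 \<le> (norm d)\<^sup>2 + 2 * \<sigma> * (d \<bullet> y) + 2 * h * (d \<bullet> b) + \<sigma>\<^sup>2 * (norm y)\<^sup>2 + (2 * \<sigma> * \<Theta>b + \<Theta>b\<^sup>2) * \<rho> ^ 3"
              by (simp add: algebra_simps)
          qed (use \<kappa> in auto)
          moreover have "s (t + h) x' = 1 - a * U x' powr q - \<kappa> * (norm (x' - y0))\<^sup>2 - \<mu> * (t + h - t1)" by (simp add: s_def)
          moreover have "s t x + \<alpha> * h + g \<bullet> y + Q y - C0 * \<rho> ^ 3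
            = 1 - a * (U x powr q + A1 * (l + 2 * h * (z \<bullet> \<theta>) + \<sigma>\<^sup>2 * (norm \<zeta>)\<^sup>2) + A1m * (c1 * \<rho> ^ 3)
              - (A2 * l\<^sup>2 - 2 * A2m * m1\<^sup>2 * \<rho> ^ 3) + A3 * (8 * m1 ^ 3 * \<rho> ^ 3))
             - \<kappa> * ((norm d)\<^sup>2 + 2 * \<sigma> * (d \<bullet> y) + 2 * h * (d \<bullet> b) + \<sigma>\<^sup>2 * (norm y)\<^sup>2 + (2 * \<sigma> * \<Theta>b + \<Theta>b\<^sup>2) * \<rho> ^ 3)
             - \<mu> * (t + h - t1)"
          proof -
            have gy: "g \<bullet> y = - (2 * a * A1 * \<sigma>) * (z \<bullet> \<zeta>) - (2 * \<kappa> * \<sigma>) * (d \<bullet> y)"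
              by (simp add: g_def \<zeta>_def Pt inner_diff_left)
            have l2: "l\<^sup>2 = 4 * \<sigma>\<^sup>2 * (z \<bullet> \<zeta>)\<^sup>2" by (simp add: l_def power_mult_distrib)
            have sd: "s t x = 1 - a * U x powr q - \<kappa> * (norm d)\<^sup>2 - \<mu> * (t - t1)" by (simp add: s_def d_def)
            show ?thesis
              unfolding gy l2 sd unfolding Q_def \<alpha>_def C0_def l_def \<zeta>_def[symmetric] by (simp add: algebra_simps)
          qed
          ultimately have "s t x + \<alpha> * h + g \<bullet> y + Q y - C0 * \<rho> ^ 3 \<le> s (t + h) x'" by linarith
          then show "s t x + \<alpha> * h + g \<bullet> y + Q y - C0 * (sqrt h + norm y) ^ 3 \<le> s (t + h) (x + \<sigma> *\<^sub>R y + h *\<^sub>R \<beta> x)"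
            unfolding \<rho>_def x'_def .
        qed
        \<comment> \<open>After the noise has used up to half of the attraction, a gain of at least
          \<open>a * (q * Um) * \<gamma> = \<kappa>s\<close> is left, which is the price of
          localisation and of the decrease in time.\<close>
        moreover have "0 \<le> \<alpha> + \<tau>"
        proof -
          have "\<alpha> + \<tau> = a * A1 * (- 2 * (z \<bullet> \<theta>) - 4 * \<sigma>\<^sup>2) + 8 * a * \<sigma>\<^sup>2 * (A2 * (norm z)\<^sup>2) - \<kappa> * (2 * (d \<bullet> b) + \<sigma>\<^sup>2 * D) - \<mu>"
            by (simp add: \<alpha>_def \<tau>_def algebra_simps)
          also have "\<dots> = a * A1 * (- 2 * (z \<bullet> \<theta>) - 4 * \<sigma>\<^sup>2 * q) - \<kappa> * (2 * (d \<bullet> b) + \<sigma>\<^sup>2 * D) - \<mu>"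
            unfolding A2z by (simp add: field_simps)
          finally have eq: "\<alpha> + \<tau> = a * A1 * (- 2 * (z \<bullet> \<theta>) - 4 * \<sigma>\<^sup>2 * q) - \<kappa> * (2 * (d \<bullet> b) + \<sigma>\<^sup>2 * D) - \<mu>" .
          have "a * (q * Um) * \<gamma> \<le> a * A1 * (- 2 * (z \<bullet> \<theta>) - 4 * \<sigma>\<^sup>2 * q)"
            using a A1 q z\<theta> \<gamma> Um by (intro mult_mono) auto
          moreover have "\<kappa> * (2 * (d \<bullet> b) + \<sigma>\<^sup>2 * D) \<le> \<kappa> * (2 * max 0 \<Theta> + \<sigma>\<^sup>2 * D)"
            using z\<theta>(2) \<kappa> by (intro mult_left_mono) auto
          moreover have "a * (q * Um) * \<gamma> = \<kappa>s" using a(2) by (simp add: ac_simps)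
          ultimately show ?thesis unfolding eq \<kappa>s_def by linarith
        qed
        then have "0 \<le> h * (3 * (max 0 (s t x))\<^sup>2 * (\<alpha> + \<tau>) + 3 * max 0 (s t x) * (norm g)\<^sup>2)"
        proof -
          have "0 \<le> 3 * (max 0 (s t x))\<^sup>2 * (\<alpha> + \<tau>)" using \<open>0 \<le> \<alpha> + \<tau>\<close> by (rule mult_nonneg_nonneg[rotated]) simp
          moreover have "0 \<le> 3 * max 0 (s t x) * (norm g)\<^sup>2" by simp
          ultimately show ?thesis using h(1) by (simp only: add_nonneg_nonneg mult_nonneg_nonneg less_imp_le)
        qed
        ultimately show ?thesis unfolding u_def by simp
      qed
      show "AE \<omega> in M. \<omega> \<notin> W \<longrightarrow> (\<forall>t\<in>{t1..t2}. X t \<omega> \<notin> Bad)"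
        using W(2) by eventually_elim (force simp: Bad_def)
    qed (use C W in auto)
    have "s t2 x \<le> 0" for x
    proof -
      have "\<mu> * (t2 - t1) = 1" using t by (simp add: \<mu>_def)
      moreover have "0 \<le> a * U x powr q" "0 \<le> \<kappa> * (norm (x - y0))\<^sup>2" using a \<kappa> by auto
      ultimately show ?thesis unfolding s_def by linarith
    qed
    then have "u t2 x = 0" for x by (simp add: u_def)
    then have "(LINT \<omega>|M. indicator A \<omega> * u t1 (X t1 \<omega>)) \<le> prob W" using main by simp
    moreover have "prob A / 8 \<le> (LINT \<omega>|M. indicator A \<omega> * u t1 (X t1 \<omega>))"
    proof -
      have [measurable]: "X t1 \<in> borel_measurable M" using t by (intro X_meas) auto
      have "prob A / 8 = (LINT \<omega>|M. (1/8) * indicator A \<omega>)" by simp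
      also have "\<dots> \<le> (LINT \<omega>|M. indicator A \<omega> * u t1 (X t1 \<omega>))"
      proof (rule integral_mono)
        show "integrable M (\<lambda>\<omega>. (1/8) * indicator A \<omega> :: real)"
          by (intro integrable_mult_right integrable_real_indicator) (auto simp: emeasure_eq_measure)
        show "integrable M (\<lambda>\<omega>. indicator A \<omega> * u t1 (X t1 \<omega>))"
        proof (rule integrable_const_bound)
          show "AE \<omega> in M. norm (indicator A \<omega> * u t1 (X t1 \<omega>)) \<le> 1"
            using u_nonneg u_le[of t1] by (intro always_eventually allI) (simp add: indicator_def)
        qed measurable
        fix \<omega>
        show "1 / 8 * indicator A \<omega> \<le> indicator A \<omega> * u t1 (X t1 \<omega>)"
        proof (cases "\<omega> \<in> A")
          case True
          then have "1/2 \<le> s t1 (X t1 \<omega>)" by (intro s_half) (simp add: A_def)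
          then have "(1/2) ^ 3 \<le> u t1 (X t1 \<omega>)" unfolding u_def by (intro power_mono) auto
          then show ?thesis using True by (simp add: power3_eq_cube)
        qed simp
      qed
      finally show ?thesis .
    qed
    ultimately show ?thesis by linarith
  qed
  have pos: "AE \<omega> in M. \<forall>t\<in>{t1..t2}. 0 < norm (P (X t \<omega>))"
    using no_collision by eventually_elim (simp add: P_def)
  obtain W where W: "\<And>\<delta>. W \<delta> \<in> sets M" "\<And>\<delta>. AE \<omega> in M. \<omega> \<notin> W \<delta> \<longrightarrow> (\<forall>t\<in>{t1..t2}. \<delta> \<le> norm (P (X t \<omega>)))"
    "(\<lambda>n. prob (W (1 / real (Suc n)))) \<longlonglongrightarrow> 0"
    using small_values_vanish[OF t continuous_on_norm[OF P_cont] pos] by blast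
  have "prob A / 8 \<le> 0"
  proof (rule tendsto_lowerbound[OF W(3)])
    show "\<forall>\<^sub>F n in sequentially. prob A / 8 \<le> prob (W (1 / real (Suc n)))"
      by (intro always_eventually allI bound[OF _ W(1,2)]) simp
  qed simp
  then have "prob A = 0" using measure_nonneg[of M A] by linarith
  then show thesis using that[OF r1(1)] by (simp add: A_def)
qed

subsection \<open>The interaction drift\<close>

abbreviation noncolliding :: "(real ^ 2 ^ 'n) set" where
  "noncolliding \<equiv> {x. \<forall>k l. k \<noteq> l \<longrightarrow> x $ k \<noteq> x $ l}"

definition drift :: "real \<Rightarrow> real ^ 'n \<Rightarrow> real ^ 2 ^ 'n \<Rightarrow> real ^ 2 ^ 'n" where
  "drift \<gamma> b x = (\<chi> i. \<gamma> *\<^sub>R interaction b x i)"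

lemma interaction_kernel_minus: "interaction_kernel (- x) = - interaction_kernel x"
  by (simp add: interaction_kernel_def)

text \<open>The interaction changes the squared distance of a pair at a constant rate, independent
  of the distance. This is the same scaling as that of planar noise, so neither dominates the other
  near a collision.\<close>

lemma inner_interaction_kernel: "x \<noteq> 0 \<Longrightarrow> x \<bullet> interaction_kernel x = 1"
  by (simp add: interaction_kernel_def power2_norm_eq_inner)

lemma norm_interaction_kernel_le: "0 < d \<Longrightarrow> d \<le> norm x \<Longrightarrow> norm (interaction_kernel x) \<le> 1 / d"
  by (auto simp: interaction_kernel_def power2_eq_square divide_simps)

lemma interaction_kernel_measurable [measurable]: "interaction_kernel \<in> borel_measurable borel"
  unfolding interaction_kernel_def by measurable

lemma interaction_measurable [measurable]: "(\<lambda>x. interaction b x i) \<in> borel_measurable borel"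
proof -
  have [measurable]: "(\<lambda>x::real^2^'a. x $ k) \<in> borel_measurable borel" for k :: 'a
    by (intro borel_measurable_continuous_onI continuous_intros)
  show ?thesis unfolding interaction_def by measurable
qed

text \<open>Writes a configuration as a sum of bounded linear images of its components, through
  which measurability and integrals pass one particle at a time.\<close>

lemma vec_lambda_axis: "(\<chi> i. f i) = (\<Sum>i\<in>UNIV. axis i (f i))"
  by (simp add: vec_eq_iff axis_def)

lemma bounded_linear_axis_scaleR:
  fixes c :: real
  shows "bounded_linear (\<lambda>v::real^2. axis k (c *\<^sub>R v) :: real ^ 2 ^ 'n)"
proof -
  have "linear (\<lambda>v::real^2. axis k (c *\<^sub>R v) :: real ^ 2 ^ 'n)"
    by (rule linearI) (auto simp: vec_eq_iff axis_def scaleR_add_right)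
  then show ?thesis by (simp add: linear_conv_bounded_linear)
qed

lemma drift_eq_sum: "drift \<gamma> b x = (\<Sum>k\<in>UNIV. axis k (\<gamma> *\<^sub>R interaction b x k))"
  unfolding drift_def by (rule vec_lambda_axis)

lemma drift_measurable [measurable]: "drift \<gamma> b \<in> borel_measurable borel"
  unfolding drift_eq_sum[abs_def]
  by (intro borel_measurable_sum measurable_compose[OF interaction_measurable]
      borel_measurable_continuous_onI linear_continuous_on bounded_linear_axis_scaleR)

lemma open_noncolliding: "open (noncolliding :: (real ^ 2 ^ 'n) set)"
proof -
  have "noncolliding = (\<Inter>k. \<Inter>l. {x :: real ^ 2 ^ 'n. k \<noteq> l \<longrightarrow> x $ k \<noteq> x $ l})" by auto
  moreover have "open {x :: real ^ 2 ^ 'n. k \<noteq> l \<longrightarrow> x $ k \<noteq> x $ l}" for k l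
    by (cases "k = l") (auto intro!: open_Collect_neq continuous_intros)
  ultimately show ?thesis by (auto intro!: open_INT)
qed

text \<open>Off the diagonal the kernel is a quotient with nonvanishing denominator, and the
  self-interaction terms are constant because the kernel has the default value 0 at 0.\<close>

lemma drift_continuous: "continuous_on noncolliding (drift \<gamma> b)"
proof -
  have "continuous_on noncolliding (\<lambda>x. interaction_kernel (x $ i - x $ j))" for i j :: 'a
  proof (cases "i = j")
    case False
    have "continuous_on noncolliding (\<lambda>x. (x $ i - x $ j) /\<^sub>R (norm (x $ i - x $ j))\<^sup>2)"
      using False by (intro continuous_intros) auto
    then show ?thesis
      by (rule continuous_on_eq) (use False in \<open>auto simp: interaction_kernel_def\<close>)
  qed (simp add: interaction_kernel_def)
  then show ?thesis
    unfolding drift_def interaction_def by (intro continuous_on_vec_lambda continuous_intros)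
qed

text \<open>Collects the equations of the particles into one equation in configuration space. The
  finite integral of the norms in \<open>weak_solution\<close> supplies integrability; the remaining
  point is measurability in time along a fixed path.\<close>

lemma weak_solution_process:
  assumes "weak_solution T \<sigma> \<gamma> b M\<^sub>0 X\<^sub>0 M F X"
  obtains B where "additive_noise_process T \<sigma> M F (drift \<gamma> b) B X"
proof -
  obtain B where fps: "filtered_prob_space M F" and B: "brownian_motion_upto T M F B" and X: "adapted_upto T F X"
    and c: "AE \<omega> in M. continuous_on {0..T} (\<lambda>t. X t \<omega>)"
    and i: "AE \<omega> in M. (\<integral>\<^sup>+ s\<in>{0..T}. ennreal (\<Sum>i\<in>UNIV. norm (interaction b (X s \<omega>) i)) \<partial>lborel) < \<infinity>"
    and e: "AE \<omega> in M. \<forall>t\<in>{0..T}. \<forall>i. X t \<omega> $ i = X 0 \<omega> $ i + \<sigma> *\<^sub>R (B t \<omega> $ i)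
             + \<gamma> *\<^sub>R (LINT s:{0..t}|lborel. interaction b (X s \<omega>) i)"
    using assms unfolding weak_solution_def by blast
  have si: "set_integrable lborel {0..T} (\<lambda>s. interaction b (X s \<omega>) k)"
    if c: "continuous_on {0..T} (\<lambda>t. X t \<omega>)"
      and i: "(\<integral>\<^sup>+ s\<in>{0..T}. ennreal (\<Sum>i\<in>UNIV. norm (interaction b (X s \<omega>) i)) \<partial>lborel) < \<infinity>" for \<omega> k
    unfolding set_integrable_def
  proof (rule integrableI_bounded)
    \<comment> \<open>Outside \<open>{0..T}\<close> the path is arbitrary, so it is set to 0 there
      before the Borel function is applied.\<close>
    have "(\<lambda>s. indicator {0..T} s *\<^sub>R X s \<omega>) \<in> borel_measurable borel"
      using c by (intro borel_measurable_continuous_on_indicator) auto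
    then have m: "(\<lambda>s. interaction b (indicator {0..T} s *\<^sub>R X s \<omega>) k) \<in> borel_measurable borel"
      by (rule measurable_compose[OF _ interaction_measurable])
    have "(\<lambda>s. indicator {0..T} s *\<^sub>R interaction b (X s \<omega>) k) = (\<lambda>s. indicator {0..T} s *\<^sub>R interaction b (indicator {0..T} s *\<^sub>R X s \<omega>) k)"
      by (auto simp: indicator_def)
    moreover have "(\<lambda>s. indicator {0..T} s *\<^sub>R interaction b (indicator {0..T} s *\<^sub>R X s \<omega>) k) \<in> borel_measurable borel"
      using m by measurable
    ultimately show "(\<lambda>s. indicator {0..T} s *\<^sub>R interaction b (X s \<omega>) k) \<in> borel_measurable lborel" by simp
    have "(\<integral>\<^sup>+ s. ennreal (norm (indicator {0..T} s *\<^sub>R interaction b (X s \<omega>) k)) \<partial>lborel)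
      \<le> (\<integral>\<^sup>+ s\<in>{0..T}. ennreal (\<Sum>i\<in>UNIV. norm (interaction b (X s \<omega>) i)) \<partial>lborel)"
      by (intro nn_integral_mono) (auto simp: indicator_def intro!: ennreal_leI member_le_sum)
    then show "(\<integral>\<^sup>+ s. ennreal (norm (indicator {0..T} s *\<^sub>R interaction b (X s \<omega>) k)) \<partial>lborel) < \<infinity>"
      using i by (rule le_less_trans)
  qed
  show thesis
  proof (rule that, unfold_locales)
    show "AE \<omega> in M. set_integrable lborel {0..T} (\<lambda>s. drift \<gamma> b (X s \<omega>))"
      using c i
    proof eventually_elim
      case (elim \<omega>)
      have "(\<lambda>s. indicator {0..T} s *\<^sub>R drift \<gamma> b (X s \<omega>))
          = (\<lambda>s. \<Sum>k\<in>UNIV. axis k (\<gamma> *\<^sub>R (indicator {0..T} s *\<^sub>R interaction b (X s \<omega>) k)))"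
        by (auto simp: drift_def vec_lambda_axis[symmetric] vec_eq_iff)
      then show ?case
        using si[OF elim] unfolding set_integrable_def
        by (simp only:) (intro Bochner_Integration.integrable_sum integrable_bounded_linear[OF bounded_linear_axis_scaleR])
    qed
    show "AE \<omega> in M. \<forall>t\<in>{0..T}. X t \<omega> = X 0 \<omega> + \<sigma> *\<^sub>R B t \<omega> + (LINT s:{0..t}|lborel. drift \<gamma> b (X s \<omega>))"
      using c i e
    proof eventually_elim
      case (elim \<omega>)
      show ?case
      proof
        fix t assume t: "t \<in> {0..T}"
        have int: "set_integrable lborel {0..t} (\<lambda>s. interaction b (X s \<omega>) k)" for k
          by (rule set_integrable_subset[OF si[OF elim(1,2)]]) (use t in auto)
        have "(LINT s:{0..t}|lborel. drift \<gamma> b (X s \<omega>))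
            = (LINT s|lborel. (\<Sum>k\<in>UNIV. axis k (\<gamma> *\<^sub>R (indicator {0..t} s *\<^sub>R interaction b (X s \<omega>) k))))"
          unfolding set_lebesgue_integral_def
          by (intro Bochner_Integration.integral_cong refl) (auto simp: drift_def vec_lambda_axis[symmetric] vec_eq_iff)
        also have "\<dots> = (\<Sum>k\<in>UNIV. (LINT s|lborel. axis k (\<gamma> *\<^sub>R (indicator {0..t} s *\<^sub>R interaction b (X s \<omega>) k))))"
          using int unfolding set_integrable_def
          by (intro Bochner_Integration.integral_sum integrable_bounded_linear[OF bounded_linear_axis_scaleR])
        also have "\<dots> = (\<Sum>k\<in>UNIV. axis k (\<gamma> *\<^sub>R (LINT s:{0..t}|lborel. interaction b (X s \<omega>) k)))"
          using int unfolding set_integrable_def set_lebesgue_integral_def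
          by (intro sum.cong refl integral_bounded_linear[OF bounded_linear_axis_scaleR])
        finally have "(LINT s:{0..t}|lborel. drift \<gamma> b (X s \<omega>)) = (\<chi> k. \<gamma> *\<^sub>R (LINT s:{0..t}|lborel. interaction b (X s \<omega>) k))"
          by (simp add: vec_lambda_axis)
        then show "X t \<omega> = X 0 \<omega> + \<sigma> *\<^sub>R B t \<omega> + (LINT s:{0..t}|lborel. drift \<gamma> b (X s \<omega>))"
          using elim(3)[rule_format, OF t] by (simp add: vec_eq_iff)
      qed
    qed
  qed (use fps B X c in auto)
qed

text \<open>Near \<open>y0\<close> only the terms between \<open>i\<close> and \<open>j\<close> are
  singular. They act on the two particles in opposite directions and contribute exactly
  \<open>- 2 * \<gamma>\<close> to the attraction and, since \<open>y0 $ i = y0 $ j\<close>, exactly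
  \<open>- \<gamma>\<close> to the radial product. All other terms are bounded, and a small ball
  makes their share of the attraction at most \<gamma>.\<close>

lemma drift_near_collision:
  fixes b :: "real ^ 'n" and y0 :: "real ^ 2 ^ 'n"
  assumes \<gamma>: "\<gamma> > 0" and b: "\<And>k. \<bar>b $ k\<bar> = 1" and opp: "b $ i * b $ j = - 1" and ij: "i \<noteq> j"
    and y0: "y0 $ i = y0 $ j" and others: "\<And>k l. k \<noteq> l \<Longrightarrow> {k, l} \<noteq> {i, j} \<Longrightarrow> y0 $ k \<noteq> y0 $ l"
  obtains r \<Theta> where "r > 0" "{x \<in> cball y0 r. x $ i \<noteq> x $ j} \<subseteq> noncolliding"
    "\<And>x. x \<in> cball y0 r \<Longrightarrow> x $ i \<noteq> x $ j \<Longrightarrow> (x $ i - x $ j) \<bullet> (drift \<gamma> b x $ i - drift \<gamma> b x $ j) \<le> - \<gamma>"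
    "\<And>x. x \<in> cball y0 r \<Longrightarrow> x $ i \<noteq> x $ j \<Longrightarrow> (x - y0) \<bullet> drift \<gamma> b x \<le> \<Theta>"
proof -
  define N where "N = real CARD('n)"
  have N: "N \<ge> 1" unfolding N_def using one_le_card_finite[where 'a='n] by linarith
  define pairs where "pairs = {(k, l). k \<noteq> l \<and> {k, l} \<noteq> {i, j}}"
  obtain d where d: "d > 0" "\<And>k l. k \<noteq> l \<Longrightarrow> {k, l} \<noteq> {i, j} \<Longrightarrow> d \<le> norm (y0 $ k - y0 $ l)"
  proof
    \<comment> \<open>The extra element 1 keeps the set nonempty when there are just two particles
      and hence no other pair.\<close>
    define D where "D = insert 1 ((\<lambda>(k, l). norm (y0 $ k - y0 $ l)) ` pairs)"
    have fin: "finite D" unfolding D_def by (intro finite.insertI finite_imageI finite_subset[of pairs UNIV]) auto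
    have pos: "norm (y0 $ k - y0 $ l) > 0" if "(k, l) \<in> pairs" for k l
      using others[of k l] that unfolding pairs_def by simp
    then have "x > 0" if "x \<in> D" for x using that by (force simp: D_def)
    then show "0 < Min D" using fin by (subst Min_gr_iff) (auto simp: D_def)
    show "Min D \<le> norm (y0 $ k - y0 $ l)" if "k \<noteq> l" "{k, l} \<noteq> {i, j}" for k l
      using fin that by (intro Min_le) (auto simp: D_def pairs_def)
  qed
  \<comment> \<open>With the bound \<open>\<gamma> * (N * (2 / d))\<close> on each component of the
    regular part, this radius gives exactly \<open>4 * (r * c) = \<gamma>\<close> below. It also
    satisfies \<open>4 * r \<le> d\<close>, so all other pairs stay \<open>d / 2\<close>
    apart.\<close>
  define r where "r = d / (8 * N)"
  have r: "r > 0" using d N by (simp add: r_def)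
  have r8: "8 * N * r = d" using N by (simp add: r_def)
  have r4: "4 * r \<le> d"
  proof -
    have "1 * r \<le> N * r" using N r by (intro mult_right_mono) auto
    then show ?thesis using r8 r by linarith
  qed
  have far: "d / 2 \<le> norm (x $ k - x $ l)" if x: "x \<in> cball y0 r" and kl: "k \<noteq> l" "{k, l} \<noteq> {i, j}" for x k l
  proof -
    have n: "norm (y0 $ m - x $ m) \<le> r" for m
      using Finite_Cartesian_Product.norm_nth_le[of "y0 - x" m] x by (simp add: dist_norm)
    have "norm (y0 $ k - y0 $ l) = norm ((y0 $ k - x $ k) + (x $ k - x $ l) - (y0 $ l - x $ l))" by simp
    also have "\<dots> \<le> norm (y0 $ k - x $ k) + norm (x $ k - x $ l) + norm (y0 $ l - x $ l)"
      by (rule order.trans[OF norm_triangle_ineq4 add_right_mono[OF norm_triangle_ineq]])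
    finally have "norm (y0 $ k - y0 $ l) \<le> norm (y0 $ k - x $ k) + norm (x $ k - x $ l) + norm (y0 $ l - x $ l)" .
    then show ?thesis using d(2)[OF kl] n[of k] n[of l] r4 by linarith
  qed
  define kern where "kern x = \<gamma> *\<^sub>R interaction_kernel (x $ i - x $ j)" for x :: "real ^ 2 ^ 'n"
  \<comment> \<open>The regular part of the interaction: all terms except those of the singular
    pair. The self-interaction is included, being 0.\<close>
  define R where "R x k = (\<Sum>l\<in>UNIV. if {k, l} = {i, j} then 0 else (b $ k * b $ l) *\<^sub>R interaction_kernel (x $ k - x $ l))" for x k
  have R_le: "norm (\<gamma> *\<^sub>R R x k) \<le> \<gamma> * (N * (2 / d))" if x: "x \<in> cball y0 r" for x k
  proof -
    have "norm (R x k) \<le> (\<Sum>l\<in>(UNIV::'n set). 2 / d)"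
      unfolding R_def
    proof (intro sum_norm_le)
      fix l :: 'n
      show "norm (if {k, l} = {i, j} then 0 else (b $ k * b $ l) *\<^sub>R interaction_kernel (x $ k - x $ l)) \<le> 2 / d"
      proof (cases "{k, l} = {i, j} \<or> k = l")
        case True
        then show ?thesis using d(1) by (auto simp: interaction_kernel_def)
      next
        case False
        then have "norm (interaction_kernel (x $ k - x $ l)) \<le> 1 / (d / 2)"
          using d(1) far[OF x] by (intro norm_interaction_kernel_le) auto
        then show ?thesis using False b by (simp add: abs_mult)
      qed
    qed
    also have "\<dots> = N * (2 / d)" by (simp add: N_def)
    finally have "\<gamma> * norm (R x k) \<le> \<gamma> * (N * (2 / d))" using \<gamma> by (intro mult_left_mono) auto
    then show ?thesis using \<gamma> by (simp only: norm_scaleR abs_of_pos)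
  qed
  have drift_k: "drift \<gamma> b x $ k = \<gamma> *\<^sub>R R x k + (if k = i then - kern x else if k = j then kern x else 0)" for x k
  proof -
    have "interaction b x k = R x k + (\<Sum>l\<in>UNIV. if {k, l} = {i, j} then (b $ k * b $ l) *\<^sub>R interaction_kernel (x $ k - x $ l) else 0)"
      unfolding interaction_def R_def sum.distrib[symmetric] by (intro sum.cong) auto
    also have "(\<Sum>l\<in>UNIV. if {k, l} = {i, j} then (b $ k * b $ l) *\<^sub>R interaction_kernel (x $ k - x $ l) else 0)
      = (if k = i then - interaction_kernel (x $ i - x $ j) else if k = j then interaction_kernel (x $ i - x $ j) else 0)"
    proof -
      have p: "{k, l} = {i, j} \<longleftrightarrow> (if k = i then l = j else if k = j then l = i else False)" for l
        using ij by (auto simp: doubleton_eq_iff)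
      have m: "interaction_kernel (x $ j - x $ i) = - interaction_kernel (x $ i - x $ j)"
        using interaction_kernel_minus[of "x $ i - x $ j"] by simp
      have opp': "b $ j * b $ i = - 1" using opp by (simp add: mult.commute)
      show ?thesis
        unfolding p using ij opp opp' m by (cases "k = i"; cases "k = j") (simp_all add: sum.delta)
    qed
    finally show ?thesis by (simp add: drift_def kern_def scaleR_add_right)
  qed
  have kern_inner: "(x $ i - x $ j) \<bullet> kern x = \<gamma>" if "x $ i \<noteq> x $ j" for x
    using inner_interaction_kernel[of "x $ i - x $ j"] that by (simp add: kern_def)
  show thesis
  proof (rule that[of r "N * (r * (\<gamma> * (N * (2 / d))))"])
    show "r > 0" by (rule r)
    show "{x \<in> cball y0 r. x $ i \<noteq> x $ j} \<subseteq> noncolliding"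
    proof safe
      fix x k l assume x: "x \<in> cball y0 r" "x $ i \<noteq> x $ j" and kl: "k \<noteq> l" "x $ k = x $ l"
      show False
      proof (cases "{k, l} = {i, j}")
        case True
        then show ?thesis using x kl by (auto simp: doubleton_eq_iff)
      next
        case False
        then show ?thesis using far[OF x(1) kl(1)] kl d(1) by simp
      qed
    qed
    fix x assume x: "x \<in> cball y0 r" "x $ i \<noteq> x $ j"
    have n: "norm (x $ m - y0 $ m) \<le> r" for m
      using Finite_Cartesian_Product.norm_nth_le[of "x - y0" m] x by (simp add: dist_norm norm_minus_commute)
    define c where "c = \<gamma> * (N * (2 / d))"
    have c: "c \<ge> 0" using \<gamma> N d by (simp add: c_def)
    have cr: "4 * (r * c) \<le> \<gamma>"
    proof -
      have "4 * (r * c) = \<gamma> * (8 * N * r) / d" by (simp add: c_def)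
      then show ?thesis unfolding r8 using d(1) by simp
    qed
    show "(x $ i - x $ j) \<bullet> (drift \<gamma> b x $ i - drift \<gamma> b x $ j) \<le> - \<gamma>"
    proof -
      define w where "w = \<gamma> *\<^sub>R R x i - \<gamma> *\<^sub>R R x j"
      have "norm (x $ i - x $ j) \<le> 2 * r"
        using n[of i] n[of j] y0 norm_triangle_ineq4[of "x $ i - y0 $ i" "x $ j - y0 $ j"] by simp
      moreover have "norm w \<le> 2 * c"
        using order.trans[OF norm_triangle_ineq4 add_mono[OF R_le[OF x(1)] R_le[OF x(1)]], of i j]
        unfolding w_def c_def by (simp add: ac_simps)
      ultimately have "norm (x $ i - x $ j) * norm w \<le> (2 * r) * (2 * c)" using r by (intro mult_mono) auto
      then have "(x $ i - x $ j) \<bullet> w \<le> \<gamma>"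
        using Cauchy_Schwarz_ineq2[of "x $ i - x $ j" w] cr by linarith
      moreover have "drift \<gamma> b x $ i - drift \<gamma> b x $ j = w - 2 *\<^sub>R kern x"
        using ij by (simp add: drift_k w_def scaleR_2)
      ultimately show ?thesis using kern_inner[OF x(2)] by (simp add: inner_diff_right)
    qed
    show "(x - y0) \<bullet> drift \<gamma> b x \<le> N * (r * (\<gamma> * (N * (2 / d))))"
    proof -
      have "(x - y0) \<bullet> drift \<gamma> b x = (\<Sum>k\<in>UNIV. (x $ k - y0 $ k) \<bullet> (\<gamma> *\<^sub>R R x k)
          + (x $ k - y0 $ k) \<bullet> (if k = i then - kern x else if k = j then kern x else 0))"
        by (subst inner_vec_def) (simp only: drift_k inner_add_right vector_minus_component)
      also have "\<dots> = (\<Sum>k\<in>UNIV. (x $ k - y0 $ k) \<bullet> (\<gamma> *\<^sub>R R x k))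
          + (\<Sum>k\<in>UNIV. (x $ k - y0 $ k) \<bullet> (if k = i then - kern x else if k = j then kern x else 0))"
        by (rule sum.distrib)
      also have "(\<Sum>k\<in>UNIV. (x $ k - y0 $ k) \<bullet> (if k = i then - kern x else if k = j then kern x else 0))
        = (\<Sum>k\<in>{i, j}. (x $ k - y0 $ k) \<bullet> (if k = i then - kern x else if k = j then kern x else 0))"
        by (rule sum.mono_neutral_right) auto
      also have "\<dots> = - ((x $ i - x $ j) \<bullet> kern x)"
        using ij y0 by (simp add: inner_diff_left)
      also have "\<dots> = - \<gamma>" using kern_inner[OF x(2)] by simp
      also have "(\<Sum>k\<in>UNIV. (x $ k - y0 $ k) \<bullet> (\<gamma> *\<^sub>R R x k)) \<le> (\<Sum>k\<in>(UNIV::'n set). r * c)"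
      proof (intro sum_mono)
        fix k :: 'n
        have "norm (x $ k - y0 $ k) * norm (\<gamma> *\<^sub>R R x k) \<le> r * c"
          using n[of k] R_le[OF x(1), of k] r unfolding c_def by (intro mult_mono) auto
        then show "(x $ k - y0 $ k) \<bullet> (\<gamma> *\<^sub>R R x k) \<le> r * c"
          using Cauchy_Schwarz_ineq2[of "x $ k - y0 $ k" "\<gamma> *\<^sub>R R x k"] by linarith
      qed
      finally show ?thesis using \<gamma> by (simp add: N_def c_def)
    qed
  qed
qed

subsection \<open>The collision probability\<close>

text \<open>With \<open>n = (1, c)\<close>, each nonzero \<open>v\<close> rules out at most one
  slope \<open>c\<close>, so finitely many vectors leave infinitely many admissible slopes;
  \<open>e\<close> is \<open>n\<close> turned by a right angle.\<close>

lemma exists_direction: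
  fixes V :: "(real ^ 2) set"
  assumes "finite V" "0 \<notin> V"
  obtains n e :: "real ^ 2" where "e \<noteq> 0" "e \<bullet> n = 0" "\<And>v. v \<in> V \<Longrightarrow> v \<bullet> n \<noteq> 0"
proof -
  have ip: "v \<bullet> w = v $ 1 * w $ 1 + v $ 2 * w $ 2" for v w :: "real ^ 2"
    by (simp add: inner_vec_def sum_2)
  have "finite {c. v $ 1 + v $ 2 * c = 0}" if "v \<in> V" for v
  proof (cases "v $ 2 = 0")
    case True
    moreover have "v \<noteq> 0" using that assms(2) by auto
    ultimately have "v $ 1 \<noteq> 0" by (simp add: vec_eq_iff forall_2)
    then show ?thesis using True by simp
  next
    case False
    then have "{c. v $ 1 + v $ 2 * c = 0} \<subseteq> {- v $ 1 / v $ 2}" by (auto simp: field_simps)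
    then show ?thesis by (rule finite_subset) simp
  qed
  then have "finite (\<Union>v\<in>V. {c. v $ 1 + v $ 2 * c = 0})" using assms(1) by blast
  then obtain c where c: "c \<notin> (\<Union>v\<in>V. {c. v $ 1 + v $ 2 * c = 0})"
    using ex_new_if_finite[OF infinite_UNIV_char_0] by blast
  show thesis
  proof (rule that)
    have "(vector [- c, 1] :: real ^ 2) $ 2 \<noteq> 0" by simp
    then show "vector [- c, 1] \<noteq> (0 :: real ^ 2)" by force
    show "(vector [- c, 1] :: real ^ 2) \<bullet> vector [1, c] = 0" by (simp add: ip)
    show "v \<bullet> vector [1, c] \<noteq> 0" if "v \<in> V" for v using c that by (auto simp: ip)
  qed
qed

text \<open>The end point is collinear along a direction \<open>e\<close> orthogonal to some \<open>n\<close> that separates all the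
  particles of \<open>x0\<close>; along the segment the components in direction \<open>n\<close> stay distinct.\<close>

lemma exists_path_to_pair_collision:
  fixes x0 :: "real ^ 2 ^ 'n" and i j :: 'n
  assumes x0: "x0 \<in> noncolliding" and ij: "i \<noteq> j"
  obtains y0 where "y0 $ i = y0 $ j" "\<And>k l. k \<noteq> l \<Longrightarrow> {k, l} \<noteq> {i, j} \<Longrightarrow> y0 $ k \<noteq> y0 $ l"
    "\<And>\<rho>. 0 \<le> \<rho> \<Longrightarrow> \<rho> < 1 \<Longrightarrow> x0 + \<rho> *\<^sub>R (y0 - x0) \<in> noncolliding"
proof -
  define V where "V = (\<lambda>(k, l). x0 $ k - x0 $ l) ` {(k, l). k \<noteq> l}"
  have "finite V" unfolding V_def by (intro finite_imageI finite)
  moreover have "0 \<notin> V" using x0 by (auto simp: V_def)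
  ultimately obtain n e :: "real ^ 2" where e: "e \<noteq> 0" "e \<bullet> n = 0" and n: "\<And>v. v \<in> V \<Longrightarrow> v \<bullet> n \<noteq> 0"
    using exists_direction by blast
  obtain f :: "'n \<Rightarrow> nat" where f: "inj f" using finite_imp_inj_to_nat_seg[of "UNIV :: 'n set"] by auto
  \<comment> \<open>Distinct integer labels, except that \<open>j\<close> takes over the label of
    \<open>i\<close>: as multiples of \<open>e\<close> they place the particles so that only this
    pair coincides.\<close>
  define p where "p k = (if k = j then f i else f k)" for k
  define y0 :: "real ^ 2 ^ 'n" where "y0 = (\<chi> k. real (p k) *\<^sub>R e)"
  show thesis
  proof (rule that)
    show "y0 $ i = y0 $ j" by (simp add: y0_def p_def)
    show "y0 $ k \<noteq> y0 $ l" if "k \<noteq> l" "{k, l} \<noteq> {i, j}" for k l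
    proof -
      have "p k \<noteq> p l"
        using that injD[OF f, of k l] injD[OF f, of k i] injD[OF f, of i l] by (auto simp: p_def doubleton_eq_iff)
      then show ?thesis using e(1) by (simp add: y0_def)
    qed
    fix \<rho> :: real assume \<rho>: "0 \<le> \<rho>" "\<rho> < 1"
    show "x0 + \<rho> *\<^sub>R (y0 - x0) \<in> noncolliding"
    proof (intro CollectI allI impI)
      fix k l :: 'n assume kl: "k \<noteq> l"
      let ?c = "x0 + \<rho> *\<^sub>R (y0 - x0)"
      have "?c $ k - ?c $ l = (1 - \<rho>) *\<^sub>R (x0 $ k - x0 $ l) + (\<rho> * (real (p k) - real (p l))) *\<^sub>R e"
        by (simp add: y0_def algebra_simps)
      then have "(?c $ k - ?c $ l) \<bullet> n = (1 - \<rho>) * ((x0 $ k - x0 $ l) \<bullet> n)"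
        using e(2) by (simp add: inner_add_left)
      moreover have "(x0 $ k - x0 $ l) \<bullet> n \<noteq> 0" using kl by (intro n) (auto simp: V_def)
      ultimately have "(?c $ k - ?c $ l) \<bullet> n \<noteq> 0" using \<rho> by simp
      then show "?c $ k \<noteq> ?c $ l" by auto
    qed
  qed
qed

text \<open>Otherwise every point of \<open>S\<close> has a ball that \<open>Y\<close> almost surely
  misses; by Lindelof countably many of these balls cover \<open>S\<close>, so \<open>Y\<close>
  would almost surely miss \<open>S\<close>.\<close>

lemma (in prob_space) exists_support_point:
  fixes Y :: "'a \<Rightarrow> 'e::{metric_space, second_countable_topology}"
  assumes Y: "Y \<in> borel_measurable M" and S: "AE \<omega> in M. Y \<omega> \<in> S"
  obtains x where "x \<in> S" "\<And>\<epsilon>. \<epsilon> > 0 \<Longrightarrow> prob {\<omega>\<in>space M. Y \<omega> \<in> ball x \<epsilon>} > 0"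
proof (rule ccontr)
  assume "\<not> thesis"
  then have "\<forall>x\<in>S. \<exists>\<epsilon>>0. \<not> prob {\<omega>\<in>space M. Y \<omega> \<in> ball x \<epsilon>} > 0" using that by blast
  then obtain \<epsilon> where \<epsilon>: "\<And>x. x \<in> S \<Longrightarrow> \<epsilon> x > 0" "\<And>x. x \<in> S \<Longrightarrow> \<not> prob {\<omega>\<in>space M. Y \<omega> \<in> ball x (\<epsilon> x)} > 0"
    by metis
  obtain \<F> where \<F>: "\<F> \<subseteq> (\<lambda>x. ball x (\<epsilon> x)) ` S" "countable \<F>" "\<Union>\<F> = \<Union>((\<lambda>x. ball x (\<epsilon> x)) ` S)"
    by (rule Lindelof[of "(\<lambda>x. ball x (\<epsilon> x)) ` S"]) auto
  have "AE \<omega> in M. \<forall>B\<in>\<F>. Y \<omega> \<notin> B"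
    unfolding AE_ball_countable[OF \<F>(2)]
  proof
    fix B assume "B \<in> \<F>"
    then obtain x where x: "x \<in> S" "B = ball x (\<epsilon> x)" using \<F>(1) by auto
    have m: "{\<omega>\<in>space M. Y \<omega> \<in> ball x (\<epsilon> x)} = Y -` ball x (\<epsilon> x) \<inter> space M" by auto
    have "prob {\<omega>\<in>space M. Y \<omega> \<in> ball x (\<epsilon> x)} = 0"
      using \<epsilon>(2)[OF x(1)] measure_nonneg[of M "{\<omega>\<in>space M. Y \<omega> \<in> ball x (\<epsilon> x)}"] by linarith
    then show "AE \<omega> in M. Y \<omega> \<notin> B"
      unfolding x(2) m using measurable_sets[OF Y, of "ball x (\<epsilon> x)"]
      by (intro AE_I[of _ _ "Y -` ball x (\<epsilon> x) \<inter> space M"]) (auto simp: emeasure_eq_measure)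
  qed
  then have "AE \<omega> in M. False"
    using S
  proof eventually_elim
    case (elim \<omega>)
    then have "Y \<omega> \<in> \<Union>((\<lambda>x. ball x (\<epsilon> x)) ` S)" using \<epsilon>(1) by force
    then show False using elim(1) \<F>(3) by blast
  qed
  then show False by simp
qed

text \<open>The order of choices matters. The absence of collisions in the second half of the time
  interval fixes the radius \<open>r1\<close> first; only then is the first half used to steer the
  process to a point within \<open>r1 / 2\<close> of \<open>y0\<close>.\<close>

lemma collision_not_null:
  fixes b :: "real ^ 'n"
  assumes process: "additive_noise_process T \<sigma> M F (drift \<gamma> b) B X"
    and T: "T > 0" and \<sigma>: "\<sigma> > 0" and \<gamma>: "\<gamma> > 0"
    and b: "\<And>k. \<bar>b $ k\<bar> = 1" and opp: "b $ i = - b $ j"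
  shows "\<not> (AE \<omega> in M. \<forall>t\<in>{0..T}. X t \<omega> \<in> noncolliding)"
proof
  assume nc: "AE \<omega> in M. \<forall>t\<in>{0..T}. X t \<omega> \<in> noncolliding"
  interpret additive_noise_process T \<sigma> M F "drift \<gamma> b" B X by (rule process)
  have ij: "i \<noteq> j" using opp b[of i] by auto
  have "b $ j * b $ j = \<bar>b $ j\<bar> * \<bar>b $ j\<bar>" by simp
  then have opp': "b $ i * b $ j = - 1" unfolding opp b by simp
  have "AE \<omega> in M. X 0 \<omega> \<in> noncolliding" using nc by eventually_elim (use T in auto)
  then obtain x0 where x0: "x0 \<in> noncolliding" "\<And>\<epsilon>. \<epsilon> > 0 \<Longrightarrow> prob {\<omega>\<in>space M. X 0 \<omega> \<in> ball x0 \<epsilon>} > 0"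
    using exists_support_point[OF X_meas, of 0 noncolliding] T by (auto simp del: mem_Collect_eq)
  obtain y0 where y0: "y0 $ i = y0 $ j" "\<And>k l. k \<noteq> l \<Longrightarrow> {k, l} \<noteq> {i, j} \<Longrightarrow> y0 $ k \<noteq> y0 $ l"
    and path: "\<And>\<rho>. 0 \<le> \<rho> \<Longrightarrow> \<rho> < 1 \<Longrightarrow> x0 + \<rho> *\<^sub>R (y0 - x0) \<in> noncolliding"
    using exists_path_to_pair_collision[OF x0(1) ij] by blast
  obtain r \<Theta> where r: "r > 0" "{x \<in> cball y0 r. x $ i \<noteq> x $ j} \<subseteq> noncolliding"
    "\<And>x. x \<in> cball y0 r \<Longrightarrow> x $ i \<noteq> x $ j \<Longrightarrow> (x $ i - x $ j) \<bullet> (drift \<gamma> b x $ i - drift \<gamma> b x $ j) \<le> - \<gamma>"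
    "\<And>x. x \<in> cball y0 r \<Longrightarrow> x $ i \<noteq> x $ j \<Longrightarrow> (x - y0) \<bullet> drift \<gamma> b x \<le> \<Theta>"
    using drift_near_collision[OF \<gamma> b opp' ij y0] by blast
  have "AE \<omega> in M. \<forall>t\<in>{T/2..T}. X t \<omega> $ i \<noteq> X t \<omega> $ j"
    using nc
  proof eventually_elim
    case (elim \<omega>)
    show ?case
    proof
      fix t assume "t \<in> {T/2..T}"
      then have "t \<in> {0..T}" using T by auto
      then have "X t \<omega> \<in> noncolliding" using elim by blast
      then show "X t \<omega> $ i \<noteq> X t \<omega> $ j" using ij by blast
    qed
  qed
  then obtain r1 where r1: "r1 > 0" "prob {\<omega>\<in>space M. X (T/2) \<omega> \<in> ball y0 r1} = 0"
    using no_collision_avoids_neighbourhood[OF process \<sigma> _ _ _ ij y0(1) r(1) open_noncolliding drift_continuous r(2) \<gamma> r(3,4),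
      of "T/2" T] T by auto
  \<comment> \<open>The segment must stop short of \<open>y0\<close>, which is itself a collision.
    The fraction \<eta> that is left out is positive and so small that the end point is within
    \<open>r1 / 2\<close> of \<open>y0\<close>.\<close>
  define \<eta> where "\<eta> = min (1/2) (r1 / (2 * (norm (x0 - y0) + 1)))"
  have d0: "norm (x0 - y0) + 1 > 0" by (simp add: add_nonneg_pos)
  have "0 < r1 / (2 * (norm (x0 - y0) + 1))" using r1(1) d0 by simp
  then have \<eta>: "0 < \<eta>" "\<eta> \<le> 1/2" unfolding \<eta>_def by linarith+
  have "\<eta> * (norm (x0 - y0) + 1) \<le> r1 / (2 * (norm (x0 - y0) + 1)) * (norm (x0 - y0) + 1)"
    using d0 by (intro mult_right_mono) (auto simp: \<eta>_def)
  also have "\<dots> = r1 / 2"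
  proof -
    have "r1 / (2 * c) * c = r1 / 2" if "c > 0" for c using that by simp
    then show ?thesis using d0 .
  qed
  finally have \<eta>r: "\<eta> * norm (x0 - y0) \<le> r1 / 2" using \<eta> by (simp add: distrib_left)
  define q where "q = ((1 - \<eta>) * (2 / T)) *\<^sub>R (y0 - x0)"
  have "prob {\<omega>\<in>space M. X (T/2) \<omega> \<in> ball (x0 + (T/2 - 0) *\<^sub>R q) (r1 / 2)} > 0"
  proof (rule follows_path[OF _ _ _ _ open_noncolliding drift_continuous])
    fix t assume t: "t \<in> {0..T/2}"
    have "0 \<le> (1 - \<eta>) * (2 * t / T)" using t T \<eta> by simp
    moreover have "(1 - \<eta>) * (2 * t / T) < 1"
    proof -
      have "(1 - \<eta>) * (2 * t / T) \<le> (1 - \<eta>) * 1" using t T \<eta> by (intro mult_left_mono) (auto simp: divide_le_eq)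
      then show ?thesis using \<eta> by simp
    qed
    ultimately have "x0 + ((1 - \<eta>) * (2 * t / T)) *\<^sub>R (y0 - x0) \<in> noncolliding" by (rule path)
    moreover have "(t - 0) *\<^sub>R q = ((1 - \<eta>) * (2 * t / T)) *\<^sub>R (y0 - x0)" by (simp add: q_def)
    ultimately show "x0 + (t - 0) *\<^sub>R q \<in> noncolliding" by (simp only:)
  qed (use x0 T \<sigma> r1 in auto)
  also have "prob {\<omega>\<in>space M. X (T/2) \<omega> \<in> ball (x0 + (T/2 - 0) *\<^sub>R q) (r1 / 2)} \<le> prob {\<omega>\<in>space M. X (T/2) \<omega> \<in> ball y0 r1}"
  proof (rule finite_measure_mono)
    have "(T/2 - 0) *\<^sub>R q = (1 - \<eta>) *\<^sub>R (y0 - x0)" using T by (simp add: q_def)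
    then have "y0 - (x0 + (T/2 - 0) *\<^sub>R q) = \<eta> *\<^sub>R (y0 - x0)" by (simp add: algebra_simps)
    then have "dist y0 (x0 + (T/2 - 0) *\<^sub>R q) = \<eta> * norm (x0 - y0)"
      using \<eta> by (simp only: dist_norm norm_scaleR norm_minus_commute abs_of_pos)
    then have "ball (x0 + (T/2 - 0) *\<^sub>R q) (r1 / 2) \<subseteq> ball y0 r1"
      using \<eta>r unfolding ball_subset_ball_iff by (simp add: dist_commute)
    then show "{\<omega>\<in>space M. X (T/2) \<omega> \<in> ball (x0 + (T/2 - 0) *\<^sub>R q) (r1 / 2)} \<subseteq> {\<omega>\<in>space M. X (T/2) \<omega> \<in> ball y0 r1}" by blast
    have "X (T/2) -` ball y0 r1 \<inter> space M \<in> sets M" using T by (intro measurable_sets[OF X_meas]) auto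
    moreover have "X (T/2) -` ball y0 r1 \<inter> space M = {\<omega>\<in>space M. X (T/2) \<omega> \<in> ball y0 r1}" by auto
    ultimately show "{\<omega>\<in>space M. X (T/2) \<omega> \<in> ball y0 r1} \<in> sets M" by simp
  qed
  finally show False using r1(2) by simp
qed

section \<open>The minimal distance and the measurability of its infimum\<close>

lemma pair_distances_finite: "finite {norm (x $ i - x $ j) | i j. i \<noteq> j}"
  for x :: "real ^ 2 ^ 'n"
proof -
  have e: "{norm (x $ i - x $ j) | i j. i \<noteq> j} = (\<lambda>(i, j). norm (x $ i - x $ j)) ` {(i, j). i \<noteq> j}" by auto
  show ?thesis
    unfolding e by (intro finite_imageI finite)
qed

lemma pair_distances_nonempty:
  fixes x :: "real ^ 2 ^ 'n"
  assumes card: "CARD('n) \<ge> 2"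
  shows "{norm (x $ i - x $ j) | i j. i \<noteq> j} \<noteq> {}"
proof -
  obtain i j :: 'n where "i \<noteq> j"
    using card card_le_Suc0_iff_eq[of "UNIV :: 'n set"] by auto
  then show ?thesis by auto
qed

lemma min_distance_nonneg:
  fixes x :: "real ^ 2 ^ 'n"
  assumes card: "CARD('n) \<ge> 2"
  shows "0 \<le> min_distance x"
  unfolding min_distance_def using pair_distances_finite pair_distances_nonempty[OF card]
  by (subst Min_ge_iff) auto

lemma min_distance_eq_0_iff:
  fixes x :: "real ^ 2 ^ 'n"
  assumes card: "CARD('n) \<ge> 2"
  shows "min_distance x = 0 \<longleftrightarrow> x \<notin> noncolliding"
proof -
  have "min_distance x \<le> 0 \<longleftrightarrow> (\<exists>a\<in>{norm (x $ i - x $ j) | i j. i \<noteq> j}. a \<le> 0)"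
    unfolding min_distance_def by (rule Min_le_iff[OF pair_distances_finite pair_distances_nonempty[OF card]])
  also have "\<dots> \<longleftrightarrow> x \<notin> noncolliding" by force
  finally have "min_distance x \<le> 0 \<longleftrightarrow> x \<notin> noncolliding" .
  then show ?thesis using min_distance_nonneg[OF card, of x] by auto
qed

text \<open>Strict superlevel sets are finite intersections, and strict sublevel sets unions, of
  open conditions on single pairs.\<close>

lemma min_distance_continuous:
  assumes card: "CARD('n) \<ge> 2"
  shows "continuous_on UNIV (min_distance :: real ^ 2 ^ 'n \<Rightarrow> real)"
proof -
  have "((min_distance :: real ^ 2 ^ 'n \<Rightarrow> real) \<longlongrightarrow> min_distance x) (at x)" for x :: "real ^ 2 ^ 'n"
  proof (rule order_tendstoI)
    fix a assume "a < min_distance x"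
    moreover have "{y. a < min_distance y} = (\<Inter>i. \<Inter>j. {y :: real ^ 2 ^ 'n. i \<noteq> j \<longrightarrow> a < norm (y $ i - y $ j)})"
      unfolding min_distance_def using pair_distances_finite pair_distances_nonempty[OF card]
      by (subst Min_gr_iff) auto
    moreover have "open {y :: real ^ 2 ^ 'n. i \<noteq> j \<longrightarrow> a < norm (y $ i - y $ j)}" for i j
      by (cases "i = j") (auto intro!: open_Collect_less continuous_intros)
    ultimately have "open {y :: real ^ 2 ^ 'n. a < min_distance y}" "x \<in> {y. a < min_distance y}" by (auto intro!: open_INT)
    then show "\<forall>\<^sub>F y in at x. a < min_distance y" unfolding eventually_at_topological by blast
  next
    fix a assume "min_distance x < a"
    moreover have "{y. min_distance y < a} = (\<Union>i. \<Union>j. {y :: real ^ 2 ^ 'n. i \<noteq> j \<and> norm (y $ i - y $ j) < a})"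
      unfolding min_distance_def using pair_distances_finite pair_distances_nonempty[OF card]
      by (subst Min_less_iff) auto
    moreover have "open {y :: real ^ 2 ^ 'n. i \<noteq> j \<and> norm (y $ i - y $ j) < a}" for i j
      by (cases "i = j") (auto intro!: open_Collect_less continuous_intros)
    ultimately have "open {y :: real ^ 2 ^ 'n. min_distance y < a}" "x \<in> {y. min_distance y < a}" by (auto simp only: mem_Collect_eq intro!: open_UN)
    then show "\<forall>\<^sub>F y in at x. min_distance y < a" unfolding eventually_at_topological by blast
  qed
  then show ?thesis by (simp add: continuous_on_def)
qed

text \<open>The first claim is not a formality: \<open>measure\<close> is \<open>0\<close> on sets that are not measurable.\<close>

lemma (in additive_noise_process) inf_zero_in_completion:
  fixes f :: "'e \<Rightarrow> real"
  assumes T: "T > 0" and f: "continuous_on UNIV f" "\<And>x. 0 \<le> f x"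
  shows "{\<omega>\<in>space M. (INF t\<in>{0..T}. f (X t \<omega>)) = 0} \<in> sets (completion M)"
    and "AE \<omega> in M. (INF t\<in>{0..T}. f (X t \<omega>)) = 0 \<longleftrightarrow> (\<exists>t\<in>{0..T}. f (X t \<omega>) = 0)"
proof -
  have [measurable]: "f \<in> borel_measurable borel" using f(1) by (rule borel_measurable_continuous_onI)
  \<comment> \<open>A measurable stand-in for the event, built from countably many times. On a
    continuous path the two agree: the infimum is attained, and it is 0 iff values below every
    \<open>1 / real (Suc n)\<close> occur at the inspected times.\<close>
  define S where "S = (\<Inter>n. \<Union>r\<in>\<rat> \<inter> {0..1}. {\<omega>\<in>space M. f (X (r * T) \<omega>) < 1 / real (Suc n)})"
  have rT: "r * T \<in> {0..T}" if "r \<in> {0..1}" for r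
    using that T by (auto intro: mult_left_le_one_le)
  have "(\<Union>r\<in>\<rat> \<inter> {0..1}. {\<omega>\<in>space M. f (X (r * T) \<omega>) < 1 / real (Suc n)}) \<in> sets M" for n
  proof (rule sets.countable_UN'')
    show "countable (\<rat> \<inter> {0..1::real})" using countable_rat by (rule countable_subset[rotated]) auto
    fix r :: real assume "r \<in> \<rat> \<inter> {0..1}"
    then have [measurable]: "X (r * T) \<in> borel_measurable M" using rT[of r] by (intro X_meas) auto
    show "{\<omega>\<in>space M. f (X (r * T) \<omega>) < 1 / real (Suc n)} \<in> sets M" by measurable
  qed
  then have "S \<in> sets M" unfolding S_def by (intro sets.countable_INT') auto
  have cX: "continuous_on {0..T} (\<lambda>t. f (X t \<omega>))" if "continuous_on {0..T} (\<lambda>t. X t \<omega>)" for \<omega>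
    by (rule continuous_on_compose2[OF f(1)]) (use that in auto)
  have att: "\<exists>t0\<in>{0..T}. (\<forall>t\<in>{0..T}. f (X t0 \<omega>) \<le> f (X t \<omega>)) \<and> (INF t\<in>{0..T}. f (X t \<omega>)) = f (X t0 \<omega>)"
    if c: "continuous_on {0..T} (\<lambda>t. X t \<omega>)" for \<omega>
  proof -
    obtain t0 where t0: "t0 \<in> {0..T}" "\<And>t. t \<in> {0..T} \<Longrightarrow> f (X t0 \<omega>) \<le> f (X t \<omega>)"
      using continuous_attains_inf[OF _ _ cX[OF c]] T by auto
    then have "(INF t\<in>{0..T}. f (X t \<omega>)) = f (X t0 \<omega>)" by (intro cInf_eq_minimum) auto
    then show ?thesis using t0 by blast
  qed
  show "AE \<omega> in M. (INF t\<in>{0..T}. f (X t \<omega>)) = 0 \<longleftrightarrow> (\<exists>t\<in>{0..T}. f (X t \<omega>) = 0)"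
    using continuous_X
  proof eventually_elim
    case (elim \<omega>)
    then show ?case using att[OF elim] f(2) by (metis antisym)
  qed
  have "AE \<omega> in M. \<not> (((INF t\<in>{0..T}. f (X t \<omega>)) = 0) \<noteq> (\<omega> \<in> S))"
    using continuous_X AE_space
  proof eventually_elim
    case (elim \<omega>)
    obtain t0 where t0: "t0 \<in> {0..T}" "\<And>t. t \<in> {0..T} \<Longrightarrow> f (X t0 \<omega>) \<le> f (X t \<omega>)" "(INF t\<in>{0..T}. f (X t \<omega>)) = f (X t0 \<omega>)"
      using att[OF elim(1)] by blast
    have "f (X t0 \<omega>) = 0 \<longleftrightarrow> \<omega> \<in> S"
    proof
      assume z: "f (X t0 \<omega>) = 0"
      show "\<omega> \<in> S"
      proof (rule ccontr)
        assume "\<omega> \<notin> S"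
        then obtain n where n: "\<And>r. r \<in> \<rat> \<inter> {0..1} \<Longrightarrow> \<not> f (X (r * T) \<omega>) < 1 / real (Suc n)"
          using elim(2) unfolding S_def by blast
        have "- f (X t0 \<omega>) \<le> - (1 / real (Suc n))"
        proof (rule continuous_le_rational[OF T _ t0(1), of "\<lambda>t. - f (X t \<omega>)"])
          show "continuous_on {0..T} (\<lambda>t. - f (X t \<omega>))" using cX[OF elim(1)] by (rule continuous_on_minus)
          show "- f (X (0 + r * (T - 0)) \<omega>) \<le> - (1 / real (Suc n))" if "r \<in> \<rat> \<inter> {0..1}" for r
            using n[OF that] by simp
        qed
        then show False using z by simp
      qed
    next
      assume "\<omega> \<in> S"
      have "f (X t0 \<omega>) \<le> 1 / real (Suc n)" for n
      proof -
        obtain r where r: "r \<in> {0..1}" "f (X (r * T) \<omega>) < 1 / real (Suc n)" using \<open>\<omega> \<in> S\<close> unfolding S_def by blast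
        then show ?thesis using t0(2)[OF rT[OF r(1)]] by linarith
      qed
      moreover have "(\<lambda>n. 1 / real (Suc n)) \<longlonglongrightarrow> 0" using LIMSEQ_inverse_real_of_nat by (simp add: inverse_eq_divide)
      ultimately have "f (X t0 \<omega>) \<le> 0" by (intro LIMSEQ_le_const) auto
      then show "f (X t0 \<omega>) = 0" using f(2)[of "X t0 \<omega>"] by simp
    qed
    then show ?case using t0(3) by simp
  qed
  then have [measurable]: "Measurable.pred (completion M) (\<lambda>\<omega>. ((INF t\<in>{0..T}. f (X t \<omega>)) = 0) \<noteq> (\<omega> \<in> S))"
    by (rule sets_completion_AE)
  have [measurable]: "S \<in> sets (completion M)" using \<open>S \<in> sets M\<close> by simp
  \<comment> \<open>The event is recovered as the symmetric difference of \<open>S\<close> with the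
    set where the two disagree, a null set and hence measurable in the completion.\<close>
  have "{\<omega>\<in>space M. (INF t\<in>{0..T}. f (X t \<omega>)) = 0}
      = {\<omega>\<in>space (completion M). (((INF t\<in>{0..T}. f (X t \<omega>)) = 0) \<noteq> (\<omega> \<in> S)) \<noteq> (\<omega> \<in> S)}"
    by auto
  also have "\<dots> \<in> sets (completion M)" by measurable
  finally show "{\<omega>\<in>space M. (INF t\<in>{0..T}. f (X t \<omega>)) = 0} \<in> sets (completion M)" .
qed

text \<open>The probability is taken in the completion because the infimum runs over uncountably
  many times and paths are continuous only almost surely, so the event is measurable up to a null
  set. Its complement having probability one would give almost surely collision-free paths, since a
  continuous path attains its infimum.\<close>

theorem theorem3p1:
  fixes T \<sigma> \<gamma> :: real
    and b :: "real ^ 'n"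
    and M\<^sub>0 :: "'b measure" and X\<^sub>0 :: "'b \<Rightarrow> real ^ 2 ^ 'n"
    and M :: "'a measure" and F :: "real \<Rightarrow> 'a measure"
    and X :: "real \<Rightarrow> 'a \<Rightarrow> real ^ 2 ^ 'n"
  assumes "CARD('n) \<ge> 2"
    and "T > 0" and "\<sigma> > 0" and "\<gamma> > 0"
    and "\<And>i. b $ i \<in> {-1, 1}"
    and "\<exists>i j. b $ i = - b $ j"
    and "prob_space M\<^sub>0" and "X\<^sub>0 \<in> borel_measurable M\<^sub>0"
    and "exchangeable_wrt b M\<^sub>0 X\<^sub>0"
    and "weak_solution T \<sigma> \<gamma> b M\<^sub>0 X\<^sub>0 M F X"
  shows "\<P>(\<omega> in completion M. (INF t\<in>{0..T}. min_distance (X t \<omega>)) = 0) > 0"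
proof (rule ccontr)
  assume neg: "\<not> ?thesis"
  obtain B where process: "additive_noise_process T \<sigma> M F (drift \<gamma> b) B X"
    using weak_solution_process assms(10) by blast
  interpret additive_noise_process T \<sigma> M F "drift \<gamma> b" B X by (rule process)
  obtain i j where opp: "b $ i = - b $ j" using assms(6) by blast
  have b: "\<bar>b $ k\<bar> = 1" for k using assms(5)[of k] by auto
  note I = inf_zero_in_completion[OF assms(2) min_distance_continuous[OF assms(1)] min_distance_nonneg[OF assms(1)]]
  define S where "S = {\<omega>\<in>space (completion M). (INF t\<in>{0..T}. min_distance (X t \<omega>)) = 0}"
  have S: "S \<in> sets (completion M)" using I(1) by (simp add: S_def)
  interpret C: prob_space "completion M" by (rule prob_space_completion)
  have "C.prob S = 0" using neg measure_nonneg[of "completion M" S] unfolding S_def by linarith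
  then have "AE \<omega> in completion M. \<omega> \<notin> S"
    using S by (intro AE_I[of _ _ S]) (auto simp: C.emeasure_eq_measure)
  then have "AE \<omega> in M. \<omega> \<notin> S" by (simp only: AE_completion_iff)
  then have "AE \<omega> in M. \<forall>t\<in>{0..T}. X t \<omega> \<in> noncolliding"
    using I(2) AE_space
  proof eventually_elim
    case (elim \<omega>)
    then have "\<forall>t\<in>{0..T}. min_distance (X t \<omega>) \<noteq> 0" by (simp add: S_def)
    then show ?case unfolding min_distance_eq_0_iff[OF assms(1)] by blast
  qed
  then show False using collision_not_null[OF process assms(2-4) b opp] by blast
qed

end
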